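(* Let $\hbar>0$, $N\ge2$, and let $V\in C_b(\mathbb R^d)$ be an even, real-valued function whose Fourier transform $\hat V$ is a bounded measure. Let $t\mapsto R(t)$ be a time-dependent density operator, $R(t)\in\mathcal D(\mathfrak H)$ for all $t\in\mathbb R$, and let $\mathscr R(t)\in\mathcal L(\mathcal L(\mathfrak H),\mathcal L_s(\mathfrak H_N))$ be defined by $$\mathscr R(t):\ A\mapsto\operatorname{trace}_{\mathfrak H}(R(t)A)\,I_{\mathfrak H_N}.$$ Then $t\mapsto\mathscr R(t)$ is a solution to the evolution equation $$i\hbar\,\partial_t\mathscr R(t)=\mathbf{ad}^*\left(-\tfrac12\hbar^2\Delta\right)\mathscr R(t)-\mathcal C[V,\mathscr R(t),\mathscr R(t)]$$ if and only if $t\mapsto R(t)$ is a solution of the Hartree equation $$i\hbar\,\partial_tR(t)=\left[-\tfrac12\hbar^2\Delta+V_{R(t)},R(t)\right],$$ where $V_{R(t)}\in\mathcal L(\mathfrak H)$ is the operator defined by $(V_{R(t)}\phi)(x)=\phi(x)\int_{\mathbb R^d}V(x-z)\,r(t,z,z)\,dz$, with $r(t,x,y)$ the integral kernel of the trace-class operator $R(t)$.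
   Context: Notation. $\mathfrak H:=L^2(\mathbb R^d)$, $\mathfrak H_N:=\mathfrak H^{\otimes N}\simeq L^2((\mathbb R^d)^N)$; $\mathcal L(\cdot)$ and $\mathcal L^1(\cdot)$ denote bounded and trace-class operators, and $\mathcal L(X,Y)$ bounded linear maps. $\mathcal D(\mathfrak H)$ is the set of density operators ($R=R^*\ge0$, $\operatorname{trace}(R)=1$). For $\sigma\in\mathfrak S_N$, $(U_\sigma\Psi)(x_1,\dots,x_N)=\Psi(x_{\sigma^{-1}(1)},\dots,x_{\sigma^{-1}(N)})$; $\mathcal L_s(\mathfrak H_N)$ is the set of $F\in\mathcal L(\mathfrak H_N)$ with $U_\sigma FU_\sigma^*=F$ for all $\sigma\in\mathfrak S_N$. For a possibly unbounded operator $D$ on $\mathfrak H$ and $\Lambda\in\mathcal L(\mathcal L(\mathfrak H),\mathcal L_s(\mathfrak H_N))$, $(\mathbf{ad}^*(D)\Lambda)A:=-\Lambda[D,A]$ for all $A\in\mathcal L(\mathfrak H)$ such that $[D,A]\in\mathcal L(\mathfrak H)$. The evolution equation for $\mathscr R$ is understood after application to all $A\in\mathcal L(\mathfrak H)$ such that $[\Delta,A]\in\mathcal L(\mathfrak H)$; the Hartree equation is understood in the corresponding weak sense, i.e. $i\hbar\frac{d}{dt}\operatorname{trace}_{\mathfrak H}(R(t)A)=-\operatorname{trace}_{\mathfrak H}\left(R(t)[-\tfrac12\hbar^2\Delta+V_{R(t)},A]\right)$ for all such $A$. Interaction term. For $\omega\in\mathbb R^d$, $(E_\omega\psi)(x):=e^{i\omega\cdot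 x}\psi(x)$. For $\Lambda\in\mathcal L(\mathcal L(\mathfrak H),\mathcal L(\mathfrak H_N))$ and $B\in\mathcal L(\mathfrak H)$, $\Lambda(\bullet B):A\mapsto\Lambda(AB)$ and $\Lambda(B\bullet):A\mapsto\Lambda(BA)$. $\mathcal E_N$ is the set of pairs $(\Lambda_1,\Lambda_2)\in\mathcal L(\mathcal L(\mathfrak H),\mathcal L(\mathfrak H_N))^2$ such that for all $F\in\mathcal L^1(\mathfrak H_N)$ the map $\omega\mapsto\operatorname{trace}_{\mathfrak H_N}((\Lambda_1E_\omega^* )(\Lambda_2E_\omega)F)$ is continuous on $\mathbb R^d$. For $S\in\mathcal S'(\mathbb R^d)$ with $\hat S$ a bounded measure on $\mathbb R^d$, and $\Lambda_1,\Lambda_2$ such that $(\Lambda_1,\Lambda_2(\bullet A))$ and $(\Lambda_2(A\bullet),\Lambda_1)$ belong to $\mathcal E_N$ for all $A\in\mathcal L(\mathfrak H)$, $$\mathcal C[S,\Lambda_1,\Lambda_2]A:=\frac1{(2\pi)^d}\int_{\mathbb R^d}\left((\Lambda_1E_\omega^* )(\Lambda_2(E_\omega A))-(\Lambda_2(AE_\omega))(\Lambda_1E_\omega^* )\right)\hat S(d\omega),$$ an ultraweak integral (i.e. defined by taking the trace against every trace-class operator on $\mathfrak H_N$). Fourier convention: $\hat f(\omega)=\int f(x)e^{-i\omega\cdot x}dx$, so that $V(x)=\frac1{(2\pi)^d}\int e^{i\omega\cdot x}\hat V(d\omega)$. *)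

theory Defs
  imports "HOL-Analysis.Analysis"
begin

class complex_normed_vector = real_normed_vector +
  fixes scaleC :: "complex \<Rightarrow> 'a \<Rightarrow> 'a"  (infixr \<open>*\<^sub>C\<close> 75)
  assumes scaleC_add_right: "c *\<^sub>C (x + y) = c *\<^sub>C x + c *\<^sub>C y"
    and scaleC_add_left: "(b + c) *\<^sub>C x = b *\<^sub>C x + c *\<^sub>C x"
    and scaleC_scaleC: "b *\<^sub>C (c *\<^sub>C x) = (b * c) *\<^sub>C x"
    and scaleC_of_real: "complex_of_real r *\<^sub>C x = r *\<^sub>R x"
    and norm_scaleC: "norm (c *\<^sub>C x) = cmod c * norm x"

text \<open>The inner product is antilinear in the first argument.\<close>

class complex_inner = complex_normed_vector +
  fixes cinner :: "'a \<Rightarrow> 'a \<Rightarrow> complex"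
  assumes cinner_commute: "cinner x y = cnj (cinner y x)"
    and cinner_add_right: "cinner x (y + z) = cinner x y + cinner x z"
    and cinner_scaleC_right: "cinner x (c *\<^sub>C y) = c * cinner x y"
    and norm_eq_sqrt_cinner: "norm x = sqrt (Re (cinner x x))"

definition bounded_clinear ::
    "('a::complex_normed_vector \<Rightarrow> 'b::complex_normed_vector) \<Rightarrow> bool" where
  "bounded_clinear f \<longleftrightarrow> bounded_linear f \<and> (\<forall>c x. f (c *\<^sub>C x) = c *\<^sub>C f x)"

typedef (overloaded) ('a, 'b) cblinfun  (\<open>(_ \<Rightarrow>\<^sub>C\<^sub>L /_)\<close> [22, 21] 21) =
  "{f :: 'a::complex_normed_vector \<Rightarrow> 'b::complex_normed_vector. bounded_clinear f}"
  morphisms cblinfun_apply CBlinfun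
proof
  show "(\<lambda>_. 0) \<in> {f :: 'a \<Rightarrow> 'b. bounded_clinear f}"
    using norm_scaleC[where 'a='b, of _ 0] by (simp add: bounded_clinear_def bounded_linear_zero)
qed

declare [[coercion
  "cblinfun_apply :: ('a::complex_normed_vector \<Rightarrow>\<^sub>C\<^sub>L 'b::complex_normed_vector) \<Rightarrow> 'a \<Rightarrow> 'b"]]

setup_lifting type_definition_cblinfun

lemma scaleC_zero_right: "c *\<^sub>C (0::'a::complex_normed_vector) = 0"
  using norm_scaleC[of c "0::'a"] by simp

lemma scaleC_minus_right: "c *\<^sub>C (- x) = - (c *\<^sub>C (x::'a::complex_normed_vector))"
  by (metis scaleC_add_right scaleC_zero_right add.right_inverse add_eq_0_iff)

lemma scaleC_diff_right: "c *\<^sub>C (x - y) = c *\<^sub>C x - c *\<^sub>C (y::'a::complex_normed_vector)"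
  by (metis scaleC_add_right scaleC_minus_right diff_conv_add_uminus)

lemma scaleC_scaleR: "c *\<^sub>C (r *\<^sub>R x) = r *\<^sub>R (c *\<^sub>C (x::'a::complex_normed_vector))"
  by (metis scaleC_scaleC scaleC_of_real mult.commute)

lemma bounded_linear_scaleC: "bounded_linear (\<lambda>x::'a::complex_normed_vector. c *\<^sub>C x)"
  by (rule bounded_linear_intro[where K = "cmod c"])
    (simp_all add: scaleC_add_right scaleC_scaleR norm_scaleC mult.commute)

instantiation cblinfun :: (complex_normed_vector, complex_normed_vector) complex_normed_vector
begin

lift_definition norm_cblinfun :: "'a \<Rightarrow>\<^sub>C\<^sub>L 'b \<Rightarrow> real" is onorm .

lift_definition zero_cblinfun :: "'a \<Rightarrow>\<^sub>C\<^sub>L 'b" is "\<lambda>x. 0"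
  by (simp add: bounded_clinear_def bounded_linear_zero scaleC_zero_right)

lift_definition plus_cblinfun :: "'a \<Rightarrow>\<^sub>C\<^sub>L 'b \<Rightarrow> 'a \<Rightarrow>\<^sub>C\<^sub>L 'b \<Rightarrow> 'a \<Rightarrow>\<^sub>C\<^sub>L 'b"
  is "\<lambda>f g x. f x + g x"
  by (simp add: bounded_clinear_def bounded_linear_add scaleC_add_right)

lift_definition minus_cblinfun :: "'a \<Rightarrow>\<^sub>C\<^sub>L 'b \<Rightarrow> 'a \<Rightarrow>\<^sub>C\<^sub>L 'b \<Rightarrow> 'a \<Rightarrow>\<^sub>C\<^sub>L 'b"
  is "\<lambda>f g x. f x - g x"
  by (simp add: bounded_clinear_def bounded_linear_sub scaleC_diff_right)

lift_definition uminus_cblinfun :: "'a \<Rightarrow>\<^sub>C\<^sub>L 'b \<Rightarrow> 'a \<Rightarrow>\<^sub>C\<^sub>L 'b" is "\<lambda>f x. - f x"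
  by (simp add: bounded_clinear_def bounded_linear_minus scaleC_minus_right)

lift_definition scaleR_cblinfun :: "real \<Rightarrow> 'a \<Rightarrow>\<^sub>C\<^sub>L 'b \<Rightarrow> 'a \<Rightarrow>\<^sub>C\<^sub>L 'b" is "\<lambda>r f x. r *\<^sub>R f x"
  by (simp add: bounded_clinear_def bounded_linear_compose[OF bounded_linear_scaleR_right]
      scaleC_scaleR)

lift_definition scaleC_cblinfun :: "complex \<Rightarrow> 'a \<Rightarrow>\<^sub>C\<^sub>L 'b \<Rightarrow> 'a \<Rightarrow>\<^sub>C\<^sub>L 'b" is "\<lambda>c f x. c *\<^sub>C f x"
  by (simp add: bounded_clinear_def bounded_linear_compose[OF bounded_linear_scaleC]
      scaleC_scaleC mult.commute)

definition dist_cblinfun :: "'a \<Rightarrow>\<^sub>C\<^sub>L 'b \<Rightarrow> 'a \<Rightarrow>\<^sub>C\<^sub>L 'b \<Rightarrow> real" where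
  "dist_cblinfun a b = norm (a - b)"

definition [code del]:
  "(uniformity :: (('a \<Rightarrow>\<^sub>C\<^sub>L 'b) \<times> ('a \<Rightarrow>\<^sub>C\<^sub>L 'b)) filter) =
    (INF e\<in>{0 <..}. principal {(x, y). dist x y < e})"

definition open_cblinfun :: "('a \<Rightarrow>\<^sub>C\<^sub>L 'b) set \<Rightarrow> bool" where
  [code del]: "open_cblinfun S = (\<forall>x\<in>S. \<forall>\<^sub>F (x', y) in uniformity. x' = x \<longrightarrow> y \<in> S)"

definition sgn_cblinfun :: "'a \<Rightarrow>\<^sub>C\<^sub>L 'b \<Rightarrow> 'a \<Rightarrow>\<^sub>C\<^sub>L 'b" where
  "sgn_cblinfun x = scaleR (inverse (norm x)) x"

lemma onorm_scaleC:
  assumes f: "bounded_linear (f :: 'a \<Rightarrow> 'b)"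
  shows "onorm (\<lambda>x. c *\<^sub>C f x) = cmod c * onorm f"
proof (rule antisym)
  have le: "onorm (\<lambda>x. b *\<^sub>C g x) \<le> cmod b * onorm g"
    if g: "bounded_linear (g :: 'a \<Rightarrow> 'b)" for b g
  proof (rule onorm_bound)
    show "0 \<le> cmod b * onorm g" by (simp add: onorm_pos_le[OF g])
    show "norm (b *\<^sub>C g x) \<le> cmod b * onorm g * norm x" for x
      using mult_left_mono[OF onorm[OF g, of x], of "cmod b"]
      by (simp add: norm_scaleC mult.assoc)
  qed
  show "onorm (\<lambda>x. c *\<^sub>C f x) \<le> cmod c * onorm f" by (rule le[OF f])
  show "cmod c * onorm f \<le> onorm (\<lambda>x. c *\<^sub>C f x)"
  proof (cases "c = 0")
    case True
    then show ?thesis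
      using onorm_pos_le[OF bounded_linear_compose[OF bounded_linear_scaleC f]] by simp
  next
    case False
    have one: "1 *\<^sub>C y = y" for y :: 'b using scaleC_of_real[of 1 y] by simp
    have "onorm f = onorm (\<lambda>x. inverse c *\<^sub>C (c *\<^sub>C f x))"
      using False by (simp add: scaleC_scaleC one)
    also have "\<dots> \<le> cmod (inverse c) * onorm (\<lambda>x. c *\<^sub>C f x)"
      by (rule le[OF bounded_linear_compose[OF bounded_linear_scaleC f]])
    finally show ?thesis using False
      by (simp add: norm_divide field_simps)
  qed
qed

instance
proof
  fix a b c :: "'a \<Rightarrow>\<^sub>C\<^sub>L 'b" and r s :: real and u v :: complex
  show "a + b + c = a + (b + c)" by transfer (simp add: add.assoc)
  show "a + b = b + a" by transfer (simp add: add.commute)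
  show "0 + a = a" by transfer simp
  show "- a + a = 0" by transfer simp
  show "a - b = a + - b" by transfer simp
  show "r *\<^sub>R (a + b) = r *\<^sub>R a + r *\<^sub>R b" by transfer (simp add: scaleR_add_right)
  show "(r + s) *\<^sub>R a = r *\<^sub>R a + s *\<^sub>R a" by transfer (simp add: scaleR_add_left)
  show "r *\<^sub>R s *\<^sub>R a = (r * s) *\<^sub>R a" by transfer simp
  show "1 *\<^sub>R a = a" by transfer simp
  show "dist a b = norm (a - b)" by (simp add: dist_cblinfun_def)
  show "sgn a = inverse (norm a) *\<^sub>R a" by (simp add: sgn_cblinfun_def)
  show "(uniformity :: (('a \<Rightarrow>\<^sub>C\<^sub>L 'b) \<times> ('a \<Rightarrow>\<^sub>C\<^sub>L 'b)) filter) =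
      (INF e\<in>{0 <..}. principal {(x, y). dist x y < e})"
    by (simp add: uniformity_cblinfun_def)
  show "open S = (\<forall>x\<in>S. \<forall>\<^sub>F (x', y) in uniformity. x' = x \<longrightarrow> y \<in> S)"
    for S :: "('a \<Rightarrow>\<^sub>C\<^sub>L 'b) set"
    by (simp add: open_cblinfun_def)
  show "(norm a = 0) = (a = 0)"
    by transfer (auto simp: bounded_clinear_def onorm_eq_0)
  show "norm (a + b) \<le> norm a + norm b"
    by transfer (auto simp: bounded_clinear_def onorm_triangle)
  show "norm (r *\<^sub>R a) = \<bar>r\<bar> * norm a"
    by transfer (auto simp: bounded_clinear_def onorm_scaleR)
  show "u *\<^sub>C (a + b) = u *\<^sub>C a + u *\<^sub>C b" by transfer (simp add: scaleC_add_right)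
  show "(u + v) *\<^sub>C a = u *\<^sub>C a + v *\<^sub>C a" by transfer (simp add: scaleC_add_left)
  show "u *\<^sub>C v *\<^sub>C a = (u * v) *\<^sub>C a" by transfer (simp add: scaleC_scaleC)
  show "complex_of_real r *\<^sub>C a = r *\<^sub>R a" by transfer (simp add: scaleC_of_real)
  show "norm (u *\<^sub>C a) = cmod u * norm a"
    by transfer (auto simp: bounded_clinear_def onorm_scaleC)
qed

end

type_synonym 'h op = "'h \<Rightarrow>\<^sub>C\<^sub>L 'h"

lift_definition id_op :: "'h::complex_normed_vector op" is "\<lambda>x. x"
  by (simp add: bounded_clinear_def bounded_linear_ident)

lift_definition comp_op :: "'h::complex_normed_vector op \<Rightarrow> 'h op \<Rightarrow> 'h op"
  (infixl \<open>o\<^sub>C\<close> 70) is "\<lambda>A B x. A (B x)"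
  by (simp add: bounded_clinear_def bounded_linear_compose)

definition adj_op :: "'h::complex_inner op \<Rightarrow> 'h op"  (\<open>_*\<close> [1000] 1000) where
  "adj_op A = (THE B :: 'h op. \<forall>x y. cinner (B x) y = cinner x (A y))"


definition is_onb :: "'h::complex_inner set \<Rightarrow> bool" where
  "is_onb B \<longleftrightarrow> (\<forall>e\<in>B. \<forall>f\<in>B. cinner e f = (if e = f then 1 else 0)) \<and>
    (\<forall>x. (\<forall>e\<in>B. cinner e x = 0) \<longrightarrow> x = 0)"

definition positive_op :: "'h::complex_inner op \<Rightarrow> bool" where
  "positive_op A \<longleftrightarrow> (\<forall>x. cinner x (A x) \<in> \<real> \<and> 0 \<le> Re (cinner x (A x)))"

text \<open>The operator \<open>P\<close> below is the absolute value \<open>(A\<^sup>* A)\<^sup>1\<^sup>/\<^sup>2\<close> of \<open>A\<close>, i.e. the unique positive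
  square root.\<close>

definition trace_class :: "'h::complex_inner op \<Rightarrow> bool" where
  "trace_class A \<longleftrightarrow> (\<exists>P B. positive_op P \<and> P o\<^sub>C P = A* o\<^sub>C A \<and>
    is_onb B \<and> (\<lambda>e. cinner e (P e)) summable_on B)"

text \<open>On trace class operators the value does not depend on the orthonormal basis.\<close>

definition op_trace :: "'h::complex_inner op \<Rightarrow> complex" where
  "op_trace A = (\<Sum>\<^sub>\<infinity>e\<in>(SOME B. is_onb B). cinner e (A e))"

definition density_op :: "'h::complex_inner op \<Rightarrow> bool" where
  "density_op R \<longleftrightarrow> trace_class R \<and> R* = R \<and> positive_op R \<and> op_trace R = 1"


definition square_integrable :: "('a::euclidean_space \<Rightarrow> complex) \<Rightarrow> bool" where
  "square_integrable f \<longleftrightarrow> f \<in> borel_measurable borel \<and> integrable lborel (\<lambda>x. (cmod (f x))\<^sup>2)"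

definition L2_rel :: "('a::euclidean_space \<Rightarrow> complex) \<Rightarrow> ('a \<Rightarrow> complex) \<Rightarrow> bool" where
  "L2_rel f g \<longleftrightarrow> square_integrable f \<and> square_integrable g \<and> (AE x in lborel. f x = g x)"

lemma square_integrable_scale:
  assumes "square_integrable f"
  shows "square_integrable (\<lambda>x. c * f x)"
  using assms by (auto simp: square_integrable_def norm_mult power_mult_distrib)

lemma square_integrable_prod:
  assumes f: "square_integrable f" and g: "square_integrable g"
  shows "integrable lborel (\<lambda>x. cnj (f x) * g x)"
proof (rule Bochner_Integration.integrable_bound)
  show "integrable lborel (\<lambda>x. (cmod (f x))\<^sup>2 + (cmod (g x))\<^sup>2)"
    using f g by (simp add: square_integrable_def)
  show "(\<lambda>x. cnj (f x) * g x) \<in> borel_measurable lborel"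
    using f g by (auto simp: square_integrable_def intro!: borel_measurable_times
        borel_measurable_continuous_on[where f=cnj] continuous_intros)
  have "a * b \<le> a\<^sup>2 + b\<^sup>2" if "0 \<le> a" "0 \<le> b" for a b :: real
    using that sum_squares_bound[of a b] mult_nonneg_nonneg[of a b] by linarith
  then show "AE x in lborel. norm (cnj (f x) * g x) \<le> norm ((cmod (f x))\<^sup>2 + (cmod (g x))\<^sup>2)"
    by (auto simp: norm_mult)
qed

lemma square_integrable_add:
  assumes f: "square_integrable f" and g: "square_integrable g"
  shows "square_integrable (\<lambda>x. f x + g x)"
proof -
  have m: "(\<lambda>x. f x + g x) \<in> borel_measurable borel"
    using f g by (auto simp: square_integrable_def)
  have "integrable lborel (\<lambda>x. (cmod (f x + g x))\<^sup>2)"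
  proof (rule Bochner_Integration.integrable_bound)
    show "integrable lborel (\<lambda>x. 2 * (cmod (f x))\<^sup>2 + 2 * (cmod (g x))\<^sup>2)"
      using f g by (simp add: square_integrable_def)
    show "(\<lambda>x. (cmod (f x + g x))\<^sup>2) \<in> borel_measurable lborel"
      using m by simp
    have "(cmod (a + b))\<^sup>2 \<le> 2 * (cmod a)\<^sup>2 + 2 * (cmod b)\<^sup>2" for a b
    proof -
      have "(cmod (a + b))\<^sup>2 \<le> (cmod a + cmod b)\<^sup>2"
        by (intro power_mono norm_triangle_ineq norm_ge_zero)
      also have "\<dots> \<le> 2 * (cmod a)\<^sup>2 + 2 * (cmod b)\<^sup>2"
        using sum_squares_bound[of "cmod a" "cmod b"] by (simp add: power2_sum)
      finally show ?thesis .
    qed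
    then show "AE x in lborel. norm ((cmod (f x + g x))\<^sup>2) \<le>
        norm (2 * (cmod (f x))\<^sup>2 + 2 * (cmod (g x))\<^sup>2)"
      by auto
  qed
  with m show ?thesis by (simp add: square_integrable_def)
qed

quotient_type (overloaded) 'a L2 = "'a::euclidean_space \<Rightarrow> complex" / partial: L2_rel
  morphisms rep_L2 abs_L2
proof (rule part_equivpI)
  have "square_integrable (\<lambda>_::'a. 0)" by (simp add: square_integrable_def)
  then show "\<exists>f::'a \<Rightarrow> complex. L2_rel f f" by (auto simp: L2_rel_def)
  show "symp (L2_rel :: ('a \<Rightarrow> complex) \<Rightarrow> _)"
    by (auto simp: L2_rel_def symp_def)
  show "transp (L2_rel :: ('a \<Rightarrow> complex) \<Rightarrow> _)"
    unfolding L2_rel_def transp_def by (auto elim: AE_mp)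
qed

instantiation L2 :: (euclidean_space) real_inner
begin

lift_definition zero_L2 :: "'a L2" is "\<lambda>_. 0"
  by (simp add: L2_rel_def square_integrable_def)

lift_definition plus_L2 :: "'a L2 \<Rightarrow> 'a L2 \<Rightarrow> 'a L2" is "\<lambda>f g x. f x + g x"
  unfolding L2_rel_def by (auto intro: square_integrable_add)

lift_definition uminus_L2 :: "'a L2 \<Rightarrow> 'a L2" is "\<lambda>f x. - f x"
  unfolding L2_rel_def by (auto simp: square_integrable_def)

definition minus_L2 :: "'a L2 \<Rightarrow> 'a L2 \<Rightarrow> 'a L2" where
  "minus_L2 x y = x + - y"

lift_definition scaleR_L2 :: "real \<Rightarrow> 'a L2 \<Rightarrow> 'a L2" is "\<lambda>r f x. complex_of_real r * f x"
  unfolding L2_rel_def by (auto intro: square_integrable_scale)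

lift_definition inner_L2 :: "'a L2 \<Rightarrow> 'a L2 \<Rightarrow> real"
  is "\<lambda>f g. Re (\<integral>x. cnj (f x) * g x \<partial>lborel)"
proof -
  fix f f' g g' :: "'a \<Rightarrow> complex"
  assume a: "L2_rel f f'" and b: "L2_rel g g'"
  have "(\<integral>x. cnj (f x) * g x \<partial>lborel) = (\<integral>x. cnj (f' x) * g' x \<partial>lborel)"
    using a b square_integrable_prod[of f g] square_integrable_prod[of f' g']
    by (intro integral_cong_AE) (auto simp: L2_rel_def dest: borel_measurable_integrable)
  then show "Re (\<integral>x. cnj (f x) * g x \<partial>lborel) = Re (\<integral>x. cnj (f' x) * g' x \<partial>lborel)" by simp
qed

definition norm_L2 :: "'a L2 \<Rightarrow> real" where
  "norm_L2 x = sqrt (inner x x)"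

definition dist_L2 :: "'a L2 \<Rightarrow> 'a L2 \<Rightarrow> real" where
  "dist_L2 x y = norm (x - y)"

definition sgn_L2 :: "'a L2 \<Rightarrow> 'a L2" where
  "sgn_L2 x = inverse (norm x) *\<^sub>R x"

definition [code del]:
  "(uniformity :: ('a L2 \<times> 'a L2) filter) = (INF e\<in>{0 <..}. principal {(x, y). dist x y < e})"

definition open_L2 :: "'a L2 set \<Rightarrow> bool" where
  [code del]: "open_L2 S = (\<forall>x\<in>S. \<forall>\<^sub>F (x', y) in uniformity. x' = x \<longrightarrow> y \<in> S)"

instance
proof
  fix a b c :: "'a L2" and r s :: real
  show "a + b + c = a + (b + c)"
    by transfer (auto simp: L2_rel_def intro!: square_integrable_add)
  show "a + b = b + a"
    by transfer (auto simp: L2_rel_def intro!: square_integrable_add)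
  show "0 + a = a" by transfer (auto simp: L2_rel_def)
  show "- a + a = 0" by transfer (auto simp: L2_rel_def square_integrable_def)
  show "a - b = a + - b" by (simp add: minus_L2_def)
  show "r *\<^sub>R (a + b) = r *\<^sub>R a + r *\<^sub>R b"
    by transfer (auto simp: L2_rel_def distrib_left
        intro!: square_integrable_add square_integrable_scale)
  show "(r + s) *\<^sub>R a = r *\<^sub>R a + s *\<^sub>R a"
    by transfer (auto simp: L2_rel_def distrib_right
        intro!: square_integrable_add square_integrable_scale)
  show "r *\<^sub>R s *\<^sub>R a = (r * s) *\<^sub>R a"
    by transfer (auto simp: L2_rel_def mult.assoc intro!: square_integrable_scale)
  show "1 *\<^sub>R a = a" by transfer (auto simp: L2_rel_def)
  show "dist a b = norm (a - b)" by (simp add: dist_L2_def)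
  show "sgn a = inverse (norm a) *\<^sub>R a" by (simp add: sgn_L2_def)
  show "(uniformity :: ('a L2 \<times> 'a L2) filter) =
      (INF e\<in>{0 <..}. principal {(x, y). dist x y < e})"
    by (simp add: uniformity_L2_def)
  show "open S = (\<forall>x\<in>S. \<forall>\<^sub>F (x', y) in uniformity. x' = x \<longrightarrow> y \<in> S)" for S :: "'a L2 set"
    by (simp add: open_L2_def)
  show "norm a = sqrt (inner a a)" by (simp add: norm_L2_def)
  show "inner a b = inner b a"
  proof transfer
    fix f g :: "'a \<Rightarrow> complex"
    have "(\<integral>x. cnj (f x) * g x \<partial>lborel) = cnj (\<integral>x. cnj (g x) * f x \<partial>lborel)"
      by (subst Bochner_Integration.integral_cnj[symmetric]) (simp add: mult.commute)
    then show "Re (\<integral>x. cnj (f x) * g x \<partial>lborel) = Re (\<integral>x. cnj (g x) * f x \<partial>lborel)" by simp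
  qed
  show "inner (a + b) c = inner a c + inner b c"
    by transfer (auto simp: L2_rel_def distrib_right square_integrable_prod)
  show "inner (r *\<^sub>R a) b = r * inner a b"
    by transfer (simp add: mult.assoc)
  have sq: "Re (\<integral>x. cnj (f x) * f x \<partial>lborel) = (\<integral>x. (cmod (f x))\<^sup>2 \<partial>lborel)"
    if "square_integrable f" for f :: "'a \<Rightarrow> complex"
  proof -
    have "(\<integral>x. cnj (f x) * f x \<partial>lborel) = (\<integral>x. complex_of_real ((cmod (f x))\<^sup>2) \<partial>lborel)"
      by (metis complex_norm_square mult.commute)
    then show ?thesis by (metis Re_complex_of_real integral_complex_of_real)
  qed
  show "0 \<le> inner a a"
    by transfer (simp add: L2_rel_def sq)
  show "(inner a a = 0) = (a = 0)"
    by transfer (auto simp: L2_rel_def sq square_integrable_def integral_nonneg_eq_0_iff_AE)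
qed

end

instantiation L2 :: (euclidean_space) complex_inner
begin

lift_definition scaleC_L2 :: "complex \<Rightarrow> 'a L2 \<Rightarrow> 'a L2" is "\<lambda>c f x. c * f x"
  unfolding L2_rel_def by (auto intro: square_integrable_scale)

lift_definition cinner_L2 :: "'a L2 \<Rightarrow> 'a L2 \<Rightarrow> complex"
  is "\<lambda>f g. \<integral>x. cnj (f x) * g x \<partial>lborel"
proof -
  fix f f' g g' :: "'a \<Rightarrow> complex"
  assume a: "L2_rel f f'" and b: "L2_rel g g'"
  show "(\<integral>x. cnj (f x) * g x \<partial>lborel) = (\<integral>x. cnj (f' x) * g' x \<partial>lborel)"
    using a b square_integrable_prod[of f g] square_integrable_prod[of f' g']
    by (intro integral_cong_AE) (auto simp: L2_rel_def dest: borel_measurable_integrable)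
qed

instance
proof
  fix a b e :: "'a L2" and u v :: complex and r :: real
  show "u *\<^sub>C (a + b) = u *\<^sub>C a + u *\<^sub>C b"
    by transfer (auto simp: L2_rel_def distrib_left
        intro!: square_integrable_add square_integrable_scale)
  show "(u + v) *\<^sub>C a = u *\<^sub>C a + v *\<^sub>C a"
    by transfer (auto simp: L2_rel_def distrib_right
        intro!: square_integrable_add square_integrable_scale)
  show "u *\<^sub>C v *\<^sub>C a = (u * v) *\<^sub>C a"
    by transfer (auto simp: L2_rel_def mult.assoc intro!: square_integrable_scale)
  show "complex_of_real r *\<^sub>C a = r *\<^sub>R a"
    by transfer (auto simp: L2_rel_def intro!: square_integrable_scale)
  show n: "norm x = sqrt (Re (cinner x x))" for x :: "'a L2"
    unfolding norm_L2_def by transfer simp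
  show "cinner a b = cnj (cinner b a)"
    by transfer (subst Bochner_Integration.integral_cnj[symmetric], simp add: mult.commute)
  show "cinner a (b + e) = cinner a b + cinner a e"
    by transfer (auto simp: L2_rel_def distrib_left square_integrable_prod)
  show sr: "cinner x (u *\<^sub>C y) = u * cinner x y" for u and x y :: "'a L2"
    by transfer (simp add: mult.left_commute)
  have sl: "cinner (u *\<^sub>C a) y = cnj u * cinner a y" for y
    by transfer (simp add: mult.assoc)
  have "cinner (u *\<^sub>C a) (u *\<^sub>C a) = complex_of_real ((cmod u)\<^sup>2) * cinner a a"
    by (simp only: sl sr complex_norm_square mult.assoc)
  then show "norm (u *\<^sub>C a) = cmod u * norm a"
    by (simp add: n real_sqrt_mult)
qed

end

definition mult_op :: "('a::euclidean_space \<Rightarrow> complex) \<Rightarrow> 'a L2 op" where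
  "mult_op f = (THE T :: 'a L2 op. \<forall>\<psi>. AE x in lborel. rep_L2 (T \<psi>) x = f x * rep_L2 \<psi> x)"

definition E_op :: "'a::euclidean_space \<Rightarrow> 'a L2 op" where
  "E_op \<omega> = mult_op (\<lambda>x. exp (\<i> * complex_of_real (\<omega> \<bullet> x)))"

text \<open>The permutation \<open>\<sigma>\<close> of the particle labels acts on the \<open>N\<close>-particle space \<open>L\<^sup>2((\<real>\<^sup>d)\<^sup>N)\<close>,
  where \<open>N = CARD('n)\<close>.\<close>

definition perm_op :: "('n::finite \<Rightarrow> 'n) \<Rightarrow> ('a::euclidean_space ^ 'n) L2 op" where
  "perm_op \<sigma> = (THE U :: ('a ^ 'n) L2 op.
    \<forall>\<Psi>. AE x in lborel. rep_L2 (U \<Psi>) x = rep_L2 \<Psi> (\<chi> j. x $ inv \<sigma> j))"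

definition sym_ops :: "('a::euclidean_space ^ 'n::finite) L2 op set" where
  "sym_ops = {F. \<forall>\<sigma>. bij \<sigma> \<longrightarrow> perm_op \<sigma> o\<^sub>C F o\<^sub>C (perm_op \<sigma>)* = F}"

definition sym_superops ::
    "('a::euclidean_space L2 op \<Rightarrow> ('a ^ 'n::finite) L2 op) set" where
  "sym_superops = {\<Lambda>. bounded_clinear \<Lambda> \<and> range \<Lambda> \<subseteq> sym_ops}"


text \<open>A kernel is only determined almost everywhere, and the diagonal is a null set. For a trace class
  operator there is a kernel \<open>r\<close> for which \<open>h \<mapsto> r(x, x + h)\<close> is continuous with values in \<open>L\<^sup>1(dx)\<close>,
  and this continuity determines \<open>z \<mapsto> r(z, z)\<close> almost everywhere; the integral kernel of a trace class
  operator is always understood in this sense.\<close>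

definition is_integral_kernel ::
    "'a::euclidean_space L2 op \<Rightarrow> ('a \<Rightarrow> 'a \<Rightarrow> complex) \<Rightarrow> bool" where
  "is_integral_kernel R r \<longleftrightarrow>
    (\<lambda>(x, y). r x y) \<in> borel_measurable borel \<and>
    (\<forall>\<psi>. AE x in lborel. integrable lborel (\<lambda>y. r x y * rep_L2 \<psi> y) \<and>
      rep_L2 (R \<psi>) x = (\<integral>y. r x y * rep_L2 \<psi> y \<partial>lborel)) \<and>
    (\<forall>h. integrable lborel (\<lambda>x. r x (x + h))) \<and>
    (\<forall>h. ((\<lambda>k. \<integral>x. cmod (r x (x + k) - r x (x + h)) \<partial>lborel) \<longlongrightarrow> 0) (at h))"

definition integral_kernel :: "'a::euclidean_space L2 op \<Rightarrow> 'a \<Rightarrow> 'a \<Rightarrow> complex" where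
  "integral_kernel R = (SOME r. is_integral_kernel R r)"

definition mean_field :: "('a::euclidean_space \<Rightarrow> real) \<Rightarrow> 'a L2 op \<Rightarrow> 'a L2 op" where
  "mean_field V R =
    mult_op (\<lambda>x. \<integral>z. complex_of_real (V (x - z)) * integral_kernel R z z \<partial>lborel)"


fun partials :: "'a list \<Rightarrow> ('a::euclidean_space \<Rightarrow> complex) \<Rightarrow> 'a \<Rightarrow> complex" where
  "partials [] f = f"
| "partials (b # bs) f = partials bs (\<lambda>x. frechet_derivative f (at x) b)"

definition smooth :: "('a::euclidean_space \<Rightarrow> complex) \<Rightarrow> bool" where
  "smooth f \<longleftrightarrow> (\<forall>bs x. set bs \<subseteq> Basis \<longrightarrow> partials bs f differentiable (at x))"

definition test_function :: "('a::euclidean_space \<Rightarrow> complex) \<Rightarrow> bool" where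
  "test_function f \<longleftrightarrow> smooth f \<and> compact (closure {x. f x \<noteq> 0})"

definition schwartz :: "('a::euclidean_space \<Rightarrow> complex) \<Rightarrow> bool" where
  "schwartz f \<longleftrightarrow> smooth f \<and>
    (\<forall>bs k. set bs \<subseteq> Basis \<longrightarrow> bounded (range (\<lambda>x. norm x ^ k *\<^sub>R partials bs f x)))"

text \<open>Unbounded operators are represented by their graphs. The Laplacian has the maximal domain
  \<open>{\<psi> \<in> L\<^sup>2. \<Delta>\<psi> \<in> L\<^sup>2}\<close>, with \<open>\<Delta>\<psi>\<close> in the sense of distributions, which is the Sobolev space \<open>H\<^sup>2\<close>.\<close>

type_synonym 'h unbounded_op = "('h \<times> 'h) set"

definition laplacian :: "'a::euclidean_space L2 unbounded_op" where
  "laplacian = {(\<psi>, \<eta>). \<forall>\<phi>. test_function \<phi> \<longrightarrow>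
    (\<integral>x. rep_L2 \<psi> x * (\<Sum>b\<in>Basis. partials [b, b] \<phi> x) \<partial>lborel) =
    (\<integral>x. rep_L2 \<eta> x * \<phi> x \<partial>lborel)}"

definition uscale :: "complex \<Rightarrow> 'h::complex_normed_vector unbounded_op \<Rightarrow> 'h unbounded_op" where
  "uscale c D = {(\<psi>, c *\<^sub>C \<eta>) |\<psi> \<eta>. (\<psi>, \<eta>) \<in> D}"

definition uadd :: "'h::complex_normed_vector unbounded_op \<Rightarrow> 'h op \<Rightarrow> 'h unbounded_op" where
  "uadd D W = {(\<psi>, \<eta> + W \<psi>) |\<psi> \<eta>. (\<psi>, \<eta>) \<in> D}"

definition kinetic :: "real \<Rightarrow> 'a::euclidean_space L2 unbounded_op" where
  "kinetic hbar = uscale (- complex_of_real (hbar\<^sup>2 / 2)) laplacian"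

text \<open>The graph of \<open>A \<mapsto> [D, A]\<close> on the set of those bounded \<open>A\<close> for which \<open>[D, A]\<close> is bounded:
  \<open>A\<close> maps the domain of \<open>D\<close> into itself, and \<open>D A - A D\<close> is on this domain the restriction of a
  bounded operator \<open>K\<close>. For self-adjoint \<open>D\<close> the invariance of the domain also follows from
  boundedness of \<open>[D, A]\<close> as a quadratic form.\<close>

definition commutator :: "'h::complex_normed_vector unbounded_op \<Rightarrow> ('h op \<times> 'h op) set" where
  "commutator D = {(A :: 'h op, K :: 'h op). \<forall>(\<psi>, \<eta>)\<in>D. (A \<psi>, K \<psi> + A \<eta>) \<in> D}"

text \<open>The graph of the (in general only partially defined) map \<open>A \<mapsto> (ad\<^sup>*(D) \<Lambda>) A = - \<Lambda> [D, A]\<close>.\<close>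

definition ad_star ::
    "'h::complex_normed_vector unbounded_op \<Rightarrow> ('h op \<Rightarrow> 'k::complex_normed_vector op) \<Rightarrow>
      ('h op \<times> 'k op) set" where
  "ad_star D \<Lambda> = {(A, - \<Lambda> K) |A K. (A, K) \<in> commutator D}"


text \<open>A bounded complex Borel measure \<open>\<mu>\<close> is given by its polar decomposition \<open>\<mu> = u |\<mu>|\<close>.\<close>

type_synonym 'a complex_measure = "'a measure \<times> ('a \<Rightarrow> complex)"

definition bounded_complex_measure :: "'a::euclidean_space complex_measure \<Rightarrow> bool" where
  "bounded_complex_measure \<mu> \<longleftrightarrow> (case \<mu> of (m, u) \<Rightarrow>
    finite_measure m \<and> sets m = sets borel \<and> u \<in> borel_measurable borel \<and> (\<forall>\<omega>. cmod (u \<omega>) = 1))"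

definition cm_integral :: "'a complex_measure \<Rightarrow> ('a \<Rightarrow> complex) \<Rightarrow> complex" where
  "cm_integral \<mu> f = (case \<mu> of (m, u) \<Rightarrow> \<integral>\<omega>. f \<omega> * u \<omega> \<partial>m)"

definition fourier :: "('a::euclidean_space \<Rightarrow> complex) \<Rightarrow> 'a \<Rightarrow> complex" where
  "fourier f \<omega> = (\<integral>x. f x * exp (- \<i> * complex_of_real (\<omega> \<bullet> x)) \<partial>lborel)"

text \<open>Tempered distributions are functionals of which only the values on Schwartz functions matter.
  Continuity need not be imposed below: a functional whose Fourier transform is a bounded measure is
  automatically tempered.\<close>

type_synonym 'a distribution = "('a \<Rightarrow> complex) \<Rightarrow> complex"

definition distribution_of :: "('a::euclidean_space \<Rightarrow> real) \<Rightarrow> 'a distribution" where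
  "distribution_of V \<phi> = (\<integral>x. complex_of_real (V x) * \<phi> x \<partial>lborel)"

definition is_fourier_measure ::
    "'a::euclidean_space distribution \<Rightarrow> 'a complex_measure \<Rightarrow> bool" where
  "is_fourier_measure S \<mu> \<longleftrightarrow> bounded_complex_measure \<mu> \<and>
    (\<forall>\<phi>. schwartz \<phi> \<longrightarrow> S (fourier \<phi>) = cm_integral \<mu> \<phi>)"

definition fourier_measure :: "'a::euclidean_space distribution \<Rightarrow> 'a complex_measure" where
  "fourier_measure S = (SOME \<mu>. is_fourier_measure S \<mu>)"


definition EN ::
    "(('a::euclidean_space L2 op \<Rightarrow> 'k::complex_inner op) \<times> ('a L2 op \<Rightarrow> 'k op)) set" where
  "EN = {(\<Lambda>1, \<Lambda>2). bounded_clinear \<Lambda>1 \<and> bounded_clinear \<Lambda>2 \<and>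
    (\<forall>F. trace_class F \<longrightarrow>
      continuous_on UNIV (\<lambda>\<omega>. op_trace (\<Lambda>1 ((E_op \<omega>)*) o\<^sub>C \<Lambda>2 (E_op \<omega>) o\<^sub>C F)))}"

definition interaction_defined ::
    "('a::euclidean_space L2 op \<Rightarrow> 'k::complex_inner op) \<Rightarrow> ('a L2 op \<Rightarrow> 'k op) \<Rightarrow> bool" where
  "interaction_defined \<Lambda>1 \<Lambda>2 \<longleftrightarrow>
    (\<forall>A. (\<Lambda>1, \<lambda>B. \<Lambda>2 (B o\<^sub>C A)) \<in> EN \<and> (\<lambda>B. \<Lambda>2 (A o\<^sub>C B), \<Lambda>1) \<in> EN)"

definition ultraweak_integral ::
    "'a complex_measure \<Rightarrow> ('a \<Rightarrow> 'k::complex_inner op) \<Rightarrow> 'k op" where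
  "ultraweak_integral \<mu> G =
    (THE T. \<forall>F. trace_class F \<longrightarrow> op_trace (T o\<^sub>C F) = cm_integral \<mu> (\<lambda>\<omega>. op_trace (G \<omega> o\<^sub>C F)))"

definition interaction ::
    "'a::euclidean_space distribution \<Rightarrow> ('a L2 op \<Rightarrow> 'k::complex_inner op) \<Rightarrow>
      ('a L2 op \<Rightarrow> 'k op) \<Rightarrow> 'a L2 op \<Rightarrow> 'k op" where
  "interaction S \<Lambda>1 \<Lambda>2 A = complex_of_real (1 / (2 * pi) ^ DIM('a)) *\<^sub>C
    ultraweak_integral (fourier_measure S)
      (\<lambda>\<omega>. \<Lambda>1 ((E_op \<omega>)*) o\<^sub>C \<Lambda>2 (E_op \<omega> o\<^sub>C A) - \<Lambda>2 (A o\<^sub>C E_op \<omega>) o\<^sub>C \<Lambda>1 ((E_op \<omega>)*))"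


text \<open>The time derivative is taken in the norm of the bounded operators on the \<open>N\<close>-particle space.\<close>

definition evolution_solution ::
    "real \<Rightarrow> ('a::euclidean_space \<Rightarrow> real) \<Rightarrow>
      (real \<Rightarrow> 'a L2 op \<Rightarrow> ('a ^ 'n::finite) L2 op) \<Rightarrow> bool" where
  "evolution_solution hbar V \<Lambda> \<longleftrightarrow>
    (\<forall>t. \<Lambda> t \<in> sym_superops \<and> interaction_defined (\<Lambda> t) (\<Lambda> t)) \<and>
    (\<forall>t A T. A \<in> Domain (commutator laplacian) \<longrightarrow> (A, T) \<in> ad_star (kinetic hbar) (\<Lambda> t) \<longrightarrow>
      ((\<lambda>s. (\<i> * complex_of_real hbar) *\<^sub>C \<Lambda> s A) has_vector_derivative
        (T - interaction (distribution_of V) (\<Lambda> t) (\<Lambda> t) A)) (at t))"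

definition hartree_solution ::
    "real \<Rightarrow> ('a::euclidean_space \<Rightarrow> real) \<Rightarrow> (real \<Rightarrow> 'a L2 op) \<Rightarrow> bool" where
  "hartree_solution hbar V R \<longleftrightarrow>
    (\<forall>t A K. A \<in> Domain (commutator laplacian) \<longrightarrow>
      (A, K) \<in> commutator (uadd (kinetic hbar) (mean_field V (R t))) \<longrightarrow>
      ((\<lambda>s. \<i> * complex_of_real hbar * op_trace (R s o\<^sub>C A)) has_vector_derivative
        - op_trace (R t o\<^sub>C K)) (at t))"

end

theory Submission
  imports Defs "HOL-Probability.Probability"
begin

text \<open>Adding a bounded operator \<open>W\<close> to the kinetic energy shifts the commutators
  \<open>[D, A]\<close> by \<open>[W, A]\<close>, and \<open>\<R>(t)\<close> turns operators into multiples of the identity, so everything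
  reduces to the identity \<open>C[V, \<R>, \<R>] A = trace (R [V\<^sub>R, A]) I\<close>. To prove it, write
  \<open>R = \<Sum> |f\<^sub>n\<rangle>\<langle>f\<^sub>n|\<close> with \<open>\<Sum> \<parallel>f\<^sub>n\<parallel>\<^sup>2 < \<infinity>\<close>, whence \<open>trace (R B) = \<Sum> \<langle>f\<^sub>n, B f\<^sub>n\<rangle>\<close>. The kernel of \<open>R\<close> has the diagonal
  \<open>\<Sum> |f\<^sub>n(z)|\<^sup>2\<close>, which gives \<open>\<integral> e\<^sup>-\<^sup>i\<^sup>\<omega>\<^sup>z r(z, z) dz = trace (R E\<^sub>\<omega>\<^sup>*)\<close>, and Fourier inversion of \<open>V\<close> together with
  Fubini's theorem represents \<open>V\<^sub>R\<close> weakly as \<open>(2\<pi>)\<^sup>-\<^sup>d \<integral> trace (R E\<^sub>\<omega>\<^sup>*) E\<^sub>\<omega> V^(d\<omega>)\<close>.\<close>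

section \<open>Complex Hilbert spaces\<close>

text \<open>Most objects of the statement are descriptions: \<open>op_trace\<close> sums over some
  orthonormal basis, \<open>adj_op\<close>, \<open>mult_op\<close>, \<open>perm_op\<close> and
  \<open>ultraweak_integral\<close> are \<open>THE\<close>, \<open>integral_kernel\<close> and
  \<open>fourier_measure\<close> are \<open>SOME\<close>. Each needs existence, and uniqueness as
  far as it matters, before it can be computed. The kernel is the delicate case: it is fixed only
  almost everywhere, while V_R looks at its diagonal, a null set. The L1 continuity demanded by
  \<open>is_integral_kernel\<close> is therefore verified for an explicit kernel and then used to
  compare diagonals. The sums in \<open>op_trace\<close> are additive only where they converge. The
  series in f_n converges absolutely for every bounded B, so linearity, bounds and continuity of B
  \<mapsto> trace (R B) are read off from it. On the N-particle side only multiples of the identity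
  occur, which makes the ultraweak integral and the norm derivative scalar. Since V_R is bounded,
  the two Hamiltonians have the same domain and the same admissible A, and K \<mapsto> K + [V_R, A]
  matches their commutators one to one.\<close>

lemma scaleC_one [simp]: "1 *\<^sub>C x = (x::'a::complex_normed_vector)"
  using scaleC_of_real[of 1 x] by simp

lemma scaleC_zero_left [simp]: "0 *\<^sub>C x = (0::'a::complex_normed_vector)"
  using scaleC_of_real[of 0 x] by simp

declare scaleC_zero_right [simp]

lemma scaleC_minus_left: "(- c) *\<^sub>C x = - (c *\<^sub>C (x::'a::complex_normed_vector))"
  by (metis scaleC_add_left scaleC_zero_left add.right_inverse add_eq_0_iff)

lemma scaleC_diff_left: "(b - c) *\<^sub>C x = b *\<^sub>C x - c *\<^sub>C (x::'a::complex_normed_vector)"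
  using scaleC_add_left[of b "- c" x] by (simp add: scaleC_minus_left)

lemma bounded_linear_scaleC_left:
  "bounded_linear (\<lambda>c. c *\<^sub>C (x::'a::complex_normed_vector))"
proof (rule bounded_linear_intro[where K = "norm x"])
  show "(r *\<^sub>R c) *\<^sub>C x = r *\<^sub>R (c *\<^sub>C x)" for r c
    by (simp add: scaleR_conv_of_real flip: scaleC_scaleC scaleC_of_real)
qed (simp_all add: scaleC_add_left norm_scaleC)

lemma cinner_add_left: "cinner (x + y) z = cinner x z + cinner y z"
  using cinner_commute[of "x + y" z] cinner_commute[of x z] cinner_commute[of y z]
  by (simp add: cinner_add_right)

lemma cinner_scaleC_left: "cinner (c *\<^sub>C x) y = cnj c * cinner x y"
  using cinner_commute[of "c *\<^sub>C x" y] cinner_commute[of x y] by (simp add: cinner_scaleC_right)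

lemma cinner_zero_right [simp]: "cinner x 0 = 0"
  using cinner_scaleC_right[of x 0 0] by simp

lemma cinner_zero_left [simp]: "cinner 0 x = 0"
  using cinner_commute[of 0 x] by simp

lemma cinner_minus_right: "cinner x (- y) = - cinner x y"
  using cinner_add_right[of x y "- y"] by (simp add: add_eq_0_iff)

lemma cinner_diff_right: "cinner x (y - z) = cinner x y - cinner x z"
  using cinner_add_right[of x y "- z"] by (simp add: cinner_minus_right)

lemma cinner_minus_left: "cinner (- x) y = - cinner x y"
  using cinner_commute[of "- x" y] cinner_commute[of x y] by (simp add: cinner_minus_right)

lemma cinner_diff_left: "cinner (x - y) z = cinner x z - cinner y z"
  using cinner_add_left[of x "- y" z] by (simp add: cinner_minus_left)

lemma cinner_sum_right: "cinner x (\<Sum>i\<in>I. f i) = (\<Sum>i\<in>I. cinner x (f i))"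
  by (induction I rule: infinite_finite_induct) (auto simp: cinner_add_right)

lemma cinner_sum_left: "cinner (\<Sum>i\<in>I. f i) x = (\<Sum>i\<in>I. cinner (f i) x)"
  by (induction I rule: infinite_finite_induct) (auto simp: cinner_add_left)

lemma cinner_self: "cinner x x = of_real ((norm x)\<^sup>2)"
proof (rule complex_eqI)
  \<comment> \<open>Positivity is not an axiom of \<open>complex_inner\<close>; it comes from the
    norm, because \<open>sqrt\<close> is negative on negative reals.\<close>
  have "0 \<le> Re (cinner x x)"
    using norm_ge_zero[of x] unfolding norm_eq_sqrt_cinner by simp
  then show "Re (cinner x x) = Re (of_real ((norm x)\<^sup>2))"
    by (simp add: norm_eq_sqrt_cinner)
  show "Im (cinner x x) = Im (of_real ((norm x)\<^sup>2))"
    using arg_cong[OF cinner_commute[of x x], of Im] by simp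
qed

lemma cinner_mult_swap: "cinner x y * cinner y x = of_real ((cmod (cinner y x))\<^sup>2)"
  by (subst cinner_commute) (simp only: complex_norm_square mult.commute)

lemma cblinfun_linear: "bounded_linear (cblinfun_apply A)"
  using cblinfun_apply[of A] by (simp add: bounded_clinear_def)

lemma cblinfun_add: "cblinfun_apply A (x + y) = A x + A y"
  by (simp add: cblinfun_linear linear_simps)

lemma cblinfun_zero [simp]: "cblinfun_apply A 0 = 0"
  by (simp add: cblinfun_linear linear_simps)

lemma cblinfun_scaleC: "cblinfun_apply A (c *\<^sub>C x) = c *\<^sub>C A x"
  using cblinfun_apply[of A] by (simp add: bounded_clinear_def)

lemma cblinfun_sum: "cblinfun_apply A (\<Sum>i\<in>I. f i) = (\<Sum>i\<in>I. A (f i))"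
  by (induction I rule: infinite_finite_induct) (auto simp: cblinfun_add)

lemma norm_cblinfun: "norm (cblinfun_apply A x) \<le> norm A * norm x"
  using onorm[OF cblinfun_linear[of A]] by (simp add: norm_cblinfun.rep_eq)

lemma cblinfun_eqI: "(\<And>x. cblinfun_apply A x = cblinfun_apply B x) \<Longrightarrow> A = B"
  by (metis cblinfun_apply_inject ext)

lemma cblinfun_exists:
  assumes "\<And>x y. f (x + y) = f x + f y" and "\<And>c x. f (c *\<^sub>C x) = c *\<^sub>C f x"
    and "\<And>x. norm (f x) \<le> K * norm x"
  obtains T where "\<And>x. cblinfun_apply T x = f x"
proof -
  have "bounded_linear f"
  proof (rule bounded_linear_intro[where K = K])
    show "f (r *\<^sub>R x) = r *\<^sub>R f x" for r x
      using assms(2)[of "of_real r" x] by (simp add: scaleC_of_real)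
  qed (use assms in \<open>auto simp: mult.commute\<close>)
  then have "bounded_clinear f" using assms(2) by (simp add: bounded_clinear_def)
  then show thesis using that[of "CBlinfun f"] by (simp add: CBlinfun_inverse)
qed

lemmas cblinfun_rep = plus_cblinfun.rep_eq minus_cblinfun.rep_eq uminus_cblinfun.rep_eq
  scaleC_cblinfun.rep_eq zero_cblinfun.rep_eq id_op.rep_eq comp_op.rep_eq

section \<open>Positive operators and their quadratic forms\<close>

text \<open>Polarization: real values of the form at \<open>x + y\<close> make the imaginary parts
  of the mixed terms antisymmetric, real values at \<open>x + \<i> *\<^sub>C y\<close> make their
  real parts symmetric.\<close>

lemma positive_op_hermitian:
  assumes P: "positive_op P"
  shows "cinner x (P y) = cinner (P x) y"
proof -
  have im: "Im (cinner z (P z)) = 0" for z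
    using P unfolding positive_op_def by (metis complex_is_Real_iff)
  have "Im (cinner x (P y) + cinner y (P x)) = 0"
    using im[of "x + y"] im[of x] im[of y]
    by (simp add: cblinfun_add cinner_add_left cinner_add_right)
  moreover have "Re (cinner x (P y)) = Re (cinner y (P x))"
    using im[of "x + \<i> *\<^sub>C y"] im[of x] im[of y]
    by (simp add: cblinfun_add cblinfun_scaleC cinner_add_left cinner_add_right
        cinner_scaleC_left cinner_scaleC_right)
  ultimately have "cinner x (P y) = cnj (cinner y (P x))"
    by (intro complex_eqI) auto
  then show ?thesis by (metis cinner_commute)
qed

lemma positive_op_Re: "positive_op P \<Longrightarrow> cinner x (P x) = of_real (Re (cinner x (P x)))"
  unfolding positive_op_def by (metis of_real_Re)

text \<open>Discriminant argument for the form of \<open>P\<close>. The form may be degenerate, so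
  division by its value at \<open>y\<close> is avoided by an inequality in two real
  parameters.\<close>

lemma positive_op_Cauchy_Schwarz:
  assumes P: "positive_op P"
  shows "(cmod (cinner x (P y)))\<^sup>2 \<le> Re (cinner x (P x)) * Re (cinner y (P y))"
proof -
  define b where "b = cinner x (P y)"
  define p where "p = Re (cinner x (P x))"
  define r where "r = Re (cinner y (P y))"
  have px: "cinner x (P x) = of_real p" and ry: "cinner y (P y) = of_real r"
    using positive_op_Re[OF P] by (simp_all add: p_def r_def)
  have r0: "0 \<le> r" using P by (simp add: r_def positive_op_def)
  have b': "cinner y (P x) = cnj b"
    unfolding b_def by (metis P cinner_commute positive_op_hermitian)
  \<comment> \<open>Positivity of the form at s x - t (cnj b) y; the factor \<open>cnj b\<close>
    turns each cross term into the real number -s t |b|^2.\<close>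
  have key: "0 \<le> s\<^sup>2 * p - 2 * s * t * (cmod b)\<^sup>2 + t\<^sup>2 * (cmod b)\<^sup>2 * r" for s t :: real
  proof -
    define c where "c = - (of_real t * cnj b)"
    define z where "z = of_real s *\<^sub>C x + c *\<^sub>C y"
    have "cinner z (P z) = of_real (s\<^sup>2) * cinner x (P x) + of_real s * c * b
        + cnj c * of_real s * cnj b + cnj c * c * cinner y (P y)"
      unfolding z_def
      by (simp add: cblinfun_add cblinfun_scaleC cinner_add_left cinner_add_right
          cinner_scaleC_left cinner_scaleC_right b' flip: b_def) (simp add: algebra_simps power2_eq_square)
    also have "\<dots> = of_real (s\<^sup>2 * p - 2 * s * t * (cmod b)\<^sup>2 + t\<^sup>2 * (cmod b)\<^sup>2 * r)"
    proof -
      have B: "b * cnj b = of_real ((cmod b)\<^sup>2)" by (rule complex_norm_square[symmetric])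
      have 1: "c * b = of_real (- t * (cmod b)\<^sup>2)"
        "cnj c * cnj b = of_real (- t * (cmod b)\<^sup>2)"
        unfolding of_real_mult B[symmetric] by (simp_all add: c_def)
      have 2: "cnj c * c = of_real (t\<^sup>2 * (cmod b)\<^sup>2)"
        unfolding of_real_mult B[symmetric] by (simp add: c_def power2_eq_square)
      have 3: "of_real s * c * b + cnj c * of_real s * cnj b =
          of_real (2 * s * (- t * (cmod b)\<^sup>2))"
        using 1 by (simp add: mult.assoc mult.left_commute[of "cnj c"])
      show ?thesis
        unfolding px ry add.assoc[of "of_real (s\<^sup>2) * of_real p"] 3 2
        by (simp add: algebra_simps)
    qed
    finally show ?thesis using P by (metis positive_op_def Re_complex_of_real)
  qed
  show ?thesis
  proof (cases "r = 0")
    case True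
    have "(cmod b)\<^sup>2 = 0"
    proof (rule ccontr)
      assume n: "(cmod b)\<^sup>2 \<noteq> 0"
      \<comment> \<open>For r = 0 the inequality is linear in t, and this t drives its value to
        -1.\<close>
      then have "0 \<le> p - 2 * ((p + 1) / (2 * (cmod b)\<^sup>2)) * (cmod b)\<^sup>2"
        using key[of 1 "(p + 1) / (2 * (cmod b)\<^sup>2)"] True by simp
      also have "\<dots> = -1" using n by (simp add: field_simps)
      finally show False by simp
    qed
    then show ?thesis using True by (simp add: b_def r_def)
  next
    case False
    \<comment> \<open>The values s = r and t = 1 leave r times the wanted difference.\<close>
    have "0 \<le> r * (r * p - (cmod b)\<^sup>2)"
      using key[of r 1] by (simp add: algebra_simps power2_eq_square)
    then show ?thesis
      using False r0 unfolding b_def[symmetric] p_def[symmetric] r_def[symmetric]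
      by (simp add: zero_le_mult_iff mult.commute)
  qed
qed

lemma positive_op_id: "positive_op id_op"
  by (simp add: positive_op_def id_op.rep_eq cinner_self del: of_real_power)

lemma cinner_Cauchy_Schwarz: "cmod (cinner x y) \<le> norm x * norm y"
proof -
  have "(cmod (cinner x y))\<^sup>2 \<le> (norm x * norm y)\<^sup>2"
    using positive_op_Cauchy_Schwarz[OF positive_op_id, of x y]
    by (simp add: id_op.rep_eq cinner_self power_mult_distrib del: of_real_power)
  then show ?thesis by (rule power2_le_imp_le) simp
qed

text \<open>Cauchy-Schwarz for the form of \<open>P\<close> at the vectors \<open>P x\<close> and
  \<open>x\<close> bounds the fourth power of the norm of \<open>P x\<close> by a nonpositive
  product.\<close>

lemma positive_op_eq_0:
  assumes "positive_op P" "Re (cinner x (P x)) \<le> 0"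
  shows "P x = 0"
proof -
  have "(cmod (cinner (P x) (P x)))\<^sup>2 \<le> Re (cinner (P x) (P (P x))) * Re (cinner x (P x))"
    by (rule positive_op_Cauchy_Schwarz[OF assms(1)])
  moreover have "0 \<le> Re (cinner (P x) (P (P x)))" using assms(1) by (simp add: positive_op_def)
  ultimately have "(cmod (cinner (P x) (P x)))\<^sup>2 \<le> 0"
    using assms(2) by (meson mult_nonneg_nonpos order_trans)
  then show ?thesis by (simp add: cinner_self)
qed

lemma bounded_linear_cinner_right: "bounded_linear (cinner x)"
proof (rule bounded_linear_intro[where K = "norm x"])
  show "cinner x (r *\<^sub>R y) = r *\<^sub>R cinner x y" for r y
    using cinner_scaleC_right[of x "of_real r" y]
    by (simp add: scaleC_of_real scaleR_conv_of_real)
  show "norm (cinner x y) \<le> norm y * norm x" for y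
    using cinner_Cauchy_Schwarz[of x y] by (simp add: mult.commute)
qed (simp add: cinner_add_right)

lemma bounded_linear_cinner_left: "bounded_linear (\<lambda>x. cinner x y)"
proof (rule bounded_linear_intro[where K = "norm y"])
  show "cinner (r *\<^sub>R x) y = r *\<^sub>R cinner x y" for r x
    using cinner_scaleC_left[of "of_real r" x y]
    by (simp add: scaleC_of_real scaleR_conv_of_real)
qed (use cinner_Cauchy_Schwarz in \<open>auto simp: cinner_add_left\<close>)

lemma cinner_ext: "(\<And>z. cinner z x = cinner z y) \<Longrightarrow> x = y"
  using cinner_diff_right[of "x - y" x y] by (simp add: cinner_self)

section \<open>Orthonormal bases\<close>

definition orthonormal :: "'h::complex_inner set \<Rightarrow> bool" where
  "orthonormal B \<longleftrightarrow> (\<forall>e\<in>B. \<forall>f\<in>B. cinner e f = (if e = f then 1 else 0))"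

lemma is_onb_iff: "is_onb B \<longleftrightarrow> orthonormal B \<and> (\<forall>x. (\<forall>e\<in>B. cinner e x = 0) \<longrightarrow> x = 0)"
  by (simp add: is_onb_def orthonormal_def)

text \<open>As \<open>is_onb\<close> asks for a trivial orthogonal complement, a maximal orthonormal
  set from Zorn's lemma is a basis: a nonzero vector orthogonal to it could be normalized and added.
  This gives content to the choice in \<open>op_trace\<close>.\<close>

lemma is_onb_exists: "\<exists>B :: 'h::complex_inner set. is_onb B"
proof -
  have "\<exists>M\<in>{B :: 'h set. orthonormal B}. \<forall>X\<in>{B. orthonormal B}. M \<subseteq> X \<longrightarrow> X = M"
  proof (rule subset_Zorn)
    fix C assume C: "subset.chain {B :: 'h set. orthonormal B} C"
    have "orthonormal (\<Union>C)"
      unfolding orthonormal_def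
    proof (intro ballI)
      fix e f assume "e \<in> \<Union>C" "f \<in> \<Union>C"
      then obtain X Y where XY: "X \<in> C" "e \<in> X" "Y \<in> C" "f \<in> Y" by blast
      then have "X \<subseteq> Y \<or> Y \<subseteq> X" using C by (auto simp: subset.chain_def)
      then obtain Z where "Z \<in> C" "e \<in> Z" "f \<in> Z" using XY by blast
      moreover have "orthonormal Z" using C \<open>Z \<in> C\<close> by (auto simp: subset.chain_def)
      ultimately show "cinner e f = (if e = f then 1 else 0)" by (simp add: orthonormal_def)
    qed
    then show "\<exists>U\<in>{B. orthonormal B}. \<forall>X\<in>C. X \<subseteq> U" by (intro bexI[of _ "\<Union>C"]) auto
  qed
  then obtain M :: "'h set" where M: "orthonormal M"
    and max: "\<And>X. orthonormal X \<Longrightarrow> M \<subseteq> X \<Longrightarrow> X = M" by auto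
  have "x = 0" if x: "\<forall>e\<in>M. cinner e x = 0" for x
  proof (rule ccontr)
    assume nz: "x \<noteq> 0"
    define u where "u = of_real (1 / norm x) *\<^sub>C x"
    have "cinner u u = 1"
      using nz by (simp add: u_def cinner_self norm_scaleC norm_divide del: of_real_divide)
    moreover have u: "cinner e u = 0" if "e \<in> M" for e
      using x that by (simp add: u_def cinner_scaleC_right)
    moreover have "cinner u e = 0" if "e \<in> M" for e
      using u[OF that] cinner_commute[of u e] by simp
    ultimately have "orthonormal (insert u M)"
      using M unfolding orthonormal_def by auto
    then have "u \<in> M" using max by blast
    then show False using u \<open>cinner u u = 1\<close> by fastforce
  qed
  then show ?thesis using M is_onb_iff by blast
qed

lemma orthonormal_norm_sum:
  assumes B: "orthonormal B" and F: "finite F" "F \<subseteq> B"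
  shows "(norm (\<Sum>e\<in>F. c e *\<^sub>C e))\<^sup>2 = (\<Sum>e\<in>F. (cmod (c e))\<^sup>2)"
proof -
  have "cinner (\<Sum>e\<in>F. c e *\<^sub>C e) (\<Sum>e\<in>F. c e *\<^sub>C e) =
      (\<Sum>e\<in>F. \<Sum>f\<in>F. cnj (c e) * c f * cinner e f)"
    unfolding cinner_sum_left
    by (simp add: cinner_sum_right cinner_scaleC_left cinner_scaleC_right sum_distrib_left ac_simps)
  also have "\<dots> = (\<Sum>e\<in>F. \<Sum>f\<in>F. if e = f then cnj (c e) * c f else 0)"
    using B F by (intro sum.cong refl) (auto simp: orthonormal_def subset_iff)
  also have "\<dots> = of_real (\<Sum>e\<in>F. (cmod (c e))\<^sup>2)"
    using F by (simp add: complex_norm_square mult.commute del: of_real_power)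
  finally show ?thesis unfolding cinner_self using of_real_eq_iff by blast
qed

lemma Bessel:
  assumes B: "orthonormal B" and F: "finite F" "F \<subseteq> B"
  shows "(\<Sum>e\<in>F. (cmod (cinner e x))\<^sup>2) \<le> (norm x)\<^sup>2"
proof -
  define y where "y = (\<Sum>e\<in>F. cinner e x *\<^sub>C e)"
  have "cinner y x = (\<Sum>e\<in>F. of_real ((cmod (cinner e x))\<^sup>2))"
    unfolding y_def cinner_sum_left
    by (intro sum.cong refl) (simp add: cinner_scaleC_left complex_norm_square mult.commute del: of_real_power)
  then have yx: "cinner y x = of_real (\<Sum>e\<in>F. (cmod (cinner e x))\<^sup>2)" by simp
  have yy: "cinner y y = of_real (\<Sum>e\<in>F. (cmod (cinner e x))\<^sup>2)"
    using orthonormal_norm_sum[OF B F] by (simp only: cinner_self y_def)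
  have "cinner (x - y) (x - y) = cinner x x - cinner y x"
    using yx yy cinner_commute[of x y] by (simp add: cinner_diff_left cinner_diff_right)
  then have "(norm (x - y))\<^sup>2 = (norm x)\<^sup>2 - (\<Sum>e\<in>F. (cmod (cinner e x))\<^sup>2)"
    unfolding cinner_self yx by (metis of_real_diff of_real_eq_iff)
  then show ?thesis using zero_le_power2[of "norm (x - y)"] by linarith
qed

lemma Bessel_summable:
  assumes "orthonormal B"
  shows "(\<lambda>e. (cmod (cinner e x))\<^sup>2) summable_on B"
  by (rule nonneg_bdd_above_summable_on) (auto intro!: bdd_aboveI2 Bessel[OF assms])

text \<open>Riesz-Fischer for a possibly uncountable family. Completeness speaks of sequences, so
  finite sets \<open>G n\<close> that carry all but (1/2)^n of the mass are extracted first; by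
  Pythagoras every larger finite set changes the partial sum by at most the square root of
  that.\<close>

lemma orthonormal_has_sum:
  fixes c :: "'h::{complex_inner,banach} \<Rightarrow> complex"
  assumes B: "orthonormal B" and sm: "(\<lambda>e. (cmod (c e))\<^sup>2) summable_on B"
  obtains z where "((\<lambda>e. c e *\<^sub>C e) has_sum z) B"
proof -
  define a where "a e = (cmod (c e))\<^sup>2" for e
  define S where "S = infsum a B"
  define y where "y F = (\<Sum>e\<in>F. c e *\<^sub>C e)" for F
  have hs: "(a has_sum S) B"
    using sm by (simp add: a_def[abs_def] S_def)
  have le: "sum a F \<le> S" if "finite F" "F \<subseteq> B" for F
    using that hs by (intro finite_sum_le_has_sum) (auto simp: a_def)
  have "\<exists>F. finite F \<and> F \<subseteq> B \<and> S - (1/2)^n < sum a F" for n :: nat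
  proof -
    obtain F where "finite F" "F \<subseteq> B" "dist (sum a F) S \<le> (1/2)^(Suc n)"
      using has_sum_finite_approximation[OF hs, of "(1/2)^(Suc n)"] by auto
    moreover have "(1/2::real)^(Suc n) < (1/2)^n" by simp
    ultimately have "S - (1/2)^n < sum a F" unfolding dist_real_def by linarith
    then show ?thesis using \<open>finite F\<close> \<open>F \<subseteq> B\<close> by blast
  qed
  then obtain G where G: "\<And>n. finite (G n)" "\<And>n. G n \<subseteq> B" "\<And>n. S - (1/2)^n < sum a (G n)"
    by metis
  have d: "(norm (y F - y (G n)))\<^sup>2 \<le> (1/2)^n"
    if "finite F" "F \<subseteq> B" "G n \<subseteq> F" for F n
  proof -
    have "y F - y (G n) = (\<Sum>e\<in>F - G n. c e *\<^sub>C e)"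
      unfolding y_def using that by (subst sum_diff) auto
    then have "(norm (y F - y (G n)))\<^sup>2 = sum a (F - G n)"
      unfolding a_def using orthonormal_norm_sum[OF B, of "F - G n" c] that by auto
    also have "\<dots> = sum a F - sum a (G n)" using that by (simp add: sum_diff)
    finally show ?thesis using le[OF that(1,2)] G(3)[of n] by linarith
  qed
  have sq: "norm z \<le> sqrt ((1/2)^n)" if "(norm z)\<^sup>2 \<le> (1/2)^n" for z :: 'h and n
    using that by (rule real_le_rsqrt)
  have lim0: "(\<lambda>n. sqrt ((1/2)^n)) \<longlonglongrightarrow> 0"
    using tendsto_real_sqrt[OF LIMSEQ_power_zero[of "1/2::real"]] by simp
  \<comment> \<open>The sets \<open>G n\<close> are not nested, so both partial sums are compared
    with the one over the union.\<close>
  have dd: "norm (y (G m) - y (G n)) \<le> 2 * sqrt ((1/2)^n)" if "n \<le> m" for m n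
  proof -
    have "norm (y (G m \<union> G n) - y (G m)) \<le> sqrt ((1/2)^m)"
      by (rule sq, rule d) (use G in auto)
    moreover have "sqrt ((1/2)^m) \<le> sqrt ((1/2)^n)"
      using that by (simp add: power_decreasing)
    moreover have "norm (y (G m \<union> G n) - y (G n)) \<le> sqrt ((1/2)^n)"
      by (rule sq, rule d) (use G in auto)
    moreover have "norm (y (G m) - y (G n)) \<le>
        norm (y (G m \<union> G n) - y (G n)) + norm (y (G m \<union> G n) - y (G m))"
      using norm_triangle_ineq4[of "y (G m \<union> G n) - y (G n)" "y (G m \<union> G n) - y (G m)"] by simp
    ultimately show ?thesis by linarith
  qed
  have "Cauchy (\<lambda>n. y (G n))"
  proof (rule CauchyI')
    fix e :: real assume "0 < e"
    then have "0 < e / 2" by simp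
    then obtain N where N: "sqrt ((1/2)^N) < e / 2"
      using eventually_happens'[OF sequentially_bot order_tendstoD(2)[OF lim0]] by blast
    have "norm (y (G m) - y (G n)) < e" if "N \<le> m" "m \<le> n" for m n
    proof -
      have "norm (y (G m) - y (G n)) \<le> 2 * sqrt ((1/2)^m)"
        using dd[OF that(2)] by (simp add: norm_minus_commute)
      also have "\<dots> \<le> 2 * sqrt ((1/2)^N)" using that by (simp add: power_decreasing)
      finally show ?thesis using N by linarith
    qed
    then show "\<exists>M. \<forall>m\<ge>M. \<forall>n>m. dist (y (G m)) (y (G n)) < e"
      unfolding dist_norm by (intro exI[of _ N]) simp
  qed
  then obtain z where z: "(\<lambda>n. y (G n)) \<longlonglongrightarrow> z"
    using Cauchy_convergent_iff convergent_def by metis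
  have zG: "norm (z - y (G n)) \<le> 2 * sqrt ((1/2)^n)" for n
  proof (rule tendsto_upperbound)
    show "(\<lambda>m. norm (y (G m) - y (G n))) \<longlonglongrightarrow> norm (z - y (G n))" by (intro tendsto_intros z)
    show "\<forall>\<^sub>F m in sequentially. norm (y (G m) - y (G n)) \<le> 2 * sqrt ((1/2)^n)"
      using dd eventually_ge_at_top[of n] by (rule eventually_mono[rotated])
  qed simp
  have hz: "((\<lambda>e. c e *\<^sub>C e) has_sum z) B"
    unfolding has_sum_def tendsto_iff
  proof (intro allI impI)
    \<comment> \<open>The third of \<open>e\<close> pays for one distance from a large set to
      \<open>G N\<close> and for the two such distances in \<open>zG\<close>.\<close>
    fix e :: real assume "0 < e"
    then have "0 < e / 3" by simp
    then obtain N where N: "sqrt ((1/2)^N) < e / 3"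
      using eventually_happens'[OF sequentially_bot order_tendstoD(2)[OF lim0]] by blast
    have "dist (y F) z < e" if "finite F" "F \<subseteq> B" "G N \<subseteq> F" for F
    proof -
      have "norm (y F - y (G N)) \<le> sqrt ((1/2)^N)" by (rule sq, rule d) (use that in auto)
      moreover have "norm (y F - z) \<le> norm (y F - y (G N)) + norm (z - y (G N))"
        using norm_triangle_ineq4[of "y F - y (G N)" "z - y (G N)"] by simp
      ultimately show ?thesis using zG[of N] N unfolding dist_norm by linarith
    qed
    then show "\<forall>\<^sub>F F in finite_subsets_at_top B. dist (\<Sum>e\<in>F. c e *\<^sub>C e) z < e"
      unfolding eventually_finite_subsets_at_top y_def using G(1,2)
      by (intro exI[of _ "G N"] conjI allI impI) blast+
  qed
  then show thesis by (rule that)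
qed

text \<open>Riesz-Fischer supplies a sum with the same coefficients as \<open>x\<close>; totality of
  \<open>B\<close> identifies the two.\<close>

lemma onb_has_sum:
  fixes x :: "'h::{complex_inner,banach}"
  assumes onb: "is_onb B"
  shows "((\<lambda>e. cinner e x *\<^sub>C e) has_sum x) B"
proof -
  have B: "orthonormal B" using onb by (simp add: is_onb_iff)
  obtain z where hz: "((\<lambda>e. cinner e x *\<^sub>C e) has_sum z) B"
    using orthonormal_has_sum[OF B Bessel_summable[OF B]] .
  have "cinner e z = cinner e x" if e: "e \<in> B" for e
  proof -
    have "((\<lambda>f. cinner e (cinner f x *\<^sub>C f)) has_sum cinner e z) B"
      by (rule has_sum_bounded_linear[OF bounded_linear_cinner_right hz])
    moreover have "((\<lambda>f. cinner e (cinner f x *\<^sub>C f)) has_sum cinner e x) B"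
    proof (rule has_sum_finite_neutralI[where B = "{e}"])
      show "cinner e (cinner f x *\<^sub>C f) = 0" if "f \<in> B - {e}" for f
        using B e that by (auto simp: orthonormal_def cinner_scaleC_right)
    qed (use B e in \<open>auto simp: orthonormal_def cinner_scaleC_right\<close>)
    ultimately show ?thesis by (rule has_sum_unique)
  qed
  then have "\<forall>e\<in>B. cinner e (z - x) = 0" by (simp add: cinner_diff_right)
  then have "z = x" using onb by (auto simp: is_onb_iff)
  then show ?thesis using hz by simp
qed

lemma Parseval:
  fixes x y :: "'h::{complex_inner,banach}"
  assumes "is_onb B"
  shows "((\<lambda>e. cinner x e * cinner e y) has_sum cinner x y) B"
  using has_sum_bounded_linear[OF bounded_linear_cinner_right onb_has_sum[OF assms, of y], of x]
  by (simp add: cinner_scaleC_right mult.commute)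

lemma Parseval_norm:
  fixes x :: "'h::{complex_inner,banach}"
  assumes "is_onb B"
  shows "((\<lambda>e. (cmod (cinner e x))\<^sup>2) has_sum (norm x)\<^sup>2) B"
proof -
  have "((\<lambda>e. Re (cinner x e * cinner e x)) has_sum Re (cinner x x)) B"
    by (rule has_sum_bounded_linear[OF bounded_linear_Re Parseval[OF assms]])
  then show ?thesis by (simp add: cinner_self cinner_mult_swap del: of_real_power)
qed

section \<open>Trace class operators\<close>

text \<open>The rank-one operator |x><y|, both the building block of the decomposition of R and the
  test operator that separates bounded operators under the trace.\<close>

lift_definition butterfly :: "'h::complex_inner \<Rightarrow> 'h \<Rightarrow> 'h op" is "\<lambda>x y v. cinner y v *\<^sub>C x"
  by (auto simp: bounded_clinear_def cinner_scaleC_right scaleC_scaleC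
      intro: bounded_linear_compose[OF bounded_linear_scaleC_left bounded_linear_cinner_right])

text \<open>An explicit candidate settles the \<open>THE\<close> in \<open>adj_op\<close>: by
  \<open>cinner_ext\<close> there is at most one adjoint. Rank-one operators, plane waves and
  permutations all come with such a candidate.\<close>

lemma adj_opI:
  assumes "\<And>x y. cinner (cblinfun_apply B x) y = cinner x (cblinfun_apply A y)"
  shows "adj_op A = B"
  unfolding adj_op_def
proof (rule the_equality)
  fix C :: "'a op" assume C: "\<forall>x y. cinner (C x) y = cinner x (A y)"
  show "C = B"
  proof (rule cblinfun_eqI, rule cinner_ext)
    show "cinner z (C x) = cinner z (B x)" for x z
      using C assms[of x z] cinner_commute[of z "C x"] cinner_commute[of z "B x"] by simp
  qed
qed (use assms in simp)

lemma adj_butterfly: "adj_op (butterfly x y) = butterfly y x"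
proof (rule adj_opI)
  show "cinner (butterfly y x u) v = cinner u (butterfly x y v)" for u v
    using cinner_commute[of u x] by (simp add: butterfly.rep_eq cinner_scaleC_left cinner_scaleC_right)
qed

text \<open>The absolute value of |x><y| is c |y><y| with c = norm x / norm y, since its square has
  to be (norm x)^2 |y><y|. Its diagonal sum converges by Bessel's inequality. For y = 0 the operator
  vanishes.\<close>

lemma trace_class_butterfly: "trace_class (butterfly x (y::'h::complex_inner))"
proof (cases "y = 0")
  case True
  have "adj_op (butterfly x y) o\<^sub>C butterfly x y = 0"
    by (rule cblinfun_eqI) (simp add: True cblinfun_rep butterfly.rep_eq)
  moreover have "positive_op (0::'h op)" "(0::'h op) o\<^sub>C 0 = 0"
    by (auto simp: positive_op_def zero_cblinfun.rep_eq comp_op.rep_eq intro: cblinfun_eqI)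
  moreover obtain B :: "'h set" where "is_onb B" using is_onb_exists by blast
  ultimately show ?thesis
    unfolding trace_class_def by (intro exI[of _ 0] exI[of _ B]) (simp add: zero_cblinfun.rep_eq)
next
  case False
  define c where "c = norm x / norm y"
  define P where "P = of_real c *\<^sub>C butterfly y y"
  have P: "P v = of_real c *\<^sub>C cinner y v *\<^sub>C y" for v
    by (simp add: P_def cblinfun_rep butterfly.rep_eq)
  have cP: "cinner v (P v) = of_real (c * (cmod (cinner y v))\<^sup>2)" for v
    using cinner_mult_swap[of v y]
    by (simp add: P cinner_scaleC_right mult.commute del: of_real_power)
  have "positive_op P"
    unfolding positive_op_def cP by (auto simp: c_def)
  moreover have "P o\<^sub>C P = adj_op (butterfly x y) o\<^sub>C butterfly x y"
  proof (rule cblinfun_eqI)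
    fix v
    have "cinner y (P v) = of_real (c * (norm y)\<^sup>2) * cinner y v"
      by (simp add: P cinner_scaleC_right cinner_self)
    then have "P (P v) = of_real (c * c * (norm y)\<^sup>2) *\<^sub>C cinner y v *\<^sub>C y"
      unfolding P[of "P v"] by (simp add: scaleC_scaleC mult.assoc)
    also have "c * c * (norm y)\<^sup>2 = (norm x)\<^sup>2"
      using False by (simp add: c_def power2_eq_square)
    finally show "(P o\<^sub>C P) v = (adj_op (butterfly x y) o\<^sub>C butterfly x y) v"
      by (simp add: adj_butterfly cblinfun_rep butterfly.rep_eq cinner_scaleC_right cinner_self
          scaleC_scaleC mult.commute)
  qed
  moreover obtain B :: "'h set" where B: "is_onb B" using is_onb_exists by blast
  moreover have "(\<lambda>e. cinner e (P e)) summable_on B"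
  proof -
    have "(\<lambda>e. (cmod (cinner e y))\<^sup>2) summable_on B"
      using B by (intro Bessel_summable) (simp add: is_onb_iff)
    then have "(\<lambda>e. complex_of_real (c * (cmod (cinner e y))\<^sup>2)) summable_on B"
      by (intro summable_on_of_real summable_on_cmult_right)
    moreover have "cmod (cinner e y) = cmod (cinner y e)" for e
      using cinner_commute[of e y] by simp
    ultimately show ?thesis by (simp add: cP)
  qed
  ultimately show ?thesis unfolding trace_class_def by blast
qed

lemma is_onb_some: "is_onb (SOME B :: 'h::complex_inner set. is_onb B)"
  using is_onb_exists by (rule someI_ex)

text \<open>Parseval's identity yields this value in every orthonormal basis, in particular in the
  one that \<open>op_trace\<close> picks.\<close>

lemma op_trace_butterfly:
  fixes x :: "'h::{complex_inner,banach}"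
  shows "op_trace (T o\<^sub>C butterfly x y) = cinner y (T x)"
proof -
  have "((\<lambda>e. cinner y e * cinner e (T x)) has_sum cinner y (T x)) (SOME B. is_onb B)"
    by (rule Parseval[OF is_onb_some])
  then show ?thesis
    by (simp add: op_trace_def cblinfun_rep butterfly.rep_eq cblinfun_scaleC cinner_scaleC_right infsumI)
qed

text \<open>A divergent \<open>infsum\<close> is 0, so the scalar comes out whether or not the sum
  converges in the basis of \<open>op_trace\<close>; \<open>trace_class\<close> speaks of a possibly
  different basis.\<close>

lemma op_trace_scaleC: "op_trace (c *\<^sub>C A) = c * op_trace A"
  by (simp add: op_trace_def cblinfun_rep cinner_scaleC_right infsum_cmult_right')

lemma scaleC_id_comp: "(c *\<^sub>C id_op) o\<^sub>C F = c *\<^sub>C F"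
  by (rule cblinfun_eqI) (simp add: cblinfun_rep)

text \<open>Paired with F, a multiple of the identity gives its scalar times
  \<open>op_trace F\<close>, so the scalar integral satisfies the defining property. Rank-one F
  recover every matrix element of T, which gives the uniqueness that \<open>THE\<close>
  needs.\<close>

lemma ultraweak_integral_id:
  "ultraweak_integral \<mu> (\<lambda>\<omega>. g \<omega> *\<^sub>C (id_op :: 'k::{complex_inner,banach} op))
    = cm_integral \<mu> g *\<^sub>C id_op"
  unfolding ultraweak_integral_def
proof (rule the_equality)
  have cm: "cm_integral \<mu> (\<lambda>\<omega>. g \<omega> * z) = cm_integral \<mu> g * z" for z
  proof -
    have "(\<lambda>\<omega>. g \<omega> * z * snd \<mu> \<omega>) = (\<lambda>\<omega>. g \<omega> * snd \<mu> \<omega> * z)" by (simp add: ac_simps)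
    then show ?thesis by (simp add: cm_integral_def split_beta)
  qed
  show 1: "\<forall>F. trace_class F \<longrightarrow> op_trace ((cm_integral \<mu> g *\<^sub>C id_op) o\<^sub>C F) =
      cm_integral \<mu> (\<lambda>\<omega>. op_trace ((g \<omega> *\<^sub>C (id_op :: 'k op)) o\<^sub>C F))"
    by (simp add: scaleC_id_comp op_trace_scaleC cm)
  fix T :: "'k op"
  assume T: "\<forall>F. trace_class F \<longrightarrow>
      op_trace (T o\<^sub>C F) = cm_integral \<mu> (\<lambda>\<omega>. op_trace ((g \<omega> *\<^sub>C id_op) o\<^sub>C F))"
  show "T = cm_integral \<mu> g *\<^sub>C id_op"
  proof (rule cblinfun_eqI, rule cinner_ext)
    fix x y :: 'k
    show "cinner y (T x) = cinner y ((cm_integral \<mu> g *\<^sub>C id_op) x)"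
      using T[rule_format, OF trace_class_butterfly[of x y]] 1[rule_format, OF trace_class_butterfly[of x y]]
      unfolding op_trace_butterfly by simp
  qed
qed

text \<open>One step of the Cholesky decomposition: subtracting \<open>|g\<rangle>\<langle>g|\<close> keeps \<open>P\<close> positive and
  kills \<open>b\<close>. Iterated along an orthonormal basis it decomposes \<open>R\<close> without square roots or the spectral
  theorem. If \<open>P b = 0\<close> then \<open>g = 0\<close>, because \<open>1 / 0 = 0\<close>.\<close>

lemma positive_op_Schur_step:
  fixes P :: "'h::complex_inner op" and b e :: 'h
  assumes P: "positive_op P"
  defines "g \<equiv> of_real (1 / sqrt (Re (cinner b (P b)))) *\<^sub>C P b"
  shows "positive_op (P - butterfly g g)" and "(P - butterfly g g) b = 0"
    and "P e = 0 \<Longrightarrow> cinner g e = 0"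
proof -
  define q where "q = Re (cinner b (P b))"
  have q0: "0 \<le> q" using P by (simp add: q_def positive_op_def)
  have g: "g = of_real (1 / sqrt q) *\<^sub>C P b" by (simp add: g_def q_def)
  have cg: "cinner g x = of_real (1 / sqrt q) * cinner b (P x)" for x
    by (simp add: g cinner_scaleC_left positive_op_hermitian[OF P])
  show "P e = 0 \<Longrightarrow> cinner g e = 0" by (simp add: cg)
  have eq: "cinner x ((P - butterfly g g) x) = of_real (Re (cinner x (P x)) - (cmod (cinner g x))\<^sup>2)" for x
  proof -
    have "cinner g x * cinner x g = of_real ((cmod (cinner g x))\<^sup>2)"
      using cinner_mult_swap[of x g] by (simp only: mult.commute)
    moreover have "cinner x ((P - butterfly g g) x) = cinner x (P x) - cinner g x * cinner x g"
      by (simp add: cblinfun_rep butterfly.rep_eq cinner_diff_right cinner_scaleC_right)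
    ultimately show ?thesis
      using positive_op_Re[OF P, of x] by (simp only: of_real_diff)
  qed
  \<comment> \<open>This keeps the difference positive: Cauchy-Schwarz for \<open>b\<close> and
    \<open>x\<close> in the form of \<open>P\<close>, divided by \<open>q\<close>.\<close>
  have "(cmod (cinner g x))\<^sup>2 \<le> Re (cinner x (P x))" for x
  proof (cases "q = 0")
    case True
    then show ?thesis using P by (simp add: cg positive_op_def)
  next
    case False
    then have "q > 0" using q0 by simp
    have "(cmod (cinner g x))\<^sup>2 = (cmod (cinner b (P x)))\<^sup>2 / q"
      using q0 by (simp add: cg norm_mult norm_divide power_divide)
    also have "\<dots> \<le> q * Re (cinner x (P x)) / q"
      using positive_op_Cauchy_Schwarz[OF P, of b x] \<open>q > 0\<close>
      by (intro divide_right_mono) (simp_all add: q_def)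
    finally show ?thesis using False by simp
  qed
  then show "positive_op (P - butterfly g g)"
    unfolding positive_op_def eq by simp
  show "(P - butterfly g g) b = 0"
  proof (cases "q = 0")
    case True
    then have "P b = 0" using positive_op_eq_0[OF P, of b] by (simp add: q_def)
    then show ?thesis by (simp add: cblinfun_rep butterfly.rep_eq g)
  next
    case False
    have "cinner b (P b) = of_real q" using positive_op_Re[OF P, of b] by (simp add: q_def)
    then have "cinner g b * of_real (1 / sqrt q) = of_real (1 / sqrt q * q * (1 / sqrt q))"
      by (simp only: cg of_real_mult)
    also have "1 / sqrt q * q * (1 / sqrt q) = 1" using False q0 by (simp add: field_simps)
    finally have "cinner g b *\<^sub>C of_real (1 / sqrt q) *\<^sub>C P b = P b"
      by (simp add: scaleC_scaleC)
    then have "cinner g b *\<^sub>C g = P b" unfolding g[symmetric] .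
    then show ?thesis by (simp add: cblinfun_rep butterfly.rep_eq)
  qed
qed

section \<open>Rank-one series of positive operators with finite trace\<close>

text \<open>A summable diagonal has only countably many nonzero entries and \<open>R\<close> kills
  the other basis vectors, so one sequence of Schur steps meets them all. Each basis vector e is
  annihilated by some remainder \<open>Q n\<close> and by all later ones; hence the matrix elements
  of \<open>R\<close> at e are finite sums, and it is enough that the series converges
  absolutely.\<close>

lemma positive_op_rank_one_series:
  fixes R :: "'h::{complex_inner,banach} op"
  assumes R: "positive_op R" and onb: "is_onb B" and sm: "(\<lambda>e. cinner e (R e)) summable_on B"
  obtains f :: "nat \<Rightarrow> 'h" where "summable (\<lambda>n. (norm (f n))\<^sup>2)"
    and "\<And>v. (\<lambda>n. cinner (f n) v *\<^sub>C f n) sums R v"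
proof -
  define r where "r e = Re (cinner e (R e))" for e
  have r: "r summable_on B" using summable_on_Re[OF sm] by (simp add: r_def[abs_def])
  define S where "S = {e\<in>B. r e \<noteq> 0}"
  have "countable S" unfolding S_def by (rule summable_countable_real[OF r])
  \<comment> \<open>The enumeration may repeat and, for empty \<open>S\<close>, yields an arbitrary
    vector. A Schur step is valid at any vector, so this does no harm.\<close>
  then have b: "S \<subseteq> range (from_nat_into S)"
    by (metis from_nat_into_to_nat_on range_eqI subsetI)
  define b where "b = from_nat_into S"
  define g where "g n P = of_real (1 / sqrt (Re (cinner (b n) (P (b n))))) *\<^sub>C P (b n)"
    for n and P :: "'h op"
  define Q where "Q = rec_nat R (\<lambda>n P. P - butterfly (g n P) (g n P))"
  define f where "f n = g n (Q n)" for n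
  have Q0: "Q 0 = R" and QS: "Q (Suc n) = Q n - butterfly (f n) (f n)" for n
    by (simp_all add: Q_def f_def)
  have Qpos: "positive_op (Q n)" for n
  proof (induction n)
    case (Suc n)
    show ?case unfolding QS f_def g_def by (rule positive_op_Schur_step(1)[OF Suc])
  qed (simp add: Q0 R)
  have forth: "cinner (f n) e = 0" if "Q n e = 0" for n e
    using positive_op_Schur_step(3)[OF Qpos that] by (simp add: f_def g_def)
  have Qmono: "Q m e = 0" if "Q n e = 0" "n \<le> m" for m n e
    using that(2)
  proof (induction rule: dec_induct)
    case (step m)
    then show ?case using forth[of m e] by (simp add: QS cblinfun_rep butterfly.rep_eq)
  qed (use that in simp)
  have Qb: "Q (Suc n) (b n) = 0" for n
    using positive_op_Schur_step(2)[OF Qpos, of n "b n"] by (simp add: QS f_def g_def)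
  have dec: "R v = Q n v + (\<Sum>k<n. cinner (f k) v *\<^sub>C f k)" for n v
    by (induction n) (simp_all add: Q0 QS cblinfun_rep butterfly.rep_eq)
  have ev: "\<exists>N. Q N e = 0" if e: "e \<in> B" for e
  proof (cases "e \<in> S")
    case True
    then obtain n where "e = b n" using b by (auto simp: b_def)
    then show ?thesis using Qb by blast
  next
    case False
    then have "R e = 0" using e positive_op_eq_0[OF R, of e] by (simp add: S_def r_def)
    then show ?thesis using Q0 by metis
  qed
  \<comment> \<open>In the basis \<open>B\<close>, (norm (f k))^2 is the trace of |f k><f k|. As the
    remainder \<open>Q n\<close> is positive, the first n such traces add up to at most the trace of
    \<open>R\<close>.\<close>
  have bound: "(\<Sum>k<n. (norm (f k))\<^sup>2) \<le> infsum r B" for n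
  proof (rule has_sum_mono)
    show "((\<lambda>e. \<Sum>k<n. (cmod (cinner e (f k)))\<^sup>2) has_sum (\<Sum>k<n. (norm (f k))\<^sup>2)) B"
      by (induction n) (auto intro!: has_sum_add Parseval_norm[OF onb])
    show "(r has_sum infsum r B) B" using r by simp
    fix e assume "e \<in> B"
    have "cinner e (R e) = cinner e (Q n e) + (\<Sum>k<n. cinner (f k) e * cinner e (f k))"
      by (subst dec[of e n]) (simp add: cinner_add_right cinner_sum_right cinner_scaleC_right)
    also have "(\<Sum>k<n. cinner (f k) e * cinner e (f k)) = of_real (\<Sum>k<n. (cmod (cinner e (f k)))\<^sup>2)"
      unfolding cinner_mult_swap by simp
    finally have "r e = Re (cinner e (Q n e)) + (\<Sum>k<n. (cmod (cinner e (f k)))\<^sup>2)"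
      by (simp add: r_def del: of_real_sum)
    then show "(\<Sum>k<n. (cmod (cinner e (f k)))\<^sup>2) \<le> r e"
      using Qpos[of n] by (simp add: positive_op_def)
  qed
  have sf: "summable (\<lambda>n. (norm (f n))\<^sup>2)"
    by (rule summableI_nonneg_bounded[OF _ bound]) simp
  have "(\<lambda>n. cinner (f n) v *\<^sub>C f n) sums R v" for v
  proof -
    have "summable (\<lambda>n. norm (cinner (f n) v *\<^sub>C f n))"
    proof (rule summable_comparison_test'[OF summable_mult[OF sf, of "norm v"]])
      show "norm (norm (cinner (f n) v *\<^sub>C f n)) \<le> norm v * (norm (f n))\<^sup>2" for n
        using mult_right_mono[OF cinner_Cauchy_Schwarz[of "f n" v], of "norm (f n)"]
        by (simp add: norm_scaleC power2_eq_square ac_simps)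
    qed
    then have "summable (\<lambda>n. cinner (f n) v *\<^sub>C f n)" by (rule summable_norm_cancel)
    then obtain w where w: "(\<lambda>n. cinner (f n) v *\<^sub>C f n) sums w" by (auto simp: summable_def)
    \<comment> \<open>After N steps every \<open>f n\<close> is orthogonal to \<open>e\<close>, so
      the series is finite; \<open>dec\<close> at N recognizes it as
      \<open>cinner (R e) v\<close>.\<close>
    have "cinner e w = cinner e (R v)" if e: "e \<in> B" for e
    proof -
      obtain N where N: "Q N e = 0" using ev[OF e] by blast
      have z: "cinner (f n) e = 0" if "N \<le> n" for n using forth Qmono[OF N that] by blast
      have z': "cinner e (f n) = 0" if "N \<le> n" for n
        using z[OF that] cinner_commute[of e "f n"] by simp
      have "(\<lambda>n. cinner e (cinner (f n) v *\<^sub>C f n)) sums cinner e w"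
        by (rule bounded_linear.sums[OF bounded_linear_cinner_right w])
      moreover have "(\<lambda>n. cinner e (cinner (f n) v *\<^sub>C f n)) sums (\<Sum>n<N. cinner e (cinner (f n) v *\<^sub>C f n))"
        by (rule sums_finite) (auto simp: cinner_scaleC_right z' not_less)
      ultimately have "cinner e w = (\<Sum>n<N. cinner e (cinner (f n) v *\<^sub>C f n))" by (rule sums_unique2)
      also have "\<dots> = (\<Sum>n<N. cinner (cinner (f n) e *\<^sub>C f n) v)"
      proof (rule sum.cong[OF refl])
        fix n
        show "cinner e (cinner (f n) v *\<^sub>C f n) = cinner (cinner (f n) e *\<^sub>C f n) v"
          using cinner_commute[of e "f n"] by (simp add: cinner_scaleC_right cinner_scaleC_left)
      qed
      also have "\<dots> = cinner (R e) v"
        unfolding cinner_sum_left[symmetric] using dec[of e N] N by simp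
      finally show ?thesis by (simp add: positive_op_hermitian[OF R])
    qed
    then have "\<forall>e\<in>B. cinner e (w - R v) = 0" by (simp add: cinner_diff_right)
    then have "w = R v" using onb by (auto simp: is_onb_def)
    then show ?thesis using w by simp
  qed
  then show thesis using that sf by blast
qed

section \<open>Adjoint vectors and traces as series\<close>

text \<open>Bessel's inequality for the image of \<open>y\<close> under the adjoint of
  \<open>A\<close>, before that image is known to exist. Testing \<open>A\<close> on the vector v
  with the conjugate coefficients gives s = cinner y (A v), hence s is at most norm y * norm A *
  sqrt s.\<close>

lemma Bessel_adjoint:
  assumes B: "orthonormal B" and F: "finite F" "F \<subseteq> B"
  shows "(\<Sum>e\<in>F. (cmod (cinner y (cblinfun_apply A e)))\<^sup>2) \<le> (norm y * norm A)\<^sup>2"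
proof -
  define s where "s = (\<Sum>e\<in>F. (cmod (cinner y (A e)))\<^sup>2)"
  define v where "v = (\<Sum>e\<in>F. cnj (cinner y (A e)) *\<^sub>C e)"
  have s0: "0 \<le> s" by (simp add: s_def sum_nonneg)
  have nA: "0 \<le> norm y * norm A" by simp
  have "cinner y (A v) = of_real s"
    unfolding s_def of_real_sum complex_norm_square
    by (simp add: v_def cblinfun_sum cblinfun_scaleC cinner_sum_right cinner_scaleC_right mult.commute)
  then have "s = cmod (cinner y (A v))" using s0 by simp
  also have "\<dots> \<le> norm y * (norm A * norm v)"
    by (intro order_trans[OF cinner_Cauchy_Schwarz] mult_left_mono norm_cblinfun) simp
  also have "norm v = sqrt s"
    using orthonormal_norm_sum[OF B F, of "\<lambda>e. cnj (cinner y (A e))"]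
    by (intro real_sqrt_unique[symmetric]) (simp_all add: v_def s_def)
  finally have "sqrt s * sqrt s \<le> (norm y * norm A) * sqrt s" using s0 by (simp add: mult.assoc)
  then have "sqrt s \<le> norm y * norm A"
    using nA s0 by (cases "s = 0") (auto intro: mult_right_le_imp_le simp del: real_sqrt_mult_self)
  then have "(sqrt s)\<^sup>2 \<le> (norm y * norm A)\<^sup>2" by (rule power_mono) (simp add: s0)
  then show ?thesis using s0 by (simp add: s_def[symmetric])
qed

text \<open>The Riesz vector of the functional x \<mapsto> cinner y (A x), assembled from its
  coefficients in an orthonormal basis; \<open>Bessel_adjoint\<close> makes them square
  summable.\<close>

lemma adjoint_vector_exists:
  fixes y :: "'h::{complex_inner,banach}" and A :: "'h op"
  obtains z where "\<And>x. cinner z x = cinner y (A x)"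
proof -
  obtain B :: "'h set" where onb: "is_onb B" using is_onb_exists by blast
  then have B: "orthonormal B" by (simp add: is_onb_iff)
  have "(\<lambda>e. (cmod (cnj (cinner y (A e))))\<^sup>2) summable_on B"
    by (rule nonneg_bdd_above_summable_on) (auto intro!: bdd_aboveI2 Bessel_adjoint[OF B])
  then obtain z where z: "((\<lambda>e. cnj (cinner y (A e)) *\<^sub>C e) has_sum z) B"
    by (rule orthonormal_has_sum[OF B])
  have "cinner z x = cinner y (A x)" for x
  proof (rule has_sum_unique)
    show "((\<lambda>e. cinner y (A e) * cinner e x) has_sum cinner z x) B"
      using has_sum_bounded_linear[OF bounded_linear_cinner_left z] by (simp add: cinner_scaleC_left)
    have "bounded_linear (\<lambda>v. cinner y (A v))"
      by (rule bounded_linear_compose[OF bounded_linear_cinner_right cblinfun_linear])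
    from has_sum_bounded_linear[OF this onb_has_sum[OF onb, of x]]
    show "((\<lambda>e. cinner y (A e) * cinner e x) has_sum cinner y (A x)) B"
      by (simp add: cblinfun_scaleC cinner_scaleC_right mult.commute)
  qed
  then show thesis by (rule that)
qed

text \<open>The double family <f n, A e><e, f n> is absolutely summable: Cauchy-Schwarz over e
  bounds its sum for fixed n by norm A * (norm (f n))^2. Summing over e first gives <f n, A (f n)>,
  summing over n first gives <e, R (A e)>.\<close>

lemma trace_rank_one_series:
  fixes f :: "nat \<Rightarrow> 'h::{complex_inner,banach}"
  assumes sf: "summable (\<lambda>n. (norm (f n))\<^sup>2)"
    and R: "\<And>v. (\<lambda>n. cinner (f n) v *\<^sub>C f n) sums R v"
    and onb: "is_onb B"
  shows "((\<lambda>e. cinner e (R (cblinfun_apply A e))) has_sum (\<Sum>n. cinner (f n) (cblinfun_apply A (f n)))) B"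
proof -
  have B: "orthonormal B" using onb by (simp add: is_onb_iff)
  define a where "a = (\<lambda>(n, e). cinner (f n) (A e) * cinner e (f n))"
  have sumle: "(\<Sum>e\<in>F. cmod (a (n, e))) \<le> norm A * (norm (f n))\<^sup>2" if F: "finite F" "F \<subseteq> B" for n F
  proof -
    have "(\<Sum>e\<in>F. cmod (a (n, e))) = (\<Sum>e\<in>F. \<bar>cmod (cinner (f n) (A e))\<bar> * \<bar>cmod (cinner e (f n))\<bar>)"
      by (simp add: a_def norm_mult)
    also have "\<dots> \<le> L2_set (\<lambda>e. cmod (cinner (f n) (A e))) F * L2_set (\<lambda>e. cmod (cinner e (f n))) F"
      by (rule L2_set_mult_ineq)
    also have "\<dots> \<le> (norm (f n) * norm A) * norm (f n)"
      unfolding L2_set_def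
      by (intro mult_mono real_le_lsqrt Bessel_adjoint[OF B F] Bessel[OF B F])
        (auto simp: sum_nonneg)
    finally show ?thesis by (simp add: power2_eq_square ac_simps)
  qed
  have inner: "(\<lambda>e. cmod (a (n, e))) summable_on B" for n
    by (rule nonneg_bdd_above_summable_on) (auto intro!: bdd_aboveI2 sumle)
  have ile: "(\<Sum>\<^sub>\<infinity>e\<in>B. cmod (a (n, e))) \<le> norm A * (norm (f n))\<^sup>2" for n
    by (rule infsum_le_finite_sums[OF inner sumle])
  have ige: "0 \<le> (\<Sum>\<^sub>\<infinity>e\<in>B. cmod (a (n, e)))" for n by (rule infsum_nonneg) simp
  have "summable (\<lambda>n. norm (\<Sum>\<^sub>\<infinity>e\<in>B. cmod (a (n, e))))"
    by (rule summable_comparison_test'[OF summable_mult[OF sf, of "norm A"]]) (use ile ige in auto)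
  then have "(\<lambda>n. norm (\<Sum>\<^sub>\<infinity>e\<in>B. cmod (a (n, e)))) summable_on UNIV"
    by (subst summable_on_UNIV_nonneg_real_iff) auto
  then have "(\<lambda>p. norm (a p)) summable_on UNIV \<times> B"
    unfolding Infinite_Sum.abs_summable_on_Sigma_iff using inner by blast
  then obtain s where s: "(a has_sum s) (UNIV \<times> B)"
    using abs_summable_summable by (auto simp: summable_on_def)
  have "((\<lambda>n. cinner (f n) (A (f n))) has_sum s) UNIV"
  proof (rule has_sum_SigmaD[OF s])
    fix n
    have "bounded_linear (\<lambda>v. cinner (f n) (A v))"
      by (rule bounded_linear_compose[OF bounded_linear_cinner_right cblinfun_linear])
    from has_sum_bounded_linear[OF this onb_has_sum[OF onb, of "f n"]]
    show "((\<lambda>e. a (n, e)) has_sum cinner (f n) (A (f n))) B"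
      by (simp add: a_def cblinfun_scaleC cinner_scaleC_right mult.commute)
  qed
  then have s': "s = (\<Sum>n. cinner (f n) (A (f n)))" by (simp add: has_sum_imp_sums sums_unique)
  have "((\<lambda>(e, n). a (n, e)) has_sum s) (B \<times> UNIV)" using s has_sum_swap[where f = a and A = UNIV] by blast
  then show ?thesis unfolding s'
  proof (rule has_sum_SigmaD)
    fix e
    have "(\<lambda>n. a (n, e)) sums cinner e (R (A e))"
      using bounded_linear.sums[OF bounded_linear_cinner_right R[of "A e"], of e]
      by (simp add: a_def cinner_scaleC_right)
    moreover have "summable (\<lambda>n. norm (a (n, e)))"
    proof (rule summable_comparison_test'[OF summable_mult[OF sf, of "norm (A e) * norm e"]])
      fix n
      have "norm (a (n, e)) \<le> (norm (f n) * norm (A e)) * (norm e * norm (f n))"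
        unfolding a_def by (auto simp: norm_mult intro!: mult_mono cinner_Cauchy_Schwarz)
      then show "norm (norm (a (n, e))) \<le> norm (A e) * norm e * (norm (f n))\<^sup>2"
        by (simp add: power2_eq_square ac_simps)
    qed
    ultimately show "((\<lambda>n. case (e, n) of (e, n) \<Rightarrow> a (n, e)) has_sum cinner e (R (A e))) UNIV"
      by (simp add: norm_summable_imp_has_sum)
  qed
qed

lemma density_op_rank_one_series:
  fixes R :: "'h::{complex_inner,banach} op"
  assumes "density_op R"
  obtains f :: "nat \<Rightarrow> 'h" where "summable (\<lambda>n. (norm (f n))\<^sup>2)"
    and "\<And>v. (\<lambda>n. cinner (f n) v *\<^sub>C f n) sums R v"
    and "\<And>A. op_trace (R o\<^sub>C A) = (\<Sum>n. cinner (f n) (A (f n)))"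
proof -
  let ?B = "SOME B :: 'h set. is_onb B"
  have "positive_op R" "op_trace R \<noteq> 0" using assms by (auto simp: density_op_def)
  \<comment> \<open>The sum defining \<open>op_trace R = 1\<close> would be \<open>0\<close> if it did not converge.\<close>
  then have "(\<lambda>e. cinner e (R e)) summable_on ?B"
    unfolding op_trace_def using infsum_not_exists by blast
  then obtain f :: "nat \<Rightarrow> 'h" where f: "summable (\<lambda>n. (norm (f n))\<^sup>2)"
    "\<And>v. (\<lambda>n. cinner (f n) v *\<^sub>C f n) sums R v"
    using positive_op_rank_one_series[OF \<open>positive_op R\<close> is_onb_some] by blast
  have "op_trace (R o\<^sub>C A) = (\<Sum>n. cinner (f n) (A (f n)))" for A
    using trace_rank_one_series[OF f(1) _ is_onb_some, of "cblinfun_apply R" A] f(2)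
    by (simp add: op_trace_def comp_op.rep_eq infsumI)
  then show thesis using that f by blast
qed

section \<open>The space \<open>L\<^sup>2\<close>\<close>

lemma cnj_borel_measurable [measurable (raw)]:
  "f \<in> borel_measurable M \<Longrightarrow> (\<lambda>x. cnj (f x)) \<in> borel_measurable M"
  by (rule borel_measurable_continuous_on[where f = cnj]) (intro continuous_intros)

lemma square_integrable_rep: "square_integrable (rep_L2 \<psi>)"
  using Quotient3_rep_reflp[OF Quotient3_L2, of \<psi>] by (simp add: L2_rel_def)

lemma rep_L2_measurable [measurable]: "rep_L2 \<psi> \<in> borel_measurable borel"
  using square_integrable_rep[of \<psi>] by (simp add: square_integrable_def)

lemma integrable_rep_square [simp]: "integrable lborel (\<lambda>x. (cmod (rep_L2 \<psi> x))\<^sup>2)"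
  using square_integrable_rep[of \<psi>] by (simp add: square_integrable_def)

lemma abs_rep_L2 [simp]: "abs_L2 (rep_L2 \<psi>) = \<psi>"
  by (rule Quotient3_abs_rep[OF Quotient3_L2])

lemma L2_eqI:
  assumes "AE x in lborel. rep_L2 \<psi> x = rep_L2 \<phi> x"
  shows "\<psi> = \<phi>"
proof -
  have "L2_rel (rep_L2 \<psi>) (rep_L2 \<phi>)"
    using assms by (simp add: L2_rel_def square_integrable_rep)
  then have "abs_L2 (rep_L2 \<psi>) = abs_L2 (rep_L2 \<phi>)" by (rule Quotient3_rel_abs[OF Quotient3_L2])
  then show ?thesis by simp
qed

lemma rep_abs_L2:
  assumes "square_integrable f"
  shows "AE x in lborel. rep_L2 (abs_L2 f) x = f x"
  using Quotient3_rep_abs[OF Quotient3_L2, of f] assms by (simp add: L2_rel_def)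

lemma rep_abs_L2_add:
  "square_integrable f \<Longrightarrow> square_integrable g \<Longrightarrow>
    AE x in lborel. rep_L2 (abs_L2 f + abs_L2 g) x = f x + g x"
  by (simp add: plus_L2.abs_eq L2_rel_def rep_abs_L2 square_integrable_add)

lemma rep_L2_add: "AE x in lborel. rep_L2 (\<psi> + \<phi>) x = rep_L2 \<psi> x + rep_L2 \<phi> x"
  using rep_abs_L2_add[OF square_integrable_rep square_integrable_rep, of \<psi> \<phi>] by simp

lemma rep_L2_scaleC: "AE x in lborel. rep_L2 (c *\<^sub>C \<psi>) x = c * rep_L2 \<psi> x"
proof -
  have "c *\<^sub>C \<psi> = abs_L2 (\<lambda>x. c * rep_L2 \<psi> x)"
    using scaleC_L2.abs_eq[of "rep_L2 \<psi>" c] by (simp add: L2_rel_def square_integrable_rep)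
  then show ?thesis using rep_abs_L2[OF square_integrable_scale[OF square_integrable_rep]] by simp
qed

lemma rep_L2_diff: "AE x in lborel. rep_L2 (\<psi> - \<phi>) x = rep_L2 \<psi> x - rep_L2 \<phi> x"
proof -
  have e: "\<psi> - \<phi> = \<psi> + (-1) *\<^sub>C \<phi>" by (simp add: scaleC_minus_left)
  show ?thesis
    unfolding e using rep_L2_add[of \<psi> "(-1) *\<^sub>C \<phi>"] rep_L2_scaleC[of "-1" \<phi>]
    by eventually_elim simp
qed

lemma rep_L2_zero: "AE x in lborel. rep_L2 0 x = 0"
  using rep_L2_scaleC[of 0 0] by simp

lemma cinner_L2: "cinner \<psi> \<phi> = (LBINT x. cnj (rep_L2 \<psi> x) * rep_L2 \<phi> x)"
  using cinner_L2.abs_eq[of "rep_L2 \<psi>" "rep_L2 \<phi>"] by (simp add: L2_rel_def square_integrable_rep)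

lemma norm_L2_square: "(norm \<psi>)\<^sup>2 = (LBINT x. (cmod (rep_L2 \<psi> x))\<^sup>2)"
proof -
  have "complex_of_real ((norm \<psi>)\<^sup>2) = (LBINT x. complex_of_real ((cmod (rep_L2 \<psi> x))\<^sup>2))"
    unfolding cinner_self[symmetric] cinner_L2 complex_norm_square by (simp add: mult.commute)
  then show ?thesis by (metis integral_complex_of_real of_real_eq_iff)
qed

lemma nn_norm_L2_square: "(\<integral>\<^sup>+x. ennreal ((cmod (rep_L2 \<psi> x))\<^sup>2) \<partial>lborel) = ennreal ((norm \<psi>)\<^sup>2)"
  unfolding norm_L2_square by (rule nn_integral_eq_integral) auto

lemma nn_norm_L2_diff:
  "(\<integral>\<^sup>+x. ennreal ((cmod (rep_L2 \<psi> x - rep_L2 \<phi> x))\<^sup>2) \<partial>lborel) = ennreal ((norm (\<psi> - \<phi>))\<^sup>2)"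
  unfolding nn_norm_L2_square[symmetric] using rep_L2_diff[of \<psi> \<phi>]
  by (intro nn_integral_cong_AE) auto

lemma norm_abs_L2:
  assumes "square_integrable f"
  shows "(norm (abs_L2 f))\<^sup>2 = (LBINT x. (cmod (f x))\<^sup>2)"
proof -
  have [measurable]: "f \<in> borel_measurable borel" using assms by (simp add: square_integrable_def)
  show ?thesis unfolding norm_L2_square using rep_abs_L2[OF assms]
    by (intro integral_cong_AE) auto
qed

section \<open>Completeness of the space of square integrable functions\<close>

text \<open>The limit g is only a measurable function here, hence the bound on a nonnegative
  integral: it is what later shows that such a limit is square integrable.\<close>

lemma L2_Fatou:
  assumes [measurable]: "g \<in> borel_measurable borel"
    and lim: "AE x in lborel. (\<lambda>n. rep_L2 (X n) x) \<longlonglongrightarrow> g x"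
    and le: "\<And>n. norm (X n - \<phi>) \<le> C"
  shows "(\<integral>\<^sup>+x. ennreal ((cmod (g x - rep_L2 \<phi> x))\<^sup>2) \<partial>lborel) \<le> ennreal (C\<^sup>2)"
proof -
  have "(\<integral>\<^sup>+x. ennreal ((cmod (g x - rep_L2 \<phi> x))\<^sup>2) \<partial>lborel) =
      (\<integral>\<^sup>+x. liminf (\<lambda>n. ennreal ((cmod (rep_L2 (X n) x - rep_L2 \<phi> x))\<^sup>2)) \<partial>lborel)"
  proof (rule nn_integral_cong_AE, use lim in eventually_elim)
    fix x assume "(\<lambda>n. rep_L2 (X n) x) \<longlonglongrightarrow> g x"
    then have "(\<lambda>n. ennreal ((cmod (rep_L2 (X n) x - rep_L2 \<phi> x))\<^sup>2)) \<longlonglongrightarrow>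
        ennreal ((cmod (g x - rep_L2 \<phi> x))\<^sup>2)"
      by (intro tendsto_intros)
    from lim_imp_Liminf[OF sequentially_bot this]
    show "ennreal ((cmod (g x - rep_L2 \<phi> x))\<^sup>2) =
        liminf (\<lambda>n. ennreal ((cmod (rep_L2 (X n) x - rep_L2 \<phi> x))\<^sup>2))" ..
  qed
  also have "\<dots> \<le> liminf (\<lambda>n. \<integral>\<^sup>+x. ennreal ((cmod (rep_L2 (X n) x - rep_L2 \<phi> x))\<^sup>2) \<partial>lborel)"
    by (rule nn_integral_liminf) measurable
  also have "\<dots> = liminf (\<lambda>n. ennreal ((norm (X n - \<phi>))\<^sup>2))"
    by (simp only: nn_norm_L2_diff)
  also have "\<dots> \<le> liminf (\<lambda>n. ennreal (C\<^sup>2))"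
    by (intro Liminf_mono always_eventually allI ennreal_leI power_mono le) simp
  also have "\<dots> = ennreal (C\<^sup>2)" by (simp add: Liminf_const)
  finally show ?thesis .
qed

text \<open>Fatou's lemma along tails of the sequence makes the distance between g and the norm
  limit smaller than every positive e.\<close>

lemma L2_limit_AE:
  assumes [measurable]: "g \<in> borel_measurable borel"
    and lim: "AE x in lborel. (\<lambda>n. rep_L2 (X n) x) \<longlonglongrightarrow> g x"
    and X: "X \<longlonglongrightarrow> \<psi>"
  shows "AE x in lborel. rep_L2 \<psi> x = g x"
proof -
  have le: "(\<integral>\<^sup>+x. ennreal ((cmod (g x - rep_L2 \<psi> x))\<^sup>2) \<partial>lborel) \<le> ennreal (e\<^sup>2)" if "0 < e" for e
  proof -
    obtain N where N: "\<And>n. N \<le> n \<Longrightarrow> norm (X n - \<psi>) < e"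
      using X \<open>0 < e\<close> by (meson LIMSEQ_iff)
    show ?thesis
    proof (rule L2_Fatou[where X = "\<lambda>n. X (n + N)"])
      show "AE x in lborel. (\<lambda>n. rep_L2 (X (n + N)) x) \<longlonglongrightarrow> g x"
        using lim by eventually_elim (rule LIMSEQ_ignore_initial_segment)
    qed (use N in \<open>auto simp: less_imp_le\<close>)
  qed
  have "(\<integral>\<^sup>+x. ennreal ((cmod (g x - rep_L2 \<psi> x))\<^sup>2) \<partial>lborel) \<le> 0"
  proof (rule ennreal_le_epsilon)
    fix e :: real assume "0 < e"
    then show "(\<integral>\<^sup>+x. ennreal ((cmod (g x - rep_L2 \<psi> x))\<^sup>2) \<partial>lborel) \<le> 0 + ennreal e"
      using le[of "sqrt e"] by simp
  qed
  then have "AE x in lborel. ennreal ((cmod (g x - rep_L2 \<psi> x))\<^sup>2) = 0"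
    by (subst (asm) le_zero_eq, subst (asm) nn_integral_0_iff_AE) auto
  then show ?thesis by eventually_elim (auto simp: ennreal_eq_0_iff)
qed

text \<open>A rapidly converging subsequence converges almost everywhere. Fatou's lemma puts its
  limit into the space and keeps the rate, and the Cauchy property extends convergence to the full
  sequence.\<close>

lemma L2_Cauchy_convergent:
  fixes X :: "nat \<Rightarrow> 'a::euclidean_space L2"
  assumes X: "Cauchy X"
  shows "convergent X"
proof -
  have "\<forall>k. \<exists>M. \<forall>m\<ge>M. \<forall>n\<ge>M. norm (X m - X n) < (1/4)^k"
    using X by (metis Cauchy_iff zero_less_divide_1_iff zero_less_numeral zero_less_power)
  then obtain M where M: "\<And>k m n. M k \<le> m \<Longrightarrow> M k \<le> n \<Longrightarrow> norm (X m - X n) < (1/4)^k"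
    by metis
  \<comment> \<open>The sum makes \<open>r k\<close> at least \<open>M k\<close>; the summand
    \<open>k\<close> makes \<open>r\<close> strictly increasing.\<close>
  define r where "r k = (\<Sum>i\<le>k. M i) + k" for k
  have rM: "M k \<le> r k" for k unfolding r_def by (rule trans_le_add1, rule member_le_sum) auto
  have rmono: "strict_mono r" by (auto simp: r_def strict_mono_Suc_iff)
  have rle: "r k \<le> r l" if "k \<le> l" for k l using rmono that by (simp add: strict_mono_less_eq)
  define U where "U k = X (r k)" for k
  have U: "norm (U l - U k) \<le> (1/4)^k" if "k \<le> l" for k l
    using M[of k "r l" "r k"] rM[of k] rle[OF that] by (simp add: U_def)
  \<comment> \<open>The weights \<open>4\<^sup>k\<close> make \<open>|d k x| = O(2\<^sup>-\<^sup>k)\<close> almost everywhere.\<close>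
  define d where "d k x = rep_L2 (U (Suc k)) x - rep_L2 (U k) x" for k x
  have [measurable]: "d k \<in> borel_measurable borel" for k unfolding d_def by measurable
  have "(\<integral>\<^sup>+x. (\<Sum>k. ennreal (4^k * (cmod (d k x))\<^sup>2)) \<partial>lborel) =
      (\<Sum>k. \<integral>\<^sup>+x. ennreal (4^k * (cmod (d k x))\<^sup>2) \<partial>lborel)"
    by (rule nn_integral_suminf) measurable
  also have "\<dots> \<le> (\<Sum>k. ennreal ((1/4)^k))"
  proof (rule suminf_le)
    fix k
    have "(\<integral>\<^sup>+x. ennreal (4^k * (cmod (d k x))\<^sup>2) \<partial>lborel) =
        ennreal (4^k) * (\<integral>\<^sup>+x. ennreal ((cmod (d k x))\<^sup>2) \<partial>lborel)"
      by (subst nn_integral_cmult[symmetric]) (auto simp: ennreal_mult)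
    also have "\<dots> = ennreal (4^k * (norm (U (Suc k) - U k))\<^sup>2)"
      by (simp add: d_def nn_norm_L2_diff ennreal_mult)
    also have "\<dots> \<le> ennreal (4^k * ((1/4)^k)\<^sup>2)"
      by (intro ennreal_leI mult_left_mono power_mono U) auto
    also have "4^k * ((1/4)^k)\<^sup>2 = (1/4::real)^k"
      by (simp add: power2_eq_square power_divide)
    finally show "(\<integral>\<^sup>+x. ennreal (4^k * (cmod (d k x))\<^sup>2) \<partial>lborel) \<le> ennreal ((1/4)^k)" .
  qed auto
  also have "\<dots> < \<infinity>"
    by (subst suminf_ennreal2) (auto intro!: summable_geometric simp: less_top)
  finally have "AE x in lborel. (\<Sum>k. ennreal (4^k * (cmod (d k x))\<^sup>2)) \<noteq> \<infinity>"
    by (intro nn_integral_PInf_AE) auto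
  then have conv: "AE x in lborel. convergent (\<lambda>k. rep_L2 (U k) x)"
  proof eventually_elim
    fix x assume fin: "(\<Sum>k. ennreal (4^k * (cmod (d k x))\<^sup>2)) \<noteq> \<infinity>"
    then have "summable (\<lambda>k. 4^k * (cmod (d k x))\<^sup>2)"
      by (intro summable_suminf_not_top) (auto simp: infinity_ennreal_def)
    then obtain K where "\<And>k. norm (4^k * (cmod (d k x))\<^sup>2) \<le> K"
      unfolding Bseq_def by (blast dest: summable_imp_Bseq[unfolded Bseq_def])
    then have K: "4^k * (cmod (d k x))\<^sup>2 \<le> K" for k by simp
    have "cmod (d k x) \<le> sqrt K * (1/2)^k" for k
    proof -
      have "(2^k * cmod (d k x))\<^sup>2 \<le> K"
      proof -
        have "((2::real)^k)\<^sup>2 = 4^k" by (simp add: power2_eq_square flip: power_mult_distrib)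
        then show ?thesis using K[of k] by (simp add: power_mult_distrib)
      qed
      then have "2^k * cmod (d k x) \<le> sqrt K" by (rule real_le_rsqrt)
      then show ?thesis by (simp add: power_divide field_simps)
    qed
    then have "summable (\<lambda>k. d k x)"
      by (intro summable_comparison_test'[OF summable_mult[OF summable_geometric[of "1/2::real"]], of 0 _ "sqrt K"])
        auto
    then show "convergent (\<lambda>k. rep_L2 (U k) x)"
    proof -
      have "(\<lambda>k. \<Sum>i<k. d i x) = (\<lambda>k. rep_L2 (U k) x - rep_L2 (U 0) x)"
        using sum_lessThan_telescope[of "\<lambda>i. rep_L2 (U i) x"] by (simp add: d_def)
      then have "(\<lambda>k. rep_L2 (U k) x - rep_L2 (U 0) x) \<longlonglongrightarrow> (\<Sum>k. d k x)"
        using summable_LIMSEQ[OF \<open>summable (\<lambda>k. d k x)\<close>] by simp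
      from tendsto_add[OF this tendsto_const[of "rep_L2 (U 0) x"]]
      show ?thesis by (auto simp: convergent_def)
    qed
  qed
  define g where "g x = lim (\<lambda>k. rep_L2 (U k) x)" for x
  have [measurable]: "g \<in> borel_measurable borel" unfolding g_def by measurable
  have lim: "AE x in lborel. (\<lambda>k. rep_L2 (U k) x) \<longlonglongrightarrow> g x"
    using conv unfolding g_def by eventually_elim (simp add: convergent_LIMSEQ_iff)
  have Fat: "(\<integral>\<^sup>+x. ennreal ((cmod (g x - rep_L2 (U k) x))\<^sup>2) \<partial>lborel) \<le> ennreal (((1/4)^k)\<^sup>2)" for k
  proof (rule L2_Fatou[where X = "\<lambda>n. U (n + k)"])
    show "AE x in lborel. (\<lambda>n. rep_L2 (U (n + k)) x) \<longlonglongrightarrow> g x"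
      using lim by eventually_elim (rule LIMSEQ_ignore_initial_segment)
  qed (use U in auto)
  have sq: "square_integrable (\<lambda>x. g x - rep_L2 (U k) x)" for k
    unfolding square_integrable_def
  proof
    show "integrable lborel (\<lambda>x. (cmod (g x - rep_L2 (U k) x))\<^sup>2)"
      using Fat[of k] by (intro integrableI_bounded) (auto simp: le_less_trans)
  qed measurable
  have "square_integrable (\<lambda>x. (g x - rep_L2 (U 0) x) + rep_L2 (U 0) x)"
    by (rule square_integrable_add[OF sq square_integrable_rep])
  then have g: "square_integrable g" by simp
  define G where "G = abs_L2 g"
  have "norm (G - U k) \<le> (1/4)^k" for k
  proof -
    have "ennreal ((norm (G - U k))\<^sup>2) \<le> ennreal (((1/4)^k)\<^sup>2)"
      using rep_abs_L2[OF g] Fat[of k] unfolding nn_norm_L2_diff[symmetric] G_def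
      by (subst nn_integral_cong_AE[where v = "\<lambda>x. ennreal ((cmod (g x - rep_L2 (U k) x))\<^sup>2)"]) auto
    then show ?thesis by (subst (asm) ennreal_le_iff) (auto dest: power2_le_imp_le)
  qed
  then have "(\<lambda>k. norm (U k - G)) \<longlonglongrightarrow> 0"
    by (intro Lim_null_comparison[OF _ LIMSEQ_power_zero[of "1/4::real"]] always_eventually)
      (auto simp: norm_minus_commute)
  then have "(X \<circ> r) \<longlonglongrightarrow> G" by (simp add: U_def[abs_def] o_def tendsto_norm_zero_iff LIM_zero_iff)
  then have "X \<longlonglongrightarrow> G" by (rule Cauchy_converges_subseq[OF X rmono])
  then show ?thesis by (auto simp: convergent_def)
qed

instance L2 :: (euclidean_space) banach
  by standard (rule L2_Cauchy_convergent)

section \<open>Multiplication operators and plane waves\<close>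

lemma square_integrable_mult_bounded:
  assumes [measurable]: "f \<in> borel_measurable borel" and f: "\<And>x. cmod (f x) \<le> K"
    and g: "square_integrable g"
  shows "square_integrable (\<lambda>x. f x * g x)"
  unfolding square_integrable_def
proof
  have [measurable]: "g \<in> borel_measurable borel" using g by (simp add: square_integrable_def)
  show "(\<lambda>x. f x * g x) \<in> borel_measurable borel" by measurable
  show "integrable lborel (\<lambda>x. (cmod (f x * g x))\<^sup>2)"
  proof (rule Bochner_Integration.integrable_bound)
    show "integrable lborel (\<lambda>x. K\<^sup>2 * (cmod (g x))\<^sup>2)" using g by (simp add: square_integrable_def)
    show "AE x in lborel. norm ((cmod (f x * g x))\<^sup>2) \<le> norm (K\<^sup>2 * (cmod (g x))\<^sup>2)"
      using f by (intro AE_I2) (auto simp: norm_mult power_mult_distrib intro!: mult_right_mono power_mono)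
  qed measurable
qed

text \<open>Resolves the \<open>THE\<close> in \<open>mult_op\<close>: boundedness of f makes the
  pointwise product a bounded operator, and \<open>L2_eqI\<close> leaves no other one with these
  values.\<close>

lemma mult_op_rep:
  assumes [measurable]: "f \<in> borel_measurable borel" and f: "\<And>x. cmod (f x) \<le> K"
  shows "AE x in lborel. rep_L2 (mult_op f \<psi>) x = f x * rep_L2 \<psi> x"
proof -
  note sq = square_integrable_mult_bounded[OF assms square_integrable_rep]
  define t where "t \<psi> = abs_L2 (\<lambda>x. f x * rep_L2 \<psi> x)" for \<psi>
  have t: "AE x in lborel. rep_L2 (t \<psi>) x = f x * rep_L2 \<psi> x" for \<psi>
    unfolding t_def by (rule rep_abs_L2[OF sq])
  have K: "0 \<le> K" using f order_trans[OF norm_ge_zero] by blast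
  obtain T :: "'a L2 op" where T: "\<And>\<psi>. T \<psi> = t \<psi>"
  proof (rule cblinfun_exists[where f = t and K = K])
    show "t (\<psi> + \<phi>) = t \<psi> + t \<phi>" for \<psi> \<phi>
      by (rule L2_eqI)
        (use t[of "\<psi> + \<phi>"] t[of \<psi>] t[of \<phi>] rep_L2_add[of \<psi> \<phi>] rep_L2_add[of "t \<psi>" "t \<phi>"]
          in \<open>eventually_elim, simp add: distrib_left\<close>)
    show "t (c *\<^sub>C \<psi>) = c *\<^sub>C t \<psi>" for c \<psi>
      by (rule L2_eqI)
        (use t[of "c *\<^sub>C \<psi>"] t[of \<psi>] rep_L2_scaleC[of c \<psi>] rep_L2_scaleC[of c "t \<psi>"]
          in \<open>eventually_elim, simp\<close>)
    show "norm (t \<psi>) \<le> K * norm \<psi>" for \<psi>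
    proof (rule power2_le_imp_le)
      have "(norm (t \<psi>))\<^sup>2 = (LBINT x. (cmod (f x * rep_L2 \<psi> x))\<^sup>2)"
        unfolding t_def by (rule norm_abs_L2[OF sq])
      also have "\<dots> \<le> (LBINT x. K\<^sup>2 * (cmod (rep_L2 \<psi> x))\<^sup>2)"
        using sq[of \<psi>] f by (intro integral_mono)
          (auto simp: square_integrable_def norm_mult power_mult_distrib intro!: mult_right_mono power_mono)
      also have "\<dots> = (K * norm \<psi>)\<^sup>2" by (simp add: norm_L2_square power_mult_distrib)
      finally show "(norm (t \<psi>))\<^sup>2 \<le> (K * norm \<psi>)\<^sup>2" .
    qed (simp add: K)
  qed blast
  have "mult_op f = T"
    unfolding mult_op_def
  proof (rule the_equality)
    fix S :: "'a L2 op" assume S: "\<forall>\<psi>. AE x in lborel. rep_L2 (S \<psi>) x = f x * rep_L2 \<psi> x"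
    show "S = T"
    proof (rule cblinfun_eqI, rule L2_eqI)
      show "AE x in lborel. rep_L2 (S \<psi>) x = rep_L2 (T \<psi>) x" for \<psi>
        using spec[OF S, of \<psi>] t[of \<psi>] by eventually_elim (simp add: T)
    qed
  qed (simp add: T t)
  then show ?thesis using t[of \<psi>] by (simp add: T)
qed

lemma cinner_mult_op:
  assumes [measurable]: "f \<in> borel_measurable borel" and f: "\<And>x. cmod (f x) \<le> K"
  shows "cinner \<psi> (mult_op f \<phi>) = (LBINT x. cnj (rep_L2 \<psi> x) * (f x * rep_L2 \<phi> x))"
  unfolding cinner_L2 using mult_op_rep[OF assms, of \<phi>] by (intro integral_cong_AE) auto

lemma norm_mult_op:
  assumes [measurable]: "f \<in> borel_measurable borel" and f: "\<And>x. cmod (f x) \<le> K"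
  shows "(norm (mult_op f \<psi>))\<^sup>2 = (LBINT x. (cmod (f x * rep_L2 \<psi> x))\<^sup>2)"
  unfolding norm_L2_square using mult_op_rep[OF assms, of \<psi>] by (intro integral_cong_AE) auto

text \<open>The multiplier of \<open>E_op\<close>, named as a function of frequency and position so
  that it is jointly measurable in Fubini's theorem.\<close>

definition plane_wave :: "'a::euclidean_space \<Rightarrow> 'a \<Rightarrow> complex" where
  "plane_wave \<omega> x = exp (\<i> * of_real (\<omega> \<bullet> x))"

lemma plane_wave_measurable [measurable (raw)]:
  "f \<in> borel_measurable M \<Longrightarrow> g \<in> borel_measurable M \<Longrightarrow> (\<lambda>x. plane_wave (f x) (g x)) \<in> borel_measurable M"
  unfolding plane_wave_def by measurable

lemma norm_plane_wave [simp]: "cmod (plane_wave \<omega> x) = 1"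
  by (simp add: plane_wave_def)

lemma cnj_plane_wave: "cnj (plane_wave \<omega> x) = plane_wave (- \<omega>) x"
  by (simp add: plane_wave_def exp_cnj)

lemma plane_wave_diff: "plane_wave \<omega> (x - y) = plane_wave \<omega> x * plane_wave (- \<omega>) y"
  by (simp add: plane_wave_def exp_add[symmetric] algebra_simps inner_diff_right)

lemma E_op_eq: "E_op \<omega> = mult_op (plane_wave \<omega>)"
  by (simp add: E_op_def plane_wave_def[abs_def])

lemma E_op_rep: "AE x in lborel. rep_L2 (E_op \<omega> \<psi>) x = plane_wave \<omega> x * rep_L2 \<psi> x"
  unfolding E_op_eq by (rule mult_op_rep[where K = 1]) auto

lemma cinner_E_op: "cinner \<psi> (E_op \<omega> \<phi>) = (LBINT x. cnj (rep_L2 \<psi> x) * (plane_wave \<omega> x * rep_L2 \<phi> x))"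
  unfolding E_op_eq by (rule cinner_mult_op[where K = 1]) auto

lemma adj_E_op: "adj_op (E_op \<omega>) = E_op (- \<omega>)"
proof (rule adj_opI)
  show "cinner (E_op (- \<omega>) \<psi>) \<phi> = cinner \<psi> (E_op \<omega> \<phi>)" for \<psi> \<phi>
    unfolding cinner_L2
    by (rule integral_cong_AE)
      (use E_op_rep[of "- \<omega>" \<psi>] E_op_rep[of \<omega> \<phi>] in \<open>auto simp: cnj_plane_wave ac_simps\<close>)
qed

lemma norm_E_op [simp]: "norm (E_op \<omega> \<psi>) = norm \<psi>"
proof -
  have "(norm (E_op \<omega> \<psi>))\<^sup>2 = (norm \<psi>)\<^sup>2"
    unfolding E_op_eq by (subst norm_mult_op[where K = 1]) (auto simp: norm_mult norm_L2_square)
  then show ?thesis by simp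
qed

text \<open>Strong continuity, by dominated convergence: two plane waves differ by at most 2, whence
  the factor 4. It suffices for traces against R, which see only the vectors f_n and a summable
  tail.\<close>

lemma E_op_continuous: "continuous_on UNIV (\<lambda>\<omega>. E_op \<omega> \<psi>)"
proof (clarsimp simp: continuous_on_sequentially)
  fix w :: "nat \<Rightarrow> 'a" and \<omega> assume w: "w \<longlonglongrightarrow> \<omega>"
  let ?g = "\<lambda>n x. (cmod ((plane_wave (w n) x - plane_wave \<omega> x) * rep_L2 \<psi> x))\<^sup>2"
  have sq: "(norm (E_op (w n) \<psi> - E_op \<omega> \<psi>))\<^sup>2 = (LBINT x. ?g n x)" for n
    unfolding norm_L2_square
    by (rule integral_cong_AE)
      (use E_op_rep[of "w n" \<psi>] E_op_rep[of \<omega> \<psi>] rep_L2_diff[of "E_op (w n) \<psi>" "E_op \<omega> \<psi>"]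
        in \<open>auto simp: left_diff_distrib\<close>)
  have "(\<lambda>n. LBINT x. ?g n x) \<longlonglongrightarrow> (\<integral>x. 0 \<partial>(lborel :: 'a measure))"
  proof (rule integral_dominated_convergence)
    show "integrable lborel (\<lambda>x. 4 * (cmod (rep_L2 \<psi> x))\<^sup>2)" by simp
    show "AE x in lborel. (\<lambda>n. ?g n x) \<longlonglongrightarrow> 0"
    proof (rule AE_I2)
      fix x
      have "(\<lambda>n. plane_wave (w n) x) \<longlonglongrightarrow> plane_wave \<omega> x"
        unfolding plane_wave_def by (intro tendsto_intros w)
      then have "(\<lambda>n. ?g n x) \<longlonglongrightarrow> (cmod ((plane_wave \<omega> x - plane_wave \<omega> x) * rep_L2 \<psi> x))\<^sup>2"
        by (intro tendsto_intros)
      then show "(\<lambda>n. ?g n x) \<longlonglongrightarrow> 0" by simp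
    qed
    show "AE x in lborel. norm (?g n x) \<le> 4 * (cmod (rep_L2 \<psi> x))\<^sup>2" for n
    proof (rule AE_I2)
      fix x
      have "(cmod (plane_wave (w n) x - plane_wave \<omega> x))\<^sup>2 \<le> 2\<^sup>2"
        using norm_triangle_ineq4[of "plane_wave (w n) x" "plane_wave \<omega> x"] by (intro power_mono) auto
      then show "norm (?g n x) \<le> 4 * (cmod (rep_L2 \<psi> x))\<^sup>2"
        by (auto simp: norm_mult power_mult_distrib intro!: mult_right_mono)
    qed
  qed auto
  then have "(\<lambda>n. sqrt ((norm (E_op (w n) \<psi> - E_op \<omega> \<psi>))\<^sup>2)) \<longlonglongrightarrow> sqrt 0"
    unfolding sq by (intro tendsto_real_sqrt) simp
  then show "((\<lambda>\<omega>. E_op \<omega> \<psi>) \<circ> w) \<longlonglongrightarrow> E_op \<omega> \<psi>"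
    by (simp add: o_def tendsto_norm_zero_iff LIM_zero_iff)
qed

section \<open>Permutations of the particles\<close>

text \<open>The preimage of a box is the box with its blocks of coordinates permuted, whose volume
  is the same product in another order. Boxes determine \<open>lborel\<close>.\<close>

lemma lborel_distr_permute:
  fixes \<sigma> :: "'n::finite \<Rightarrow> 'n"
  assumes \<sigma>: "bij \<sigma>"
  shows "distr lborel borel (\<lambda>x :: 'a::euclidean_space ^ 'n. \<chi> j. x $ \<sigma> j) = lborel"
proof (rule lborel_eqI[symmetric])
  let ?T = "\<lambda>x :: 'a ^ 'n. \<chi> j. x $ \<sigma> j"
  let ?S = "\<lambda>x :: 'a ^ 'n. \<chi> j. x $ inv \<sigma> j"
  have s: "\<sigma> (inv \<sigma> j) = j" "inv \<sigma> (\<sigma> j) = j" for j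
    using \<sigma> by (simp_all add: bij_is_surj surj_f_inv_f bij_is_inj)
  have cont: "continuous_on UNIV ?T" by (intro continuous_intros)
  have m: "?T \<in> borel \<rightarrow>\<^sub>M borel" by (rule borel_measurable_continuous_onI[OF cont])
  have basis: "Basis = (\<lambda>(i, b). axis i (b :: 'a)) ` (UNIV \<times> Basis)"
    by (auto simp: Basis_vec_def)
  have inj: "inj_on (\<lambda>(i :: 'n, b). axis i (b :: 'a)) (UNIV \<times> Basis)"
    by (auto simp: inj_on_def axis_eq_axis nonzero_Basis)
  fix l u :: "'a ^ 'n" assume le: "\<And>b. b \<in> Basis \<Longrightarrow> l \<bullet> b \<le> u \<bullet> b"
  have le': "?S l \<bullet> b \<le> ?S u \<bullet> b" if b: "b \<in> Basis" for b
  proof -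
    obtain i c where "b = axis i c" "c \<in> Basis" using b unfolding Basis_vec_def by blast
    moreover have "axis (inv \<sigma> i) c \<in> Basis" using \<open>c \<in> Basis\<close> by (auto simp: Basis_vec_def)
    ultimately show ?thesis using le[of "axis (inv \<sigma> i) c"] by (simp add: inner_axis)
  qed
  have "?T -` box l u = box (?S l) (?S u)"
  proof (rule set_eqI)
    fix x
    have "(x \<in> box (?S l) (?S u)) \<longleftrightarrow> (\<forall>i. \<forall>b\<in>Basis. l $ inv \<sigma> i \<bullet> b < x $ i \<bullet> b \<and> x $ i \<bullet> b < u $ inv \<sigma> i \<bullet> b)"
      by (auto simp: mem_box Basis_vec_def inner_axis)
    also have "\<dots> \<longleftrightarrow> (\<forall>i. \<forall>b\<in>Basis. l $ i \<bullet> b < x $ \<sigma> i \<bullet> b \<and> x $ \<sigma> i \<bullet> b < u $ i \<bullet> b)"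
      by (metis s)
    also have "\<dots> \<longleftrightarrow> x \<in> ?T -` box l u"
      by (auto simp: mem_box Basis_vec_def inner_axis)
    finally show "x \<in> ?T -` box l u \<longleftrightarrow> x \<in> box (?S l) (?S u)" ..
  qed
  then have "emeasure (distr lborel borel ?T) (box l u) = emeasure lborel (box (?S l) (?S u))"
    using m by (simp add: emeasure_distr)
  also have "\<dots> = (\<Prod>b\<in>Basis. (?S u - ?S l) \<bullet> b)"
    by (simp add: emeasure_lborel_box_eq le')
  also have "(\<Prod>b\<in>Basis. (?S u - ?S l) \<bullet> b) = (\<Prod>b\<in>Basis. (u - l) \<bullet> b)"
  proof -
    have "(\<Prod>b\<in>Basis. (?S u - ?S l) \<bullet> b) = (\<Prod>(i, b)\<in>UNIV \<times> Basis. (u $ inv \<sigma> i - l $ inv \<sigma> i) \<bullet> b)"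
      unfolding basis by (subst prod.reindex[OF inj]) (simp add: split_beta inner_axis)
    also have "\<dots> = (\<Prod>(i, b)\<in>UNIV \<times> Basis. (u $ i - l $ i) \<bullet> b)"
      by (rule prod.reindex_bij_witness[of _ "\<lambda>(i, b). (\<sigma> i, b)" "\<lambda>(i, b). (inv \<sigma> i, b)"])
        (auto simp: s)
    also have "\<dots> = (\<Prod>b\<in>Basis. (u - l) \<bullet> b)"
      unfolding basis by (subst prod.reindex[OF inj]) (simp add: split_beta inner_axis)
    finally show ?thesis .
  qed
  finally show "emeasure (distr lborel borel ?T) (box l u) = (\<Prod>b\<in>Basis. (u - l) \<bullet> b)" .
qed simp

lemma perm_op_rep:
  fixes \<sigma> :: "'n::finite \<Rightarrow> 'n" and \<Psi> :: "('a::euclidean_space ^ 'n) L2"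
  assumes "bij \<sigma>"
  shows "AE x in lborel. rep_L2 (perm_op \<sigma> \<Psi>) x = rep_L2 \<Psi> (\<chi> j. x $ inv \<sigma> j)"
proof -
  let ?S = "\<lambda>x :: 'a ^ 'n. \<chi> j. x $ inv \<sigma> j"
  have D: "distr lborel borel ?S = lborel" by (rule lborel_distr_permute) (simp add: assms bij_imp_bij_inv)
  have "continuous_on UNIV ?S" by (intro continuous_intros)
  then have m [measurable]: "?S \<in> borel \<rightarrow>\<^sub>M borel" by (rule borel_measurable_continuous_onI)
  \<comment> \<open>The substitution preserves null sets because it preserves \<open>lborel\<close>;
    identities between representatives may be evaluated at the permuted point.\<close>
  have AE: "AE x in lborel. P (?S x)" if "AE x in lborel. P x" for P
    using that by (subst (asm) D[symmetric]) (auto dest!: AE_distrD[rotated])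
  have sq: "square_integrable (\<lambda>x. rep_L2 \<Psi> (?S x))" for \<Psi> :: "('a ^ 'n) L2"
  proof -
    have "integrable (distr lborel borel ?S) (\<lambda>x. (cmod (rep_L2 \<Psi> x))\<^sup>2)" unfolding D by simp
    then have "integrable lborel (\<lambda>x. (cmod (rep_L2 \<Psi> (?S x)))\<^sup>2)"
      by (subst (asm) integrable_distr_eq) auto
    then show ?thesis by (simp add: square_integrable_def)
  qed
  define t where "t \<Psi> = abs_L2 (\<lambda>x. rep_L2 \<Psi> (?S x))" for \<Psi>
  have t: "AE x in lborel. rep_L2 (t \<Psi>) x = rep_L2 \<Psi> (?S x)" for \<Psi>
    unfolding t_def by (rule rep_abs_L2[OF sq])
  obtain T :: "('a ^ 'n) L2 op" where T: "\<And>\<Psi>. T \<Psi> = t \<Psi>"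
  proof (rule cblinfun_exists[where f = t and K = 1])
    show "t (\<psi> + \<phi>) = t \<psi> + t \<phi>" for \<psi> \<phi>
      by (rule L2_eqI)
        (use t[of "\<psi> + \<phi>"] t[of \<psi>] t[of \<phi>] AE[OF rep_L2_add[of \<psi> \<phi>]] rep_L2_add[of "t \<psi>" "t \<phi>"]
          in \<open>eventually_elim, simp\<close>)
    show "t (c *\<^sub>C \<psi>) = c *\<^sub>C t \<psi>" for c \<psi>
      by (rule L2_eqI)
        (use t[of "c *\<^sub>C \<psi>"] t[of \<psi>] AE[OF rep_L2_scaleC[of c \<psi>]] rep_L2_scaleC[of c "t \<psi>"]
          in \<open>eventually_elim, simp\<close>)
    show "norm (t \<psi>) \<le> 1 * norm \<psi>" for \<psi>
    proof -
      have "(norm (t \<psi>))\<^sup>2 = (LBINT x. (cmod (rep_L2 \<psi> (?S x)))\<^sup>2)"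
        unfolding t_def by (rule norm_abs_L2[OF sq])
      also have "\<dots> = (\<integral>x. (cmod (rep_L2 \<psi> x))\<^sup>2 \<partial>distr lborel borel ?S)"
        by (subst integral_distr) auto
      also have "\<dots> = (norm \<psi>)\<^sup>2" unfolding D norm_L2_square ..
      finally show ?thesis by simp
    qed
  qed blast
  have "perm_op \<sigma> = T"
    unfolding perm_op_def
  proof (rule the_equality)
    fix S :: "('a ^ 'n) L2 op"
    assume S: "\<forall>\<Psi>. AE x in lborel. rep_L2 (S \<Psi>) x = rep_L2 \<Psi> (\<chi> j. x $ inv \<sigma> j)"
    show "S = T"
    proof (rule cblinfun_eqI, rule L2_eqI)
      show "AE x in lborel. rep_L2 (S \<psi>) x = rep_L2 (T \<psi>) x" for \<psi>
        using spec[OF S, of \<psi>] t[of \<psi>] by eventually_elim (simp add: T)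
    qed
  qed (simp add: T t)
  then show ?thesis using t[of \<Psi>] by (simp add: T)
qed

lemma perm_op_inverse:
  fixes \<sigma> :: "'n::finite \<Rightarrow> 'n" and \<Psi> :: "('a::euclidean_space ^ 'n) L2"
  assumes \<sigma>: "bij \<sigma>"
  shows "perm_op \<sigma> (perm_op (inv \<sigma>) \<Psi>) = \<Psi>"
proof (rule L2_eqI)
  let ?S = "\<lambda>x :: 'a ^ 'n. \<chi> j. x $ inv \<sigma> j"
  have i: "bij (inv \<sigma>)" by (rule bij_imp_bij_inv[OF \<sigma>])
  have D: "distr lborel borel ?S = lborel" by (rule lborel_distr_permute[OF i])
  have "continuous_on UNIV ?S" by (intro continuous_intros)
  then have m [measurable]: "?S \<in> borel \<rightarrow>\<^sub>M borel" by (rule borel_measurable_continuous_onI)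
  have "AE x in lborel. rep_L2 (perm_op (inv \<sigma>) \<Psi>) (?S x) = rep_L2 \<Psi> (\<chi> j. ?S x $ inv (inv \<sigma>) j)"
    using perm_op_rep[OF i, of \<Psi>] by (subst (asm) D[symmetric]) (auto dest!: AE_distrD[rotated])
  with perm_op_rep[OF \<sigma>, of "perm_op (inv \<sigma>) \<Psi>"]
  show "AE x in lborel. rep_L2 (perm_op \<sigma> (perm_op (inv \<sigma>) \<Psi>)) x = rep_L2 \<Psi> x"
    by eventually_elim (simp add: inv_inv_eq[OF \<sigma>] inv_f_f[OF bij_is_inj[OF \<sigma>]])
qed

lemma adj_perm_op:
  fixes \<sigma> :: "'n::finite \<Rightarrow> 'n"
  assumes \<sigma>: "bij \<sigma>"
  shows "adj_op (perm_op \<sigma> :: ('a::euclidean_space ^ 'n) L2 op) = perm_op (inv \<sigma>)"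
proof (rule adj_opI)
  fix \<Phi> \<Psi> :: "('a ^ 'n) L2"
  let ?S = "\<lambda>x :: 'a ^ 'n. \<chi> j. x $ inv \<sigma> j"
  have i: "bij (inv \<sigma>)" by (rule bij_imp_bij_inv[OF \<sigma>])
  have D: "distr lborel borel ?S = lborel" by (rule lborel_distr_permute[OF i])
  have "continuous_on UNIV ?S" by (intro continuous_intros)
  then have m [measurable]: "?S \<in> borel \<rightarrow>\<^sub>M borel" by (rule borel_measurable_continuous_onI)
  \<comment> \<open>\<open>\<Phi>\<close> is written as \<open>perm_op \<sigma>\<close> of
    \<open>perm_op (inv \<sigma>) \<Phi>\<close>, so that both arguments carry the same permutation
    and one change of variables removes it.\<close>
  have "cinner (perm_op \<sigma> (perm_op (inv \<sigma>) \<Phi>)) (perm_op \<sigma> \<Psi>) =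
      (LBINT x. cnj (rep_L2 (perm_op (inv \<sigma>) \<Phi>) (?S x)) * rep_L2 \<Psi> (?S x))"
    unfolding cinner_L2
    by (rule integral_cong_AE)
      (use perm_op_rep[OF \<sigma>, of \<Psi>] perm_op_rep[OF \<sigma>, of "perm_op (inv \<sigma>) \<Phi>"] in auto)
  also have "\<dots> = (\<integral>x. cnj (rep_L2 (perm_op (inv \<sigma>) \<Phi>) x) * rep_L2 \<Psi> x \<partial>distr lborel borel ?S)"
    by (subst integral_distr) auto
  also have "\<dots> = cinner (perm_op (inv \<sigma>) \<Phi>) \<Psi>" unfolding D cinner_L2 ..
  finally show "cinner (perm_op (inv \<sigma>) \<Phi>) \<Psi> = cinner \<Phi> (perm_op \<sigma> \<Psi>)"
    by (simp add: perm_op_inverse[OF \<sigma>])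
qed

lemma scaleC_id_in_sym_ops: "c *\<^sub>C id_op \<in> (sym_ops :: ('a::euclidean_space ^ 'n::finite) L2 op set)"
  unfolding sym_ops_def
proof (intro CollectI allI impI)
  fix \<sigma> :: "'n \<Rightarrow> 'n" assume \<sigma>: "bij \<sigma>"
  show "perm_op \<sigma> o\<^sub>C (c *\<^sub>C id_op) o\<^sub>C adj_op (perm_op \<sigma>) = (c *\<^sub>C id_op :: ('a ^ 'n) L2 op)"
    by (rule cblinfun_eqI)
      (simp add: adj_perm_op[OF \<sigma>] cblinfun_rep cblinfun_scaleC perm_op_inverse[OF \<sigma>])
qed

text \<open>A vector on which a multiple of the identity reveals its scalar.\<close>

lemma unit_vector_L2_exists: "\<exists>\<psi> :: 'a::euclidean_space L2. norm \<psi> = 1"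
proof -
  let ?f = "indicator (cbox (0::'a) One) :: 'a \<Rightarrow> complex"
  have "(\<lambda>x. (cmod (?f x))\<^sup>2) = indicator (cbox (0::'a) One)" by (auto simp: indicator_def)
  then have i: "integrable lborel (\<lambda>x. (cmod (?f x))\<^sup>2)" "(LBINT x. (cmod (?f x))\<^sup>2) = 1"
    by (simp_all add: measure_lborel_cbox_eq)
  have "square_integrable ?f" unfolding square_integrable_def using i(1) by simp
  from norm_abs_L2[OF this] have "(norm (abs_L2 ?f))\<^sup>2 = 1\<^sup>2" by (simp add: i(2))
  then have "norm (abs_L2 ?f) = 1" by (rule power2_eq_imp_eq) auto
  then show ?thesis by blast
qed

section \<open>The integral kernel and its diagonal\<close>

lemma lborel_distr_translate: "distr lborel borel (\<lambda>x. x + h) = (lborel :: 'a::euclidean_space measure)"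
proof -
  have "(\<lambda>x. x + h) = (+) h" by (auto simp: add.commute)
  then show ?thesis using lborel_distr_plus[of h] by simp
qed

lemma AE_lborel_translate:
  fixes h :: "'a::euclidean_space"
  assumes "AE x in lborel. P x"
  shows "AE x in lborel. P (x + h)"
proof -
  have "AE x in distr lborel borel (\<lambda>x. x + h). P x" using assms by (simp only: lborel_distr_translate)
  then show ?thesis by (rule AE_distrD[rotated]) measurable
qed

lemma integral_lborel_translate:
  fixes h :: "'a::euclidean_space" and f :: "'a \<Rightarrow> 'b::{banach, second_countable_topology}"
  assumes [measurable]: "f \<in> borel_measurable borel"
  shows "integrable lborel (\<lambda>x. f (x + h)) \<longleftrightarrow> integrable lborel f"
    and "(LBINT x. f (x + h)) = (LBINT x. f x)"
  by (subst (2) lborel_distr_translate[of h, symmetric], subst integrable_distr_eq; simp)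
    (subst (2) lborel_distr_translate[of h, symmetric], subst integral_distr; simp)

text \<open>Shifting the second argument of a kernel with terms f_n(x) cnj (f_n(y)) to y = x + h
  translates the vectors f_n; continuity of the kernel in h is thereby reduced to continuity of
  translations.\<close>

definition translate_L2 :: "'a::euclidean_space \<Rightarrow> 'a L2 \<Rightarrow> 'a L2" where
  "translate_L2 h \<psi> = abs_L2 (\<lambda>x. rep_L2 \<psi> (x + h))"

lemma rep_translate_L2: "AE x in lborel. rep_L2 (translate_L2 h \<psi>) x = rep_L2 \<psi> (x + h)"
  unfolding translate_L2_def
proof (rule rep_abs_L2)
  show "square_integrable (\<lambda>x. rep_L2 \<psi> (x + h))"
    using integral_lborel_translate(1)[of "\<lambda>x. (cmod (rep_L2 \<psi> x))\<^sup>2" h] by (simp add: square_integrable_def)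
qed

lemma norm_translate_L2_diff:
  "(norm (translate_L2 h \<psi> - translate_L2 k \<phi>))\<^sup>2 = (LBINT x. (cmod (rep_L2 \<psi> (x + h) - rep_L2 \<phi> (x + k)))\<^sup>2)"
  unfolding norm_L2_square
  by (rule integral_cong_AE)
    (use rep_translate_L2[of h \<psi>] rep_translate_L2[of k \<phi>]
        rep_L2_diff[of "translate_L2 h \<psi>" "translate_L2 k \<phi>"] in auto)

lemma norm_translate_L2_same: "norm (translate_L2 h \<psi> - translate_L2 h \<phi>) = norm (\<psi> - \<phi>)"
proof -
  have "(norm (translate_L2 h \<psi> - translate_L2 h \<phi>))\<^sup>2 = (LBINT x. (cmod (rep_L2 \<psi> x - rep_L2 \<phi> x))\<^sup>2)"
    unfolding norm_translate_L2_diff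
    using integral_lborel_translate(2)[of "\<lambda>x. (cmod (rep_L2 \<psi> x - rep_L2 \<phi> x))\<^sup>2" h] by simp
  also have "\<dots> = (norm (\<psi> - \<phi>))\<^sup>2"
    unfolding norm_L2_square by (rule integral_cong_AE) (use rep_L2_diff[of \<psi> \<phi>] in auto)
  finally show ?thesis by simp
qed

lemma norm_L2_diff_abs:
  assumes g: "square_integrable g"
  shows "(norm (\<psi> - abs_L2 g))\<^sup>2 = (LBINT x. (cmod (rep_L2 \<psi> x - g x))\<^sup>2)"
proof -
  have [measurable]: "g \<in> borel_measurable borel" using g by (simp add: square_integrable_def)
  show ?thesis
    unfolding norm_L2_square
    by (rule integral_cong_AE) (use rep_abs_L2[OF g] rep_L2_diff[of \<psi> "abs_L2 g"] in auto)
qed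

lemma square_integrable_bounded_support:
  assumes [measurable]: "g \<in> borel_measurable borel"
    and g: "\<And>x. cmod (g x) \<le> B * indicator (cball 0 r) x"
  shows "square_integrable g"
  unfolding square_integrable_def
proof
  show "integrable lborel (\<lambda>x. (cmod (g x))\<^sup>2)"
  proof (rule Bochner_Integration.integrable_bound)
    have "integrable lborel (indicator (cball 0 r) :: 'a \<Rightarrow> real)"
      using emeasure_lborel_cball_finite[of "0::'a" r] by (simp add: less_top)
    then show "integrable lborel (\<lambda>x::'a. B\<^sup>2 * indicator (cball 0 r) x)" by simp
    show "AE x in lborel. norm ((cmod (g x))\<^sup>2) \<le> norm (B\<^sup>2 * indicator (cball 0 r) x)"
    proof (rule AE_I2)
      fix x
      have "(cmod (g x))\<^sup>2 \<le> (B * indicator (cball 0 r) x)\<^sup>2" by (intro power_mono g) simp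
      then show "norm ((cmod (g x))\<^sup>2) \<le> norm (B\<^sup>2 * indicator (cball 0 r) x)"
        by (cases "x \<in> cball 0 r") auto
    qed
  qed measurable
qed measurable

text \<open>Truncation in height and in radius, with one number r serving as both bounds.\<close>

lemma L2_approx_bounded_support:
  fixes \<psi> :: "'a::euclidean_space L2"
  assumes "0 < e"
  obtains f r where "f \<in> borel_measurable borel" "0 < r"
    "\<And>x. cmod (f x) \<le> r * indicator (cball 0 r) x" "norm (\<psi> - abs_L2 f) < e"
proof -
  define f where "f n x = (if cmod (rep_L2 \<psi> x) \<le> real (Suc n) \<and> norm x \<le> real (Suc n) then rep_L2 \<psi> x else 0)" for n x
  have m [measurable]: "f n \<in> borel_measurable borel" for n unfolding f_def by measurable
  have b: "cmod (f n x) \<le> real (Suc n) * indicator (cball 0 (real (Suc n))) x" for n x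
    by (auto simp: f_def indicator_def)
  have sq: "square_integrable (f n)" for n by (rule square_integrable_bounded_support[OF m b])
  have "(\<lambda>n. LBINT x. (cmod (rep_L2 \<psi> x - f n x))\<^sup>2) \<longlonglongrightarrow> (\<integral>x. 0 \<partial>(lborel :: 'a measure))"
  proof (rule integral_dominated_convergence)
    show "integrable lborel (\<lambda>x. (cmod (rep_L2 \<psi> x))\<^sup>2)" by simp
    show "AE x in lborel. (\<lambda>n. (cmod (rep_L2 \<psi> x - f n x))\<^sup>2) \<longlonglongrightarrow> 0"
    proof (rule AE_I2, rule tendsto_eventually)
      fix x
      obtain N where N: "max (cmod (rep_L2 \<psi> x)) (norm x) \<le> real N" using real_arch_simple by blast
      show "\<forall>\<^sub>F n in sequentially. (cmod (rep_L2 \<psi> x - f n x))\<^sup>2 = 0"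
        using eventually_ge_at_top[of N]
      proof eventually_elim
        case (elim n)
        then have "real N \<le> real (Suc n)" by simp
        then show ?case using N by (simp add: f_def)
      qed
    qed
    show "AE x in lborel. norm ((cmod (rep_L2 \<psi> x - f n x))\<^sup>2) \<le> (cmod (rep_L2 \<psi> x))\<^sup>2" for n
      by (rule AE_I2) (simp add: f_def)
  qed measurable
  then have "(\<lambda>n. sqrt ((norm (\<psi> - abs_L2 (f n)))\<^sup>2)) \<longlonglongrightarrow> sqrt 0"
    unfolding norm_L2_diff_abs[OF sq] by (intro tendsto_real_sqrt) simp
  then have "\<forall>\<^sub>F n in sequentially. norm (\<psi> - abs_L2 (f n)) < e"
    using order_tendstoD(2)[of _ 0] assms by simp
  then obtain n where "norm (\<psi> - abs_L2 (f n)) < e" using eventually_happens'[OF sequentially_bot] by blast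
  then show thesis using that[of "f n" "real (Suc n)"] m b by simp
qed

text \<open>A measurable function is almost everywhere a limit of continuous ones, but these need
  not be dominated. Clipping their values and cutting off their supports provides a common bound and
  does not move the limit f.\<close>

lemma L2_approx_continuous:
  fixes \<psi> :: "'a::euclidean_space L2"
  assumes "0 < e"
  obtains g B r where "continuous_on UNIV g" "0 \<le> B" "\<And>x. cmod (g x) \<le> B * indicator (cball 0 r) x"
    "norm (\<psi> - abs_L2 g) < e"
proof -
  obtain f r where f [measurable]: "f \<in> borel_measurable borel" and r: "0 < r"
    and fb: "\<And>x. cmod (f x) \<le> r * indicator (cball 0 r) x" and fe: "norm (\<psi> - abs_L2 f) < e / 2"
    using L2_approx_bounded_support[of "e / 2" \<psi>] assms by auto
  have "f measurable_on UNIV"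
    by (rule lebesgue_measurable_imp_measurable_on) (use f in \<open>auto intro: measurable_completion\<close>)
  then obtain N g where N: "negligible N" and g: "\<And>n. continuous_on UNIV (g n)"
    and lim: "\<And>x. x \<notin> N \<Longrightarrow> (\<lambda>n. g n x) \<longlonglongrightarrow> f x"
    unfolding measurable_on_def by auto
  \<comment> \<open>\<open>c\<close> is the radial retraction onto the disc of radius r and
    \<open>cut\<close> is 1 on the ball of radius r and 0 beyond r + 1; both leave the truncated f
    unchanged.\<close>
  define c where "c z = (r / max r (cmod z)) *\<^sub>R z" for z :: complex
  define cut where "cut x = max 0 (min 1 (r + 1 - norm x))" for x :: 'a
  define G where "G n x = cut x *\<^sub>R c (g n x)" for n x
  have cc: "continuous_on UNIV c" unfolding c_def using r by (intro continuous_intros) auto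
  have c: "cmod (c z) \<le> r" for z using r by (simp add: c_def field_simps max_def)
  have Gc: "continuous_on UNIV (G n)" for n
    unfolding G_def cut_def
    by (intro continuous_intros continuous_on_compose2[OF cc] g) auto
  then have [measurable]: "G n \<in> borel_measurable borel" for n by (rule borel_measurable_continuous_onI)
  have Gb: "cmod (G n x) \<le> r * indicator (cball 0 (r + 1)) x" for n x
  proof (cases "norm x \<le> r + 1")
    case True
    have "\<bar>cut x\<bar> * cmod (c (g n x)) \<le> 1 * r" by (intro mult_mono c) (auto simp: cut_def)
    then show ?thesis using True by (simp add: G_def)
  qed (simp add: G_def cut_def)
  have sq: "square_integrable (G n)" for n by (rule square_integrable_bounded_support[OF _ Gb]) measurable
  have sqf: "square_integrable f" by (rule square_integrable_bounded_support[OF f fb])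
  have fb2: "cmod (f x) \<le> r * indicator (cball 0 (r + 1)) x" for x
    using fb[of x] r by (cases "norm x \<le> r") auto
  have AEN: "AE x in lborel. x \<notin> N"
  proof -
    have "N \<in> null_sets lebesgue" using N by (simp add: negligible_iff_null_sets)
    then have "AE x in lebesgue. x \<notin> N" by (rule AE_not_in)
    then show ?thesis by (simp add: AE_completion_iff)
  qed
  have "(\<lambda>n. LBINT x. (cmod (f x - G n x))\<^sup>2) \<longlonglongrightarrow> (\<integral>x. 0 \<partial>(lborel :: 'a measure))"
  proof (rule integral_dominated_convergence)
    have "integrable lborel (indicator (cball 0 (r + 1)) :: 'a \<Rightarrow> real)"
      using emeasure_lborel_cball_finite[of "0::'a" "r + 1"] by (simp add: less_top)
    then show "integrable lborel (\<lambda>x::'a. (2 * r)\<^sup>2 * indicator (cball 0 (r + 1)) x)" by simp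
    show "AE x in lborel. (\<lambda>n. (cmod (f x - G n x))\<^sup>2) \<longlonglongrightarrow> 0"
      using AEN
    proof eventually_elim
      fix x assume "x \<notin> N"
      then have "(\<lambda>n. c (g n x)) \<longlonglongrightarrow> c (f x)"
        using continuous_on_tendsto_compose[OF cc lim] by simp
      then have "(\<lambda>n. (cmod (f x - G n x))\<^sup>2) \<longlonglongrightarrow> (cmod (f x - cut x *\<^sub>R c (f x)))\<^sup>2"
        unfolding G_def by (intro tendsto_intros)
      moreover have "cut x *\<^sub>R c (f x) = f x"
        using fb[of x] r by (cases "norm x \<le> r") (auto simp: c_def cut_def max_def)
      ultimately show "(\<lambda>n. (cmod (f x - G n x))\<^sup>2) \<longlonglongrightarrow> 0" by simp
    qed
    show "AE x in lborel. norm ((cmod (f x - G n x))\<^sup>2) \<le> (2 * r)\<^sup>2 * indicator (cball 0 (r + 1)) x" for n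
    proof (rule AE_I2)
      fix x
      have "cmod (f x - G n x) \<le> 2 * r * indicator (cball 0 (r + 1)) x"
        using norm_triangle_ineq4[of "f x" "G n x"] Gb[of n x] fb2[of x] by linarith
      then have "(cmod (f x - G n x))\<^sup>2 \<le> (2 * r * indicator (cball 0 (r + 1)) x)\<^sup>2"
        by (intro power_mono) auto
      then show "norm ((cmod (f x - G n x))\<^sup>2) \<le> (2 * r)\<^sup>2 * indicator (cball 0 (r + 1)) x"
        by (auto simp: indicator_def)
    qed
  qed measurable
  moreover have "(norm (abs_L2 f - abs_L2 (G n)))\<^sup>2 = (LBINT x. (cmod (f x - G n x))\<^sup>2)" for n
    unfolding norm_L2_diff_abs[OF sq]
    by (rule integral_cong_AE) (use rep_abs_L2[OF sqf] in auto)
  ultimately have "(\<lambda>n. sqrt ((norm (abs_L2 f - abs_L2 (G n)))\<^sup>2)) \<longlonglongrightarrow> sqrt 0"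
    by (intro tendsto_real_sqrt) simp
  then have "\<forall>\<^sub>F n in sequentially. norm (abs_L2 f - abs_L2 (G n)) < e / 2"
    using order_tendstoD(2)[of _ 0 sequentially "e / 2"] assms by simp
  then obtain n where n: "norm (abs_L2 f - abs_L2 (G n)) < e / 2"
    using eventually_happens'[OF sequentially_bot] by blast
  have "norm (\<psi> - abs_L2 (G n)) < e"
    using norm_triangle_ineq[of "\<psi> - abs_L2 f" "abs_L2 f - abs_L2 (G n)"] n fe by simp
  then show thesis using that[of "G n" r "r + 1"] Gc Gb r by simp
qed

text \<open>Dominated convergence settles continuous functions of bounded support. Translations are
  isometric, so an approximation of \<psi> costs e / 3 at each of the two shifts.\<close>

lemma translate_L2_continuous:
  fixes \<psi> :: "'a::euclidean_space L2"
  shows "((\<lambda>k. translate_L2 k \<psi>) \<longlongrightarrow> translate_L2 h \<psi>) (at h)"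
proof (rule tendstoI)
  fix e :: real assume "0 < e"
  then obtain g B r where g: "continuous_on UNIV g" and B: "0 \<le> B" and gb: "\<And>x. cmod (g x) \<le> B * indicator (cball 0 r) x"
    and ge: "norm (\<psi> - abs_L2 g) < e / 3"
    using L2_approx_continuous[of "e / 3" \<psi>] by (metis divide_pos_pos zero_less_numeral)
  have [measurable]: "g \<in> borel_measurable borel" using g by (rule borel_measurable_continuous_onI)
  have sq: "square_integrable g" by (rule square_integrable_bounded_support[OF _ gb]) measurable
  define \<phi> where "\<phi> = abs_L2 g"
  have "((\<lambda>k. norm (translate_L2 k \<phi> - translate_L2 h \<phi>)) \<longlongrightarrow> 0) (at h)"
    unfolding tendsto_at_iff_sequentially
  proof (intro allI impI)
    fix X assume X: "X \<longlonglongrightarrow> h"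
    \<comment> \<open>One radius C bounds the shifts and their limit, so all translates live in the
      ball of radius r + C, which yields the dominating function.\<close>
    then have "bounded (range X)" by (rule convergent_imp_bounded)
    then obtain C where C: "\<And>n. norm (X n) \<le> C" by (auto simp: bounded_iff)
    have Ch: "norm h \<le> C" by (rule tendsto_upperbound[OF tendsto_norm[OF X]]) (auto simp: C)
    have eq: "(norm (translate_L2 k \<phi> - translate_L2 h \<phi>))\<^sup>2 = (LBINT x. (cmod (g (x + k) - g (x + h)))\<^sup>2)" for k
      unfolding norm_translate_L2_diff \<phi>_def
      by (rule integral_cong_AE)
        (use AE_lborel_translate[OF rep_abs_L2[OF sq], of h] AE_lborel_translate[OF rep_abs_L2[OF sq], of k] in auto)
    have "(\<lambda>n. LBINT x. (cmod (g (x + X n) - g (x + h)))\<^sup>2) \<longlonglongrightarrow> (\<integral>x. 0 \<partial>(lborel :: 'a measure))"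
    proof (rule integral_dominated_convergence)
      have "integrable lborel (indicator (cball 0 (r + C)) :: 'a \<Rightarrow> real)"
        using emeasure_lborel_cball_finite[of "0::'a" "r + C"] by (simp add: less_top)
      then show "integrable lborel (\<lambda>x::'a. (2 * B)\<^sup>2 * indicator (cball 0 (r + C)) x)" by simp
      show "AE x in lborel. (\<lambda>n. (cmod (g (x + X n) - g (x + h)))\<^sup>2) \<longlonglongrightarrow> 0"
      proof (rule AE_I2)
        fix x
        have "(\<lambda>n. g (x + X n)) \<longlonglongrightarrow> g (x + h)"
          by (rule continuous_on_tendsto_compose[OF g]) (auto intro!: tendsto_intros X)
        then have "(\<lambda>n. (cmod (g (x + X n) - g (x + h)))\<^sup>2) \<longlonglongrightarrow> (cmod (g (x + h) - g (x + h)))\<^sup>2"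
          by (intro tendsto_intros)
        then show "(\<lambda>n. (cmod (g (x + X n) - g (x + h)))\<^sup>2) \<longlonglongrightarrow> 0" by simp
      qed
      have gb': "cmod (g (x + k)) \<le> B * indicator (cball 0 (r + C)) x" if "norm k \<le> C" for x k
        using gb[of "x + k"] B norm_triangle_ineq4[of "x + k" k] that
        by (cases "norm (x + k) \<le> r"; cases "norm x \<le> r + C") auto
      show "AE x in lborel. norm ((cmod (g (x + X n) - g (x + h)))\<^sup>2) \<le> (2 * B)\<^sup>2 * indicator (cball 0 (r + C)) x" for n
      proof (rule AE_I2)
        fix x
        have "cmod (g (x + X n) - g (x + h)) \<le> 2 * B * indicator (cball 0 (r + C)) x"
          using norm_triangle_ineq4[of "g (x + X n)" "g (x + h)"] gb'[OF C[of n], of x] gb'[OF Ch, of x] by linarith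
        then have "(cmod (g (x + X n) - g (x + h)))\<^sup>2 \<le> (2 * B * indicator (cball 0 (r + C)) x)\<^sup>2"
          by (intro power_mono) auto
        then show "norm ((cmod (g (x + X n) - g (x + h)))\<^sup>2) \<le> (2 * B)\<^sup>2 * indicator (cball 0 (r + C)) x"
          by (auto simp: indicator_def)
      qed
    qed measurable
    then have "(\<lambda>n. sqrt ((norm (translate_L2 (X n) \<phi> - translate_L2 h \<phi>))\<^sup>2)) \<longlonglongrightarrow> sqrt 0"
      unfolding eq by (intro tendsto_real_sqrt) simp
    then show "((\<lambda>k. norm (translate_L2 k \<phi> - translate_L2 h \<phi>)) \<circ> X) \<longlonglongrightarrow> 0"
      by (simp add: o_def)
  qed
  then have "\<forall>\<^sub>F k in at h. norm (translate_L2 k \<phi> - translate_L2 h \<phi>) < e / 3"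
    using order_tendstoD(2)[of _ 0 "at h" "e / 3"] \<open>0 < e\<close> by simp
  then show "\<forall>\<^sub>F k in at h. dist (translate_L2 k \<psi>) (translate_L2 h \<psi>) < e"
  proof eventually_elim
    case (elim k)
    have 1: "norm (translate_L2 k \<psi> - translate_L2 k \<phi>) < e / 3" "norm (translate_L2 h \<phi> - translate_L2 h \<psi>) < e / 3"
      using ge by (simp_all add: norm_translate_L2_same \<phi>_def norm_minus_commute)
    have "norm (translate_L2 k \<psi> - translate_L2 h \<psi>) =
        norm ((translate_L2 k \<psi> - translate_L2 k \<phi>) + (translate_L2 k \<phi> - translate_L2 h \<phi>)
          + (translate_L2 h \<phi> - translate_L2 h \<psi>))" by simp
    also have "\<dots> \<le> norm (translate_L2 k \<psi> - translate_L2 k \<phi>) + norm (translate_L2 k \<phi> - translate_L2 h \<phi>)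
        + norm (translate_L2 h \<phi> - translate_L2 h \<psi>)"
      by (intro order_trans[OF norm_triangle_ineq] add_right_mono norm_triangle_ineq)
    finally show ?case using 1 elim unfolding dist_norm by linarith
  qed
qed

text \<open>The inner product inequality is applied to the moduli of u and v, which have the same
  norms; the absolute values thus stay inside the integral.\<close>

lemma integral_mult_le_norm_L2:
  assumes u: "square_integrable u" and v: "square_integrable v"
  shows "(LBINT x. cmod (u x) * cmod (v x)) \<le> norm (abs_L2 u) * norm (abs_L2 v)"
proof -
  have [measurable]: "u \<in> borel_measurable borel" "v \<in> borel_measurable borel"
    using u v by (auto simp: square_integrable_def)
  define u' where "u' x = complex_of_real (cmod (u x))" for x
  define v' where "v' x = complex_of_real (cmod (v x))" for x
  have [measurable]: "u' \<in> borel_measurable borel" "v' \<in> borel_measurable borel"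
    unfolding u'_def[abs_def] v'_def[abs_def] by measurable
  have u': "square_integrable u'" and v': "square_integrable v'"
    using u v by (auto simp: square_integrable_def u'_def v'_def)
  have "cinner (abs_L2 u') (abs_L2 v') = (LBINT x. of_real (cmod (u x) * cmod (v x)))"
    unfolding cinner_L2
    by (rule integral_cong_AE) (use rep_abs_L2[OF u'] rep_abs_L2[OF v'] in \<open>auto simp: u'_def v'_def\<close>)
  then have "cinner (abs_L2 u') (abs_L2 v') = of_real (LBINT x. cmod (u x) * cmod (v x))"
    by (simp only: integral_complex_of_real)
  then have "(LBINT x. cmod (u x) * cmod (v x)) = cmod (cinner (abs_L2 u') (abs_L2 v'))"
    by (simp add: integral_nonneg_AE)
  also have "\<dots> \<le> norm (abs_L2 u') * norm (abs_L2 v')" by (rule cinner_Cauchy_Schwarz)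
  also have "norm (abs_L2 u') = norm (abs_L2 u)"
    by (rule power2_eq_imp_eq) (use norm_abs_L2[OF u] norm_abs_L2[OF u'] in \<open>simp_all add: u'_def\<close>)
  also have "norm (abs_L2 v') = norm (abs_L2 v)"
    by (rule power2_eq_imp_eq) (use norm_abs_L2[OF v] norm_abs_L2[OF v'] in \<open>simp_all add: v'_def\<close>)
  finally show ?thesis .
qed

section \<open>A kernel built from the rank-one series\<close>

lemma mult_le_half_squares: "a * b \<le> (a\<^sup>2 + b\<^sup>2) / (2::real)"
  using sum_squares_bound[of a b] by simp

lemma kernel_measurable:
  assumes "(\<lambda>(x, y). r x y) \<in> borel_measurable borel"
    and [measurable]: "f \<in> borel_measurable M" "g \<in> borel_measurable M"
  shows "(\<lambda>z. r (f z :: 'a::euclidean_space) (g z :: 'a) :: complex) \<in> borel_measurable M"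
  using measurable_compose[OF borel_measurable_Pair[OF assms(2,3)] assms(1)] by simp

text \<open>The representatives \<open>g n\<close> are changed on a null set so that all series below converge
  at every point.\<close>

locale L2_series =
  fixes f :: "nat \<Rightarrow> 'a::euclidean_space L2" and g :: "nat \<Rightarrow> 'a \<Rightarrow> complex"
  assumes sf: "summable (\<lambda>n. (norm (f n))\<^sup>2)"
    and g_meas [measurable]: "\<And>n. g n \<in> borel_measurable borel"
    and fg: "\<And>n. AE x in lborel. rep_L2 (f n) x = g n x"
    and sg: "\<And>x. summable (\<lambda>n. (cmod (g n x))\<^sup>2)"

begin

text \<open>By \<open>sg\<close> the series converges absolutely at every point, so its diagonal has
  definite values and not merely values up to a null set.\<close>

definition "ker x y = (\<Sum>n. g n x * cnj (g n y))"

lemma ker_diagonal: "ker z z = (\<Sum>n. of_real ((cmod (g n z))\<^sup>2))"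
  unfolding ker_def complex_norm_square ..

lemma g_square: "integrable lborel (\<lambda>x. (cmod (g n x))\<^sup>2)"
  "(LBINT x. (cmod (g n x))\<^sup>2) = (norm (f n))\<^sup>2"
proof -
  have "integrable lborel (\<lambda>x. (cmod (g n x))\<^sup>2) \<longleftrightarrow> integrable lborel (\<lambda>x. (cmod (rep_L2 (f n) x))\<^sup>2)"
    by (rule integrable_cong_AE) (use fg[of n] in auto)
  then show "integrable lborel (\<lambda>x. (cmod (g n x))\<^sup>2)" by simp
  show "(LBINT x. (cmod (g n x))\<^sup>2) = (norm (f n))\<^sup>2"
    unfolding norm_L2_square by (rule integral_cong_AE) (use fg[of n] in auto)
qed

lemma g_sq: "square_integrable (g n)"
  using g_square by (simp add: square_integrable_def)

lemma f_abs: "f n = abs_L2 (g n)"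
  by (rule L2_eqI) (use fg[of n] rep_abs_L2[OF g_sq, of n] in auto)

lemma summable_prod: "summable (\<lambda>n. cmod (g n x) * cmod (g n y))"
proof (rule summable_comparison_test')
  show "summable (\<lambda>n. ((cmod (g n x))\<^sup>2 + (cmod (g n y))\<^sup>2) / 2)"
    by (intro summable_divide summable_add sg)
  show "norm (cmod (g n x) * cmod (g n y)) \<le> ((cmod (g n x))\<^sup>2 + (cmod (g n y))\<^sup>2) / 2" for n
    using mult_le_half_squares by simp
qed

lemma ker_measurable: "(\<lambda>(x, y). ker x y) \<in> borel_measurable borel"
proof -
  have [measurable]: "(fst :: 'a \<times> 'a \<Rightarrow> 'a) \<in> borel \<rightarrow>\<^sub>M borel" "(snd :: 'a \<times> 'a \<Rightarrow> 'a) \<in> borel \<rightarrow>\<^sub>M borel"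
    by (auto intro!: borel_measurable_continuous_onI continuous_intros)
  have "(\<lambda>p. \<Sum>n. g n (fst p) * cnj (g n (snd p))) \<in> borel_measurable (borel :: ('a \<times> 'a) measure)"
    by measurable
  then show ?thesis by (simp add: ker_def split_beta')
qed

text \<open>Termwise integration. The arithmetic-geometric mean inequality splits each term into
  |g_n(y)|^2 and |g_n(x)|^2 |\<psi>(y)|^2, whose integrals are summable by \<open>sf\<close> and by
  \<open>sg\<close> at x.\<close>

lemma ker_apply:
  "integrable lborel (\<lambda>y. ker x y * rep_L2 \<psi> y)"
  "(\<lambda>n. g n x * cinner (f n) \<psi>) sums (LBINT y. ker x y * rep_L2 \<psi> y)"
proof -
  define h where "h n y = g n x * (cnj (g n y) * rep_L2 \<psi> y)" for n y
  have eq: "ker x y * rep_L2 \<psi> y = (\<Sum>n. h n y)" for y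
  proof -
    have "summable (\<lambda>n. g n x * cnj (g n y))"
      by (rule summable_norm_cancel) (use summable_prod[of x y] in \<open>simp add: norm_mult\<close>)
    then show ?thesis unfolding ker_def h_def by (subst suminf_mult2) (auto simp: mult.assoc)
  qed
  have hi: "integrable lborel (h n)" for n
    unfolding h_def by (intro integrable_mult_right square_integrable_prod g_sq square_integrable_rep)
  have 1: "AE y in lborel. summable (\<lambda>n. norm (h n y))"
  proof (rule AE_I2)
    fix y
    have "summable (\<lambda>n. cmod (g n x) * cmod (g n y) * cmod (rep_L2 \<psi> y))"
      by (rule summable_mult2[OF summable_prod])
    then show "summable (\<lambda>n. norm (h n y))" by (simp add: h_def norm_mult mult.assoc)
  qed
  have 2: "summable (\<lambda>n. LBINT y. norm (h n y))"
  proof (rule summable_comparison_test')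
    show "summable (\<lambda>n. ((norm (f n))\<^sup>2 + (cmod (g n x))\<^sup>2 * (norm \<psi>)\<^sup>2) / 2)"
      by (intro summable_divide summable_add summable_mult2 sf sg)
    fix n
    have "(LBINT y. norm (h n y)) \<le> (LBINT y. ((cmod (g n y))\<^sup>2 + (cmod (g n x))\<^sup>2 * (cmod (rep_L2 \<psi> y))\<^sup>2) / 2)"
    proof (rule integral_mono)
      show "norm (h n y) \<le> ((cmod (g n y))\<^sup>2 + (cmod (g n x))\<^sup>2 * (cmod (rep_L2 \<psi> y))\<^sup>2) / 2" for y
        using mult_le_half_squares[of "cmod (g n y)" "cmod (g n x) * cmod (rep_L2 \<psi> y)"]
        by (simp add: h_def norm_mult power_mult_distrib ac_simps)
    qed (use hi g_square in auto)
    also have "\<dots> = ((norm (f n))\<^sup>2 + (cmod (g n x))\<^sup>2 * (norm \<psi>)\<^sup>2) / 2"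
      using g_square by (simp add: norm_L2_square[of \<psi>])
    finally show "norm (LBINT y. norm (h n y)) \<le> ((norm (f n))\<^sup>2 + (cmod (g n x))\<^sup>2 * (norm \<psi>)\<^sup>2) / 2"
      by (simp add: integral_nonneg_AE)
  qed
  show "integrable lborel (\<lambda>y. ker x y * rep_L2 \<psi> y)"
    unfolding eq by (rule integrable_suminf[OF hi 1 2])
  have "integral\<^sup>L lborel (h n) = g n x * cinner (f n) \<psi>" for n
  proof -
    have "integral\<^sup>L lborel (h n) = g n x * (LBINT y. cnj (g n y) * rep_L2 \<psi> y)"
      unfolding h_def by (rule Bochner_Integration.integral_mult_right_zero)
    also have "(LBINT y. cnj (g n y) * rep_L2 \<psi> y) = cinner (f n) \<psi>"
      unfolding cinner_L2 by (rule integral_cong_AE) (use fg[of n] in auto)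
    finally show ?thesis .
  qed
  then show "(\<lambda>n. g n x * cinner (f n) \<psi>) sums (LBINT y. ker x y * rep_L2 \<psi> y)"
    unfolding eq using sums_integral[OF hi 1 2] by simp
qed

text \<open>The partial sums converge to \<open>R \<psi>\<close> in norm and pointwise to the kernel
  integral; \<open>L2_limit_AE\<close> identifies the limits.\<close>

lemma ker_represents:
  assumes R: "\<And>v. (\<lambda>n. cinner (f n) v *\<^sub>C f n) sums R v"
  shows "AE x in lborel. rep_L2 (R \<psi>) x = (LBINT y. ker x y * rep_L2 \<psi> y)"
proof (rule L2_limit_AE)
  let ?X = "\<lambda>N. \<Sum>n<N. cinner (f n) \<psi> *\<^sub>C f n"
  show "?X \<longlonglongrightarrow> R \<psi>" using R[of \<psi>] by (simp add: sums_def)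
  have lim: "(\<lambda>N. \<Sum>n<N. g n x * cinner (f n) \<psi>) \<longlonglongrightarrow> (LBINT y. ker x y * rep_L2 \<psi> y)" for x
    using ker_apply(2)[of x \<psi>] by (simp add: sums_def)
  show "(\<lambda>x. LBINT y. ker x y * rep_L2 \<psi> y) \<in> borel_measurable borel"
    by (rule borel_measurable_LIMSEQ_metric[OF _ lim]) measurable
  have "AE x in lborel. rep_L2 (?X N) x = (\<Sum>n<N. g n x * cinner (f n) \<psi>)" for N
  proof (induction N)
    case 0
    then show ?case using rep_L2_zero by simp
  next
    case (Suc N)
    then show ?case
      using rep_L2_add[of "?X N" "cinner (f N) \<psi> *\<^sub>C f N"] rep_L2_scaleC[of "cinner (f N) \<psi>" "f N"] fg[of N]
      by eventually_elim (simp add: mult.commute)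
  qed
  then have "AE x in lborel. \<forall>N. rep_L2 (?X N) x = (\<Sum>n<N. g n x * cinner (f n) \<psi>)"
    by (simp add: AE_all_countable)
  then show "AE x in lborel. (\<lambda>N. rep_L2 (?X N) x) \<longlonglongrightarrow> (LBINT y. ker x y * rep_L2 \<psi> y)"
    by eventually_elim (use lim in simp)
qed

lemma g_translate_square: "integrable lborel (\<lambda>x. (cmod (g n (x + h)))\<^sup>2)"
  "(LBINT x. (cmod (g n (x + h)))\<^sup>2) = (norm (f n))\<^sup>2"
  using g_square integral_lborel_translate[of "\<lambda>x. (cmod (g n x))\<^sup>2" h] by simp_all

lemma g_translate_sq: "square_integrable (\<lambda>x. g n (x + h))"
  using g_translate_square by (simp add: square_integrable_def)

lemma translate_f_abs: "translate_L2 h (f n) = abs_L2 (\<lambda>x. g n (x + h))"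
  by (rule L2_eqI)
    (use rep_translate_L2[of h "f n"] AE_lborel_translate[OF fg[of n], of h] rep_abs_L2[OF g_translate_sq, of n h] in auto)

lemma norm_translate_f: "norm (translate_L2 h (f n)) = norm (f n)"
proof -
  have "(norm (translate_L2 h (f n)))\<^sup>2 = (norm (f n))\<^sup>2"
    unfolding translate_f_abs norm_abs_L2[OF g_translate_sq] by (rule g_translate_square)
  then show ?thesis by simp
qed

lemma ker_translate_integrable: "integrable lborel (\<lambda>x. ker x (x + h))"
  unfolding ker_def
proof (rule integrable_suminf)
  show i: "integrable lborel (\<lambda>x. g n x * cnj (g n (x + h)))" for n
    using square_integrable_prod[OF g_translate_sq g_sq, of n h n] by (simp add: mult.commute)
  show "AE x in lborel. summable (\<lambda>n. norm (g n x * cnj (g n (x + h))))"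
    using summable_prod by (intro AE_I2) (simp add: norm_mult)
  show "summable (\<lambda>n. LBINT x. norm (g n x * cnj (g n (x + h))))"
  proof (rule summable_comparison_test'[OF sf])
    fix n
    have "(LBINT x. norm (g n x * cnj (g n (x + h)))) \<le>
        (LBINT x. ((cmod (g n x))\<^sup>2 + (cmod (g n (x + h)))\<^sup>2) / 2)"
    proof (rule integral_mono[OF integrable_norm[OF i]])
      show "integrable lborel (\<lambda>x. ((cmod (g n x))\<^sup>2 + (cmod (g n (x + h)))\<^sup>2) / 2)"
        using g_square[of n] g_translate_square[of n h] by simp
    qed (simp only: norm_mult complex_mod_cnj mult_le_half_squares)
    also have "\<dots> = (norm (f n))\<^sup>2" using g_square[of n] g_translate_square[of n h] by simp
    finally show "norm (LBINT x. norm (g n x * cnj (g n (x + h)))) \<le> (norm (f n))\<^sup>2"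
      by (simp add: integral_nonneg_AE)
  qed
qed

abbreviation "osc k h n \<equiv> norm (translate_L2 k (f n) - translate_L2 h (f n))"

text \<open>Cauchy-Schwarz in x for each n separates \<open>g n\<close> from the difference of its
  two translates.\<close>

lemma ker_translate_diff:
  "(LBINT x. cmod (ker x (x + k) - ker x (x + h))) \<le>
    (\<Sum>n. norm (f n) * osc k h n)"
proof -
  define w where "w n x = cmod (g n x) * cmod (g n (x + k) - g n (x + h))" for n x
  have sqd: "square_integrable (\<lambda>x. g n (x + k) - g n (x + h))" for n
    using square_integrable_add[OF g_translate_sq square_integrable_scale[OF g_translate_sq, of "-1"], of n k n h]
    by simp
  have wi: "integrable lborel (w n)" for n
    using integrable_norm[OF square_integrable_prod[OF g_sq sqd, of n n]] by (simp add: w_def[abs_def] norm_mult)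
  have wint: "integral\<^sup>L lborel (w n) \<le> norm (f n) * osc k h n" for n
  proof -
    have "(osc k h n)\<^sup>2 = (norm (abs_L2 (\<lambda>x. g n (x + k) - g n (x + h))))\<^sup>2"
      unfolding norm_translate_L2_diff norm_abs_L2[OF sqd]
      by (rule integral_cong_AE)
        (use AE_lborel_translate[OF fg[of n], of h] AE_lborel_translate[OF fg[of n], of k] in auto)
    then have "osc k h n = norm (abs_L2 (\<lambda>x. g n (x + k) - g n (x + h)))"
      by simp
    then show ?thesis
      using integral_mult_le_norm_L2[OF g_sq sqd, of n n] by (simp add: w_def[abs_def] f_abs)
  qed
  have sw: "summable (\<lambda>n. w n x)" for x
  proof (rule summable_comparison_test'[OF summable_add[OF summable_prod[of x "x + k"] summable_prod[of x "x + h"]]])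
    show "norm (w n x) \<le> cmod (g n x) * cmod (g n (x + k)) + cmod (g n x) * cmod (g n (x + h))" for n
      using mult_left_mono[OF norm_triangle_ineq4[of "g n (x + k)" "g n (x + h)"], of "cmod (g n x)"]
      by (simp add: w_def distrib_left)
  qed
  have sn: "summable (\<lambda>n. norm (f n) * osc k h n)"
  proof (rule summable_comparison_test'[OF summable_mult[OF sf, of 2]])
    show "norm (norm (f n) * osc k h n) \<le> 2 * (norm (f n))\<^sup>2" for n
      using mult_left_mono[OF norm_triangle_ineq4[of "translate_L2 k (f n)" "translate_L2 h (f n)"], of "norm (f n)"]
      by (simp add: norm_translate_f power2_eq_square)
  qed
  have w0: "0 \<le> w n x" for n x by (simp add: w_def)
  have wint0: "0 \<le> integral\<^sup>L lborel (w n)" for n by (rule integral_nonneg_AE) (simp add: w0)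
  have 1: "AE x in lborel. summable (\<lambda>n. norm (w n x))" using sw w0 by simp
  have 2: "summable (\<lambda>n. LBINT x. norm (w n x))"
    by (rule summable_comparison_test'[OF sn]) (use wint wint0 w0 in simp)
  have le: "cmod (ker x (x + k) - ker x (x + h)) \<le> (\<Sum>n. w n x)" for x
  proof -
    have s: "summable (\<lambda>n. g n x * cnj (g n (x + h)))" for h
      by (rule summable_norm_cancel) (use summable_prod[of x "x + h"] in \<open>simp add: norm_mult\<close>)
    have "ker x (x + k) - ker x (x + h) = (\<Sum>n. g n x * cnj (g n (x + k)) - g n x * cnj (g n (x + h)))"
      unfolding ker_def by (rule suminf_diff[OF s s])
    moreover have n: "norm (g n x * cnj (g n (x + k)) - g n x * cnj (g n (x + h))) = w n x" for n
    proof -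
      have "g n x * cnj (g n (x + k)) - g n x * cnj (g n (x + h)) = g n x * cnj (g n (x + k) - g n (x + h))"
        by (simp add: right_diff_distrib)
      then show ?thesis by (simp only: norm_mult complex_mod_cnj w_def)
    qed
    moreover have "norm (\<Sum>n. g n x * cnj (g n (x + k)) - g n x * cnj (g n (x + h))) \<le>
        (\<Sum>n. norm (g n x * cnj (g n (x + k)) - g n x * cnj (g n (x + h))))"
      by (rule summable_norm) (simp add: n sw)
    ultimately show ?thesis by (simp only: n)
  qed
  have "(LBINT x. cmod (ker x (x + k) - ker x (x + h))) \<le> (LBINT x. (\<Sum>n. w n x))"
    by (intro integral_mono integrable_norm Bochner_Integration.integrable_diff ker_translate_integrable
        integrable_suminf[OF wi 1 2] le)
  also have "\<dots> = (\<Sum>n. integral\<^sup>L lborel (w n))" by (rule integral_suminf[OF wi 1 2])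
  also have "\<dots> \<le> (\<Sum>n. norm (f n) * osc k h n)"
    by (rule suminf_le[OF wint summable_integral[OF wi 1 2] sn])
  finally show ?thesis .
qed

text \<open>Tannery's theorem: each \<open>osc k h n\<close> tends to 0, and isometry of
  translations dominates the terms by 2 (norm (f n))^2.\<close>

lemma ker_translate_continuous: "((\<lambda>k. LBINT x. cmod (ker x (x + k) - ker x (x + h))) \<longlongrightarrow> 0) (at h)"
proof (rule Lim_null_comparison)
  show "\<forall>\<^sub>F k in at h. norm (LBINT x. cmod (ker x (x + k) - ker x (x + h))) \<le>
      (\<Sum>n. norm (f n) * osc k h n)"
    using ker_translate_diff by (intro always_eventually) (simp add: integral_nonneg_AE)
  have "((\<lambda>k. \<Sum>n. norm (f n) * osc k h n) \<longlongrightarrow> (\<Sum>n::nat. 0)) (at h)"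
  proof (rule tannerys_theorem[THEN conjunct2, THEN conjunct2])
    fix n
    have "((\<lambda>k. norm (f n) * osc k h n) \<longlongrightarrow>
        norm (f n) * norm (translate_L2 h (f n) - translate_L2 h (f n))) (at h)"
      by (intro tendsto_intros translate_L2_continuous)
    then show "((\<lambda>k. norm (f n) * osc k h n) \<longlongrightarrow> 0) (at h)" by simp
  next
    show "summable (\<lambda>n. 2 * (norm (f n))\<^sup>2)" by (rule summable_mult[OF sf])
    show "\<forall>\<^sub>F (n, k) in sequentially \<times>\<^sub>F at h.
        norm (norm (f n) * osc k h n) \<le> 2 * (norm (f n))\<^sup>2"
    proof (rule always_eventually, clarify)
      fix n k
      show "norm (norm (f n) * osc k h n) \<le> 2 * (norm (f n))\<^sup>2"
        using mult_left_mono[OF norm_triangle_ineq4[of "translate_L2 k (f n)" "translate_L2 h (f n)"], of "norm (f n)"]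
        by (simp add: norm_translate_f power2_eq_square)
    qed
  qed simp
  then show "((\<lambda>k. \<Sum>n. norm (f n) * osc k h n) \<longlongrightarrow> 0) (at h)" by simp
qed

lemma ker_is_integral_kernel:
  assumes "\<And>v. (\<lambda>n. cinner (f n) v *\<^sub>C f n) sums cblinfun_apply R v"
  shows "is_integral_kernel R ker"
  unfolding is_integral_kernel_def
  using ker_measurable ker_apply(1) ker_represents[OF assms] ker_translate_integrable ker_translate_continuous
  by auto

text \<open>On the diagonal the n-th term is |g_n(z)|^2, so integration against b produces the
  matrix element of the multiplication operator at \<open>f n\<close>. With b a plane wave this
  computes the Fourier transform of the density.\<close>

lemma ker_diagonal_integral:
  assumes [measurable]: "b \<in> borel_measurable borel" and b: "\<And>x. cmod (b x) \<le> K"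
  shows "(\<lambda>n. cinner (f n) (mult_op b (f n))) sums (LBINT z. b z * ker z z)"
proof -
  define w where "w n z = b z * of_real ((cmod (g n z))\<^sup>2)" for n z
  have K: "0 \<le> K" using b order_trans[OF norm_ge_zero] by blast
  have nw: "norm (w n z) \<le> K * (cmod (g n z))\<^sup>2" for n z
    using b[of z] by (auto simp: w_def norm_mult norm_power intro: mult_right_mono)
  have [measurable]: "w n \<in> borel_measurable borel" for n unfolding w_def by measurable
  have wi: "integrable lborel (w n)" for n
  proof (rule Bochner_Integration.integrable_bound)
    show "integrable lborel (\<lambda>z. K * (cmod (g n z))\<^sup>2)" using g_square[of n] by simp
    show "AE z in lborel. norm (w n z) \<le> norm (K * (cmod (g n z))\<^sup>2)"
      using nw K by (intro AE_I2) (simp add: abs_mult)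
  qed measurable
  have 1: "AE z in lborel. summable (\<lambda>n. norm (w n z))"
  proof (rule AE_I2)
    show "summable (\<lambda>n. norm (w n z))" for z
      by (rule summable_comparison_test'[OF summable_mult[OF sg[of z], of K]]) (use nw in simp)
  qed
  have 2: "summable (\<lambda>n. LBINT z. norm (w n z))"
  proof (rule summable_comparison_test'[OF summable_mult[OF sf, of K]])
    fix n
    have "(LBINT z. norm (w n z)) \<le> (LBINT z. K * (cmod (g n z))\<^sup>2)"
      using g_square[of n] by (intro integral_mono integrable_norm wi nw) simp
    then show "norm (LBINT z. norm (w n z)) \<le> K * (norm (f n))\<^sup>2"
      using g_square[of n] by (simp add: integral_nonneg_AE)
  qed
  have "(\<Sum>n. w n z) = b z * ker z z" for z
  proof -
    have "summable (\<lambda>n. complex_of_real ((cmod (g n z))\<^sup>2))" using sg[of z] by (rule summable_of_real)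
    then show ?thesis unfolding w_def ker_diagonal by (rule suminf_mult)
  qed
  moreover have "integral\<^sup>L lborel (w n) = cinner (f n) (mult_op b (f n))" for n
    unfolding cinner_mult_op[OF assms] w_def complex_norm_square
    by (rule integral_cong_AE) (use fg[of n] in \<open>auto simp: ac_simps\<close>)
  ultimately show ?thesis using sums_integral[OF wi 1 2] by simp
qed

end

text \<open>By Tonelli the integral of \<open>s\<close> is the sum of the squared norms, hence
  \<open>s\<close> is finite almost everywhere; elsewhere \<open>g\<close> is set to 0.\<close>

lemma L2_series_exists:
  fixes f :: "nat \<Rightarrow> 'a::euclidean_space L2"
  assumes sf: "summable (\<lambda>n. (norm (f n))\<^sup>2)"
  obtains g where "L2_series f g"
proof -
  define s where "s x = (\<Sum>n. ennreal ((cmod (rep_L2 (f n) x))\<^sup>2))" for x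
  have [measurable]: "s \<in> borel_measurable borel" unfolding s_def by measurable
  have "(\<integral>\<^sup>+x. s x \<partial>lborel) = (\<Sum>n. ennreal ((norm (f n))\<^sup>2))"
    unfolding s_def by (subst nn_integral_suminf) (auto simp: nn_norm_L2_square)
  also have "\<dots> \<noteq> \<infinity>" using sf by (subst suminf_ennreal2) auto
  finally have AE: "AE x in lborel. s x \<noteq> \<infinity>" by (intro nn_integral_PInf_AE) auto
  define g where "g n x = (if s x = \<infinity> then 0 else rep_L2 (f n) x)" for n x
  have "L2_series f g"
  proof
    show "AE x in lborel. rep_L2 (f n) x = g n x" for n
      using AE by eventually_elim (simp add: g_def)
    show "summable (\<lambda>n. (cmod (g n x))\<^sup>2)" for x
    proof (cases "s x = \<infinity>")
      case False
      then show ?thesis unfolding g_def s_def by (simp add: summable_suminf_not_top)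
    qed (simp add: g_def)
    show "g n \<in> borel_measurable borel" for n unfolding g_def by measurable
  qed (rule sf)
  then show thesis by (rule that)
qed

section \<open>Uniqueness of the kernel and of its diagonal\<close>

text \<open>Finite intersections from a countable basis form a countable generating system stable
  under intersection, to which Dynkin's argument applies. The empty family contributes
  \<open>UNIV\<close>, needed for complements. Countability lets exceptional null sets, one for each
  member, be merged.\<close>

lemma countable_determining_sets:
  obtains G :: "'a::euclidean_space set set" where "countable G" "UNIV \<in> G" "G \<subseteq> sets borel"
    "\<And>u :: 'a \<Rightarrow> complex. integrable lborel u \<Longrightarrow>
      (\<And>A. A \<in> G \<Longrightarrow> (LINT x:A|lborel. u x) = 0) \<Longrightarrow> AE x in lborel. u x = 0"
proof -
  obtain B :: "'a set set" where B: "countable B" "topological_basis B" using ex_countable_basis by blast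
  define G where "G = Inter ` {F. finite F \<and> F \<subseteq> B}"
  have "countable G" unfolding G_def using B(1) by (intro countable_image countable_Collect_finite_subset)
  moreover have U: "UNIV \<in> G" unfolding G_def by (intro image_eqI[of _ _ "{}"]) auto
  moreover have Gb: "G \<subseteq> sets borel"
  proof -
    have "open (\<Inter>F)" if "finite F" "F \<subseteq> B" for F
      using that topological_basis_open[OF B(2)] by (intro open_Inter) auto
    then show ?thesis unfolding G_def by auto
  qed
  moreover have "AE x in lborel. u x = 0"
    if u: "integrable lborel u" and z: "\<And>A. A \<in> G \<Longrightarrow> (LINT x:A|lborel. u x) = 0" for u :: "'a \<Rightarrow> complex"
  proof (rule sigma_finite_measure.density_zero[OF sigma_finite_lborel u])
    fix A assume "A \<in> sets (lborel :: 'a measure)"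
    moreover have "sets (borel :: 'a measure) = sigma_sets UNIV B"
      by (subst borel_eq_countable_basis[OF B]) (simp add: sets_measure_of)
    ultimately have "A \<in> sigma_sets UNIV B" by simp
    moreover have "B \<subseteq> G"
    proof
      fix b assume "b \<in> B"
      then show "b \<in> G" unfolding G_def by (intro image_eqI[of _ _ "{b}"]) auto
    qed
    ultimately have A: "A \<in> sigma_sets UNIV G" using sigma_sets_mono' by blast
    have sub: "sigma_sets UNIV G \<subseteq> sets borel"
      using Gb by (metis sets.sigma_sets_subset space_borel)
    have "Int_stable G"
    proof (rule Int_stableI)
      fix a b assume "a \<in> G" "b \<in> G"
      then obtain F F' where "finite F" "F \<subseteq> B" "a = \<Inter>F" "finite F'" "F' \<subseteq> B" "b = \<Inter>F'"
        by (auto simp: G_def)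
      then show "a \<inter> b \<in> G" unfolding G_def by (intro image_eqI[of _ _ "F \<union> F'"]) auto
    qed
    moreover have "G \<subseteq> Pow UNIV" by simp
    ultimately show "(LINT x:A|lborel. u x) = 0" using A
    proof (induction rule: sigma_sets_induct_disjoint)
      case (basic A)
      then show ?case by (rule z)
    next
      case empty
      then show ?case by (simp add: set_lebesgue_integral_def)
    next
      case (compl A)
      have [measurable]: "A \<in> sets borel" using compl(1) sub by blast
      have "(LINT x:UNIV|lborel. u x) = (LINT x:A \<union> (UNIV - A)|lborel. u x)" by (simp add: Un_Diff_cancel)
      also have "\<dots> = (LINT x:A|lborel. u x) + (LINT x:UNIV - A|lborel. u x)"
        using u by (intro set_integral_Un) (auto simp: set_integrable_def intro!: integrable_mult_indicator)
      finally show ?case using z[OF U] compl by simp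
    next
      case (union A)
      have A: "A i \<in> sets borel" for i using union(2) sub by blast
      have "(LINT x:(\<Union>i. A i)|lborel. u x) = (\<Sum>i. (LINT x:A i|lborel. u x))"
      proof (rule lebesgue_integral_countable_add)
        show "A i \<inter> A j = {}" if "i \<noteq> j" for i j using union(1) that by (auto simp: disjoint_family_on_def)
        show "set_integrable lborel (\<Union>i. A i) u"
          using u A by (auto simp: set_integrable_def intro!: integrable_mult_indicator)
      qed (use A in simp)
      then show ?case using union by simp
    qed
  qed
  ultimately show thesis using that by blast
qed

text \<open>The kernel identity has an exceptional set of x for each test vector, so only countably
  many indicators are used. They are cut off by balls to be square integrable; for good x the
  difference of the kernels then has zero integral over all these sets.\<close>

lemma integral_kernel_unique:
  fixes R :: "'a::euclidean_space L2 op"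
  assumes r: "is_integral_kernel R r" and r': "is_integral_kernel R r'"
  shows "AE x in lborel. AE y in lborel. r x y = r' x y"
proof -
  have rm: "(\<lambda>(x, y). r x y) \<in> borel_measurable borel"
    and r'm: "(\<lambda>(x, y). r' x y) \<in> borel_measurable borel"
    using r r' unfolding is_integral_kernel_def by blast+
  obtain G :: "'a set set" where G: "countable G" "UNIV \<in> G" "G \<subseteq> sets borel"
    and G0: "\<And>u :: 'a \<Rightarrow> complex. integrable lborel u \<Longrightarrow>
      (\<And>A. A \<in> G \<Longrightarrow> (LINT x:A|lborel. u x) = 0) \<Longrightarrow> AE x in lborel. u x = 0"
    using countable_determining_sets by blast
  define S where "S n A = A \<inter> cball (0::'a) (real n)" for n A
  have [measurable]: "S n A \<in> sets borel" if "A \<in> G" for n A using G(3) that by (auto simp: S_def)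
  define \<psi> where "\<psi> n A = abs_L2 (indicator (S n A))" for n A
  have \<psi>: "AE y in lborel. rep_L2 (\<psi> n A) y = indicator (S n A) y" if [measurable]: "A \<in> G" for n A
    unfolding \<psi>_def
  proof (rule rep_abs_L2, rule square_integrable_bounded_support[where B = 1 and r = "real n"])
    show "indicator (S n A) \<in> borel_measurable borel" by measurable
  qed (auto simp: S_def indicator_def)
  define good where "good r x \<psi> \<longleftrightarrow> integrable lborel (\<lambda>y. r x y * rep_L2 \<psi> y) \<and>
      rep_L2 (R \<psi>) x = (LBINT y. r x y * rep_L2 \<psi> y)" for r x \<psi>
  have gr: "AE x in lborel. good r x \<phi>" "AE x in lborel. good r' x \<phi>" for \<phi>
    using r r' unfolding is_integral_kernel_def good_def by blast+
  have "AE x in lborel. \<forall>A\<in>G. \<forall>n. good r x (\<psi> n A) \<and> good r' x (\<psi> n A)"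
    unfolding AE_ball_countable[OF G(1)] AE_all_countable
  proof (intro ballI allI)
    show "AE x in lborel. good r x (\<psi> n A) \<and> good r' x (\<psi> n A)" for n A
      by (rule AE_conjI[OF gr(1) gr(2)])
  qed
  then show ?thesis
  proof (rule eventually_mono)
    fix x assume x: "\<forall>A\<in>G. \<forall>n. good r x (\<psi> n A) \<and> good r' x (\<psi> n A)"
    have m [measurable]: "(\<lambda>y. r x y) \<in> borel_measurable borel" "(\<lambda>y. r' x y) \<in> borel_measurable borel"
      by (rule kernel_measurable[OF rm, where f = "\<lambda>_. x"] kernel_measurable[OF r'm, where f = "\<lambda>_. x"]; measurable)+
    define d where "d y = r x y - r' x y" for y
    have [measurable]: "d \<in> borel_measurable borel" unfolding d_def by measurable
    have d: "integrable lborel (\<lambda>y. d y * indicator (S n A) y)"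
      "(LBINT y. d y * indicator (S n A) y) = 0" if A: "A \<in> G" for n A
    proof -
      have gg: "good r x (\<psi> n A)" "good r' x (\<psi> n A)" using x A by blast+
      have i: "integrable lborel (\<lambda>y. r x y * rep_L2 (\<psi> n A) y)" "integrable lborel (\<lambda>y. r' x y * rep_L2 (\<psi> n A) y)"
        and e: "(LBINT y. r x y * rep_L2 (\<psi> n A) y) = (LBINT y. r' x y * rep_L2 (\<psi> n A) y)"
        using gg unfolding good_def by (blast, blast, simp)
      have AE: "AE y in lborel. r x y * rep_L2 (\<psi> n A) y - r' x y * rep_L2 (\<psi> n A) y = d y * indicator (S n A) y"
        using \<psi>[OF A, of n] by eventually_elim (simp add: d_def left_diff_distrib)
      note [measurable] = \<open>A \<in> G\<close>
      show "integrable lborel (\<lambda>y. d y * indicator (S n A) y)"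
        using integrable_cong_AE[THEN iffD1, OF _ _ AE Bochner_Integration.integrable_diff[OF i]] by simp
      have "(LBINT y. d y * indicator (S n A) y) =
          (LBINT y. r x y * rep_L2 (\<psi> n A) y - r' x y * rep_L2 (\<psi> n A) y)"
        using AE by (intro integral_cong_AE) auto
      then show "(LBINT y. d y * indicator (S n A) y) = 0"
        using e Bochner_Integration.integral_diff[OF i] by simp
    qed
    have "AE y in lborel. d y * indicator (S n UNIV) y = 0" for n
    proof (rule G0)
      show "integrable lborel (\<lambda>y. d y * indicator (S n UNIV) y)" by (rule d(1)[OF G(2)])
      fix A assume "A \<in> G"
      have "(LINT y:A|lborel. d y * indicator (S n UNIV) y) = (LBINT y. d y * indicator (S n A) y)"
        unfolding set_lebesgue_integral_def
        by (rule Bochner_Integration.integral_cong) (auto simp: S_def indicator_def)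
      then show "(LINT y:A|lborel. d y * indicator (S n UNIV) y) = 0" using d(2)[OF \<open>A \<in> G\<close>] by simp
    qed
    then have "AE y in lborel. \<forall>n. d y * indicator (S n UNIV) y = 0" unfolding AE_all_countable by blast
    then show "AE y in lborel. r x y = r' x y"
    proof eventually_elim
      fix y assume y: "\<forall>n. d y * indicator (S n UNIV) y = 0"
      obtain n where "norm y \<le> real n" using real_arch_simple by blast
      then have "y \<in> S n UNIV" by (simp add: S_def)
      then show "r x y = r' x y" using spec[OF y, of n] by (simp add: d_def)
    qed
  qed
qed

text \<open>A ball is not a null set. The point 0 is excluded because a limit at 0 is blind to
  it.\<close>

lemma AE_lborel_near_0:
  assumes "AE h in lborel. P (h :: 'a::euclidean_space)" and "0 < e"
  shows "\<exists>h. P h \<and> h \<noteq> 0 \<and> norm h < e"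
proof (rule ccontr)
  assume n: "\<not> ?thesis"
  have "AE h in lborel. h \<notin> ball (0::'a) e"
    using assms(1) AE_lborel_singleton[of 0] by eventually_elim (use n in auto)
  then have "ball (0::'a) e \<in> null_sets lborel"
    using AE_iff_null_sets[of "ball (0::'a) e" lborel] by simp
  then have "negligible (ball (0::'a) e)" by (simp add: negligible_iff_null_sets null_sets_completionI)
  then show False using assms(2) by (metis open_not_negligible open_ball ball_eq_empty not_le)
qed

text \<open>For almost every \<open>h\<close> the two kernels agree at \<open>(x, x + h)\<close> for almost every \<open>x\<close>; letting
  such \<open>h\<close> tend to \<open>0\<close>, the continuity in \<open>L\<^sup>1\<close> carries this over to the diagonal.\<close>

lemma integral_kernel_diagonal_unique:
  fixes R :: "'a::euclidean_space L2 op"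
  assumes r: "is_integral_kernel R r" and r': "is_integral_kernel R r'"
  shows "AE x in lborel. r x x = r' x x"
proof -
  have rm: "(\<lambda>(x, y). r x y) \<in> borel_measurable borel"
    and r'm: "(\<lambda>(x, y). r' x y) \<in> borel_measurable borel"
    using r r' unfolding is_integral_kernel_def by blast+
  have [measurable]: "(\<lambda>x. r x (x + k)) \<in> borel_measurable borel" "(\<lambda>x. r' x (x + k)) \<in> borel_measurable borel" for k
    by (rule kernel_measurable[OF rm, where f = "\<lambda>x. x"] kernel_measurable[OF r'm, where f = "\<lambda>x. x"]; measurable)+
  have m: "(\<lambda>p. r (fst p) (fst p + snd p) - r' (fst p) (fst p + snd p)) \<in> borel_measurable (lborel \<Otimes>\<^sub>M lborel)"
    by (intro borel_measurable_diff kernel_measurable[OF rm, where f = fst] kernel_measurable[OF r'm, where f = fst])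
      measurable
  have "AE x in lborel. AE h in lborel. r x (x + h) - r' x (x + h) = 0"
    using integral_kernel_unique[OF r r']
  proof (rule eventually_mono)
    fix x assume "AE y in lborel. r x y = r' x y"
    from AE_lborel_translate[OF this, of x]
    show "AE h in lborel. r x (x + h) - r' x (x + h) = 0" by (simp add: add.commute)
  qed
  \<comment> \<open>Fubini for null sets exchanges the two quantifiers; it needs the measurability
    of both kernels jointly in x and h.\<close>
  then have ae: "AE h in lborel. AE x in lborel. r x (x + h) - r' x (x + h) = 0"
  proof (subst (asm) lborel_pair.AE_commute)
    define d where "d p = r (fst p) (fst p + snd p) - r' (fst p) (fst p + snd p)" for p
    have [measurable]: "d \<in> borel_measurable (lborel \<Otimes>\<^sub>M lborel)"
      using m by (simp add: d_def[abs_def])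
    have "{p \<in> space (lborel \<Otimes>\<^sub>M lborel). d p = 0} \<in> sets (lborel \<Otimes>\<^sub>M lborel)"
      by measurable
    then show "{p \<in> space (lborel \<Otimes>\<^sub>M lborel). r (fst p) (fst p + snd p) - r' (fst p) (fst p + snd p) = 0}
        \<in> sets (lborel \<Otimes>\<^sub>M lborel)" by (simp add: d_def)
  qed
  define I where "I r k = (LBINT x. cmod (r x (x + k) - r x (x + 0)))" for r :: "'a \<Rightarrow> 'a \<Rightarrow> complex" and k
  have int: "integrable lborel (\<lambda>x. r x (x + k))" "integrable lborel (\<lambda>x. r' x (x + k))" for k
    using r r' unfolding is_integral_kernel_def by blast+
  have int0: "integrable lborel (\<lambda>x. r x x)" "integrable lborel (\<lambda>x. r' x x)"
    using int[of 0] by simp_all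
  have lim: "(I r \<longlongrightarrow> 0) (at 0)" "(I r' \<longlongrightarrow> 0) (at 0)"
    using r r' unfolding is_integral_kernel_def I_def[abs_def] by blast+
  define J where "J = (LBINT x. cmod (r x x - r' x x))"
  have J: "J \<le> I r k + I r' k" if k: "AE x in lborel. r x (x + k) - r' x (x + k) = 0" for k
  proof -
    have "J \<le> (LBINT x. cmod (r x (x + k) - r x x) + cmod (r' x (x + k) - r' x x))"
      unfolding J_def
    proof (rule integral_mono_AE)
      show "integrable lborel (\<lambda>x. cmod (r x x - r' x x))" using int0 by auto
      show "integrable lborel (\<lambda>x. cmod (r x (x + k) - r x x) + cmod (r' x (x + k) - r' x x))"
        using int int0 by auto
      show "AE x in lborel. cmod (r x x - r' x x) \<le> cmod (r x (x + k) - r x x) + cmod (r' x (x + k) - r' x x)"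
        using k
      proof eventually_elim
        fix x assume "r x (x + k) - r' x (x + k) = 0"
        then have "r x x - r' x x = (r' x (x + k) - r' x x) - (r x (x + k) - r x x)" by simp
        then show "cmod (r x x - r' x x) \<le> cmod (r x (x + k) - r x x) + cmod (r' x (x + k) - r' x x)"
          using norm_triangle_ineq4[of "r' x (x + k) - r' x x" "r x (x + k) - r x x"] by simp
      qed
    qed
    also have "\<dots> = I r k + I r' k"
      unfolding I_def using int int0 by (subst Bochner_Integration.integral_add) auto
    finally show ?thesis .
  qed
  have "J \<le> 0"
  proof (rule field_le_epsilon)
    fix e :: real assume "0 < e"
    have "((\<lambda>k. I r k + I r' k) \<longlongrightarrow> 0) (at 0)" using tendsto_add[OF lim] by simp
    then obtain \<delta> where \<delta>: "0 < \<delta>" "\<And>k. k \<noteq> 0 \<Longrightarrow> norm k < \<delta> \<Longrightarrow> norm (I r k + I r' k) < e"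
      using \<open>0 < e\<close> unfolding LIM_def dist_norm by auto
    obtain k where "AE x in lborel. r x (x + k) - r' x (x + k) = 0" "k \<noteq> 0" "norm k < \<delta>"
      using AE_lborel_near_0[OF ae \<delta>(1)] by blast
    then show "J \<le> 0 + e" using J[of k] \<delta>(2)[of k] by simp
  qed
  then have "J = 0" unfolding J_def by (simp add: antisym integral_nonneg_AE)
  then have "AE x in lborel. cmod (r x x - r' x x) = 0"
    unfolding J_def using int0 by (subst (asm) integral_nonneg_eq_0_iff_AE) auto
  then show ?thesis by eventually_elim simp
qed

section \<open>Fourier inversion\<close>

text \<open>The characteristic function of the standard normal distribution, cleared of its factor
  sqrt (2 * pi).\<close>

lemma gauss_1d:
  "integrable lborel (\<lambda>u::real. exp (\<i> * of_real (t * u)) * of_real (exp (- u\<^sup>2 / 2)))"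
  "(LBINT u. exp (\<i> * of_real (t * u)) * of_real (exp (- u\<^sup>2 / 2))) =
    of_real (sqrt (2 * pi) * exp (- t\<^sup>2 / 2))"
proof -
  let ?e = "\<lambda>u::real. exp (\<i> * of_real (t * u)) * of_real (exp (- u\<^sup>2 / 2))"
  have e: "?e u = of_real (sqrt (2 * pi)) * (std_normal_density u *\<^sub>R iexp (t * u))" for u
    by (simp add: std_normal_density_def scaleR_conv_of_real field_simps)
  have i: "integrable lborel (\<lambda>u. std_normal_density u *\<^sub>R iexp (t * u))"
  proof (rule Bochner_Integration.integrable_bound)
    show "integrable lborel std_normal_density" by simp
    show "AE x in lborel. norm (std_normal_density x *\<^sub>R iexp (t * x)) \<le> norm (std_normal_density x)"
      by (intro AE_I2) simp
  qed measurable
  show "integrable lborel ?e" unfolding e by (rule integrable_mult_right[OF i])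
  have "char std_normal_distribution t = (LBINT u. std_normal_density u *\<^sub>R iexp (t * u))"
    unfolding char_def by (subst integral_density) auto
  moreover have "integral\<^sup>L lborel ?e =
      of_real (sqrt (2 * pi)) * (LBINT u. std_normal_density u *\<^sub>R iexp (t * u))"
    unfolding e by (rule Bochner_Integration.integral_mult_right_zero)
  ultimately show "integral\<^sup>L lborel ?e = of_real (sqrt (2 * pi) * exp (- t\<^sup>2 / 2))"
    unfolding of_real_mult by (metis char_std_normal_distribution)
qed

text \<open>\<open>lborel\<close> is the image of the product of the one-dimensional measures along
  the coordinates, so Fubini integrates product functions factor by factor.\<close>

lemma lborel_integral_prod:
  fixes f :: "'a::euclidean_space \<Rightarrow> real \<Rightarrow> complex"
  assumes f: "\<And>b. b \<in> Basis \<Longrightarrow> integrable lborel (f b)"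
  shows "integrable lborel (\<lambda>x. \<Prod>b\<in>Basis. f b (x \<bullet> b))"
    and "(LBINT x. (\<Prod>b\<in>Basis. f b (x \<bullet> b))) = (\<Prod>b\<in>Basis. integral\<^sup>L lborel (f b))"
proof -
  interpret product_sigma_finite "\<lambda>_::'a. lborel :: real measure" ..
  let ?P = "Pi\<^sub>M Basis (\<lambda>_::'a. lborel :: real measure)"
  let ?e = "\<lambda>h. \<Sum>b\<in>Basis. h b *\<^sub>R b :: 'a"
  have [measurable]: "f b \<in> borel_measurable borel" if "b \<in> Basis" for b
    using borel_measurable_integrable[OF f[OF that]] by simp
  have e [measurable]: "?e \<in> ?P \<rightarrow>\<^sub>M borel" by measurable
  have m [measurable]: "(\<lambda>x. \<Prod>b\<in>Basis. f b (x \<bullet> b)) \<in> borel_measurable borel" by measurable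
  have eq: "(\<lambda>h. \<Prod>b\<in>Basis. f b (?e h \<bullet> b)) = (\<lambda>h. \<Prod>b\<in>Basis. f b (h b))"
    by (intro ext prod.cong refl) (simp add: inner_sum_left_Basis)
  show "integrable lborel (\<lambda>x. \<Prod>b\<in>Basis. f b (x \<bullet> b))"
    unfolding lborel_eq[where 'a = 'a]
    by (subst integrable_distr_eq[OF e m], subst eq) (rule product_integrable_prod[OF finite_Basis f])
  show "(LBINT x. (\<Prod>b\<in>Basis. f b (x \<bullet> b))) = (\<Prod>b\<in>Basis. integral\<^sup>L lborel (f b))"
    unfolding lborel_eq[where 'a = 'a]
    by (subst integral_distr[OF e m], subst eq) (rule product_integral_prod[OF finite_Basis f])
qed

lemma exp_norm_square_Basis: "exp (- (norm u)\<^sup>2 / 2) = (\<Prod>b\<in>Basis. exp (- ((u::'a::euclidean_space) \<bullet> b)\<^sup>2 / 2))"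
proof -
  have "(norm u)\<^sup>2 = (\<Sum>b\<in>Basis. (u \<bullet> b)\<^sup>2)"
    unfolding power2_norm_eq_inner using euclidean_inner[of u u] by (simp add: power2_eq_square)
  then show ?thesis by (simp add: exp_sum[symmetric] sum_negf sum_divide_distrib)
qed

lemma gauss_fourier:
  fixes z :: "'a::euclidean_space"
  shows "integrable lborel (\<lambda>u. plane_wave u z * of_real (exp (- (norm u)\<^sup>2 / 2)))"
    and "(LBINT u. plane_wave u z * of_real (exp (- (norm u)\<^sup>2 / 2))) =
      of_real (sqrt (2 * pi) ^ DIM('a) * exp (- (norm z)\<^sup>2 / 2))"
proof -
  let ?f = "\<lambda>b u. exp (\<i> * of_real ((z \<bullet> b) * u)) * of_real (exp (- u\<^sup>2 / 2))"
  have eq: "plane_wave u z * of_real (exp (- (norm u)\<^sup>2 / 2)) = (\<Prod>b\<in>Basis. ?f b (u \<bullet> b))" for u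
  proof -
    have "plane_wave u z = (\<Prod>b\<in>Basis. exp (\<i> * of_real ((z \<bullet> b) * (u \<bullet> b))))"
      unfolding plane_wave_def by (subst euclidean_inner) (simp add: exp_sum[symmetric] sum_distrib_left mult.commute)
    then show ?thesis unfolding exp_norm_square_Basis of_real_prod prod.distrib by simp
  qed
  show "integrable lborel (\<lambda>u. plane_wave u z * of_real (exp (- (norm u)\<^sup>2 / 2)))"
    unfolding eq by (rule lborel_integral_prod(1)) (rule gauss_1d(1))
  have "(LBINT u. plane_wave u z * of_real (exp (- (norm u)\<^sup>2 / 2))) =
      (\<Prod>b\<in>Basis. of_real (sqrt (2 * pi) * exp (- (z \<bullet> b)\<^sup>2 / 2)))"
    unfolding eq by (subst lborel_integral_prod(2)) (simp_all only: gauss_1d)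
  then show "(LBINT u. plane_wave u z * of_real (exp (- (norm u)\<^sup>2 / 2))) =
      of_real (sqrt (2 * pi) ^ DIM('a) * exp (- (norm z)\<^sup>2 / 2))"
    unfolding exp_norm_square_Basis[of z] of_real_prod[symmetric] by (simp add: prod.distrib)
qed

lemma integral_lborel_affine:
  fixes f :: "'a::euclidean_space \<Rightarrow> complex"
  assumes [measurable]: "f \<in> borel_measurable borel" and s: "0 < s"
  shows "(LBINT x. f x) = of_real (s ^ DIM('a)) * (LBINT u. f (t + s *\<^sub>R u))"
proof -
  have "(LBINT x. f x) = (\<integral>x. f x \<partial>density (distr lborel borel (\<lambda>x. t + s *\<^sub>R x)) (\<lambda>_. ennreal (\<bar>s\<bar> ^ DIM('a))))"
    using s by (subst lborel_affine[of s t]) auto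
  also have "\<dots> = (\<integral>x. (s ^ DIM('a)) *\<^sub>R f x \<partial>distr lborel borel (\<lambda>x. t + s *\<^sub>R x))"
    using s by (subst integral_density) auto
  also have "\<dots> = (LBINT u. (s ^ DIM('a)) *\<^sub>R f (t + s *\<^sub>R u))"
    by (subst integral_distr) auto
  finally show ?thesis by (simp add: scaleR_conv_of_real)
qed

section \<open>Gaussian waves as Schwartz functions\<close>

text \<open>Polynomials in the coordinates. They give the invariant for iterated derivatives: every
  partial derivative of a Gaussian wave is a polynomial times that wave.\<close>

inductive cpoly :: "('a::euclidean_space \<Rightarrow> complex) \<Rightarrow> bool" where
  const: "cpoly (\<lambda>x. c)"
| linear: "cpoly (\<lambda>x. of_real (x \<bullet> v))"
| add: "cpoly p \<Longrightarrow> cpoly q \<Longrightarrow> cpoly (\<lambda>x. p x + q x)"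
| mult: "cpoly p \<Longrightarrow> cpoly q \<Longrightarrow> cpoly (\<lambda>x. p x * q x)"

text \<open>The direction is the first argument of D, so that for each fixed direction the
  derivative is again a polynomial in the point.\<close>

lemma cpoly_has_derivative:
  assumes "cpoly p"
  obtains D where "\<And>x. (p has_derivative (\<lambda>h. D h x)) (at x)" "\<And>h. cpoly (D h)"
proof -
  have "\<exists>D. (\<forall>x. (p has_derivative (\<lambda>h. D h x)) (at x)) \<and> (\<forall>h. cpoly (D h))"
    using assms
  proof induction
    case (const c)
    show ?case by (intro exI[of _ "\<lambda>h x. 0"]) (auto intro: cpoly.const)
  next
    case (linear v)
    show ?case
      by (intro exI[of _ "\<lambda>h x. of_real (h \<bullet> v)"])
        (auto intro!: cpoly.const derivative_eq_intros)
  next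
    case (add p q)
    then obtain D E where D: "\<forall>x. (p has_derivative (\<lambda>h. D h x)) (at x)" "\<forall>h. cpoly (D h)"
      and E: "\<forall>x. (q has_derivative (\<lambda>h. E h x)) (at x)" "\<forall>h. cpoly (E h)" by blast
    then show ?case
      by (intro exI[of _ "\<lambda>h x. D h x + E h x"]) (auto intro!: cpoly.add has_derivative_add)
  next
    case (mult p q)
    then obtain D E where D: "\<forall>x. (p has_derivative (\<lambda>h. D h x)) (at x)" "\<forall>h. cpoly (D h)"
      and E: "\<forall>x. (q has_derivative (\<lambda>h. E h x)) (at x)" "\<forall>h. cpoly (E h)" by blast
    then show ?case using mult.hyps
      by (intro exI[of _ "\<lambda>h x. p x * E h x + D h x * q x"])
        (auto intro!: cpoly.add cpoly.mult has_derivative_mult)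
  qed
  then show thesis using that by blast
qed

text \<open>The base 1 + norm x is at least 1, so exponents may be enlarged to a common one.\<close>

lemma cpoly_growth:
  assumes "cpoly p"
  obtains C m where "0 \<le> C" "\<And>x. cmod (p x) \<le> C * (1 + norm x) ^ m"
proof -
  have "\<exists>C m. 0 \<le> C \<and> (\<forall>x. cmod (p x) \<le> C * (1 + norm x) ^ m)"
    using assms
  proof induction
    case (const c)
    show ?case by (intro exI[of _ "cmod c"] exI[of _ 0]) auto
  next
    case (linear v)
    have "cmod (of_real (x \<bullet> v)) \<le> norm v * (1 + norm x) ^ 1" for x
      using Cauchy_Schwarz_ineq2[of x v] by (simp add: algebra_simps) (smt (verit) norm_ge_zero)
    then show ?case by (metis norm_ge_zero)
  next
    case (add p q)
    then obtain C m C' m' where C: "0 \<le> C" "\<And>x. cmod (p x) \<le> C * (1 + norm x) ^ m"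
      and C': "0 \<le> C'" "\<And>x. cmod (q x) \<le> C' * (1 + norm x) ^ m'" by blast
    have "cmod (p x + q x) \<le> (C + C') * (1 + norm x) ^ (m + m')" for x
    proof -
      have "C * (1 + norm x) ^ m \<le> C * (1 + norm x) ^ (m + m')"
        "C' * (1 + norm x) ^ m' \<le> C' * (1 + norm x) ^ (m + m')"
        using C C' by (auto intro!: mult_left_mono power_increasing)
      then show ?thesis
        using norm_triangle_ineq[of "p x" "q x"] C(2)[of x] C'(2)[of x] by (simp add: distrib_right)
    qed
    then show ?case using C(1) C'(1) by (metis add_nonneg_nonneg)
  next
    case (mult p q)
    then obtain C m C' m' where C: "0 \<le> C" "\<And>x. cmod (p x) \<le> C * (1 + norm x) ^ m"
      and C': "0 \<le> C'" "\<And>x. cmod (q x) \<le> C' * (1 + norm x) ^ m'" by blast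
    have "cmod (p x * q x) \<le> (C * C') * (1 + norm x) ^ (m + m')" for x
    proof -
      have "cmod (p x * q x) \<le> (C * (1 + norm x) ^ m) * (C' * (1 + norm x) ^ m')"
        unfolding norm_mult using C C' by (intro mult_mono) auto
      then show ?thesis by (simp add: power_add ac_simps)
    qed
    then show ?case using C(1) C'(1) by (metis mult_nonneg_nonneg)
  qed
  then show thesis using that by blast
qed

text \<open>A plane wave at position y, as a function of the frequency, damped so that it becomes an
  admissible test function. The parameter s is the width of its Fourier transform.\<close>

definition gauss_wave :: "real \<Rightarrow> 'a::euclidean_space \<Rightarrow> 'a \<Rightarrow> complex" where
  "gauss_wave s y \<omega> = plane_wave \<omega> y * of_real (exp (- (s\<^sup>2 * (norm \<omega>)\<^sup>2 / 2)))"

lemma gauss_wave_has_derivative: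
  "(gauss_wave s y has_derivative
    (\<lambda>h. gauss_wave s y x * (\<i> * of_real (h \<bullet> y) - of_real (s\<^sup>2 * (x \<bullet> h))))) (at x)"
proof -
  have g: "gauss_wave s y = (\<lambda>\<omega>. exp (\<i> * of_real (\<omega> \<bullet> y) - of_real (s\<^sup>2 * (\<omega> \<bullet> \<omega>) / 2)))"
  proof
    have "exp (z - complex_of_real r) = exp z * complex_of_real (exp (- r))" for z r
      unfolding exp_of_real[symmetric] of_real_minus exp_add[symmetric] by simp
    then show "gauss_wave s y \<omega> = exp (\<i> * of_real (\<omega> \<bullet> y) - of_real (s\<^sup>2 * (\<omega> \<bullet> \<omega>) / 2))" for \<omega>
      by (simp only: gauss_wave_def plane_wave_def power2_norm_eq_inner)
  qed
  have "((\<lambda>\<omega>. \<i> * of_real (\<omega> \<bullet> y) - of_real (s\<^sup>2 * (\<omega> \<bullet> \<omega>) / 2)) has_derivative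
      (\<lambda>h. \<i> * of_real (h \<bullet> y) - of_real (s\<^sup>2 * (x \<bullet> h)))) (at x)"
    by (auto intro!: derivative_eq_intros simp: inner_commute algebra_simps)
  from has_derivative_compose[OF this, of exp "\<lambda>z. exp (\<i> * of_real (x \<bullet> y) - of_real (s\<^sup>2 * (x \<bullet> x) / 2)) * z"]
  show ?thesis unfolding g using DERIV_exp has_field_derivative_def by fastforce
qed

lemma cpoly_gauss_has_derivative:
  fixes p :: "'a::euclidean_space \<Rightarrow> complex"
  assumes "cpoly p"
  obtains D :: "'a \<Rightarrow> 'a \<Rightarrow> complex" where "\<And>x. ((\<lambda>x. p x * gauss_wave s y x) has_derivative (\<lambda>h. D h x * gauss_wave s y x)) (at x)"
    "\<And>h. cpoly (D h)"
proof -
  obtain D where D: "\<And>x. (p has_derivative (\<lambda>h. D h x)) (at x)" "\<And>h. cpoly (D h)"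
    using cpoly_has_derivative[OF assms] by blast
  define E where "E h x = D h x + p x * (\<i> * of_real (h \<bullet> y) + of_real (- s\<^sup>2) * of_real (x \<bullet> h))" for h x
  have "cpoly (E h)" for h
    unfolding E_def by (intro cpoly.intros D assms)
  moreover have "((\<lambda>x. p x * gauss_wave s y x) has_derivative (\<lambda>h. E h x * gauss_wave s y x)) (at x)" for x
    using has_derivative_mult[OF D(1)[of x] gauss_wave_has_derivative[of s y x]]
    by (rule has_derivative_eq_rhs) (auto simp: E_def algebra_simps)
  ultimately show thesis using that by blast
qed

text \<open>The induction varies p because \<open>partials\<close> recurses on the already
  differentiated function.\<close>

lemma partials_cpoly_gauss:
  "cpoly p \<Longrightarrow> \<exists>q. cpoly q \<and> partials bs (\<lambda>x. p x * gauss_wave s y x) = (\<lambda>x. q x * gauss_wave s y x)"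
proof (induction bs arbitrary: p)
  case (Cons b bs)
  obtain D where D: "\<And>x. ((\<lambda>x. p x * gauss_wave s y x) has_derivative (\<lambda>h. D h x * gauss_wave s y x)) (at x)"
    "\<And>h. cpoly (D h)"
    using cpoly_gauss_has_derivative[OF Cons.prems] by blast
  have "(\<lambda>x. frechet_derivative (\<lambda>x. p x * gauss_wave s y x) (at x) b) = (\<lambda>x. D b x * gauss_wave s y x)"
    by (simp add: frechet_derivative_at[OF D(1), symmetric])
  then show ?case using Cons.IH[OF D(2)[of b]] by simp
qed auto

lemma power_le_fact_exp:
  fixes u :: real
  assumes "0 \<le> u"
  shows "u ^ n \<le> fact n * exp u"
proof -
  have "(\<Sum>k\<in>{n}. u ^ k /\<^sub>R fact k) \<le> (\<Sum>k. u ^ k /\<^sub>R fact k)"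
    using assms summable_exp_generic[of u] by (intro sum_le_suminf) auto
  then have "u ^ n / fact n \<le> exp u" by (simp add: exp_def divide_inverse mult.commute)
  then show ?thesis by (simp add: field_simps)
qed

lemma gauss_wave_schwartz:
  assumes s: "0 < s"
  shows "schwartz (gauss_wave s (y::'a::euclidean_space))"
proof -
  have "\<exists>q. cpoly q \<and> partials bs (gauss_wave s y) = (\<lambda>x. q x * gauss_wave s y x)" for bs
    using partials_cpoly_gauss[OF cpoly.const[of 1], of bs s y] by simp
  then obtain q where q: "\<And>bs. cpoly (q bs)" "\<And>bs. partials bs (gauss_wave s y) = (\<lambda>x. q bs x * gauss_wave s y x)"
    by metis
  have "partials bs (gauss_wave s y) differentiable (at x)" for bs x
    unfolding q(2) differentiable_def using cpoly_gauss_has_derivative[OF q(1)] by metis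
  moreover have "bounded (range (\<lambda>x. norm x ^ k *\<^sub>R partials bs (gauss_wave s y) x))" for bs k
  proof -
    obtain C m where C: "0 \<le> C" "\<And>x. cmod (q bs x) \<le> C * (1 + norm x) ^ m"
      using cpoly_growth[OF q(1)] by blast
    \<comment> \<open>The factorial bound for powers replaces the polynomial growth by exp (1 + norm
      x); completing the square then bounds the exponent by 1 + 1 / (2 s^2).\<close>
    have "norm (norm x ^ k *\<^sub>R partials bs (gauss_wave s y) x) \<le> C * (fact (k + m) * exp (1 + 1 / (2 * s\<^sup>2)))" for x
    proof -
      let ?r = "norm x"
      have "norm (norm x ^ k *\<^sub>R partials bs (gauss_wave s y) x) = ?r ^ k * cmod (q bs x) * exp (- (s\<^sup>2 * ?r\<^sup>2 / 2))"
        unfolding q(2) by (simp add: gauss_wave_def norm_mult norm_power)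
      also have "\<dots> \<le> (1 + ?r) ^ k * (C * (1 + ?r) ^ m) * exp (- (s\<^sup>2 * ?r\<^sup>2 / 2))"
        using C by (intro mult_right_mono mult_mono power_mono) auto
      also have "\<dots> = C * ((1 + ?r) ^ (k + m) * exp (- (s\<^sup>2 * ?r\<^sup>2 / 2)))" by (simp add: power_add ac_simps)
      also have "\<dots> \<le> C * ((fact (k + m) * exp (1 + ?r)) * exp (- (s\<^sup>2 * ?r\<^sup>2 / 2)))"
        using C by (intro mult_left_mono mult_right_mono power_le_fact_exp) auto
      also have "\<dots> = C * (fact (k + m) * exp (1 + ?r - s\<^sup>2 * ?r\<^sup>2 / 2))"
        by (simp add: exp_add[symmetric] mult.assoc)
      also have "\<dots> \<le> C * (fact (k + m) * exp (1 + 1 / (2 * s\<^sup>2)))"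
      proof -
        have "0 \<le> (s * ?r - 1 / s)\<^sup>2" by simp
        also have "\<dots> = s\<^sup>2 * ?r\<^sup>2 - 2 * ?r + 1 / s\<^sup>2"
          using s by (simp add: power2_diff power_mult_distrib power_divide)
        finally have "?r - s\<^sup>2 * ?r\<^sup>2 / 2 \<le> 1 / (2 * s\<^sup>2)" by simp
        then show ?thesis using C by (intro mult_left_mono) auto
      qed
      finally show ?thesis .
    qed
    then show ?thesis by (auto simp: bounded_iff)
  qed
  ultimately show ?thesis by (simp add: schwartz_def smooth_def)
qed

lemma gauss_wave_measurable [measurable]: "gauss_wave s y \<in> borel_measurable borel"
  unfolding gauss_wave_def[abs_def] by measurable

text \<open>Rescaling the frequency by 1 / s reduces this to the standard Gaussian at (y - x) /
  s.\<close>

lemma fourier_gauss_wave: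
  fixes x y :: "'a::euclidean_space"
  assumes s: "0 < s"
  shows "fourier (gauss_wave s y) x =
    of_real ((sqrt (2 * pi) / s) ^ DIM('a) * exp (- (norm ((y - x) /\<^sub>R s))\<^sup>2 / 2))"
proof -
  have "gauss_wave s y \<omega> * exp (- \<i> * of_real (x \<bullet> \<omega>)) =
      plane_wave \<omega> (y - x) * of_real (exp (- (s\<^sup>2 * (norm \<omega>)\<^sup>2 / 2)))" for \<omega>
    by (simp add: gauss_wave_def plane_wave_def inner_diff_right exp_diff exp_minus inner_commute[of x] field_simps)
  then have "fourier (gauss_wave s y) x =
      (LBINT \<omega>. plane_wave \<omega> (y - x) * of_real (exp (- (s\<^sup>2 * (norm \<omega>)\<^sup>2 / 2))))"
    by (simp add: fourier_def)
  also have "\<dots> = of_real ((1 / s) ^ DIM('a)) *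
      (LBINT u. plane_wave (0 + (1 / s) *\<^sub>R u) (y - x) * of_real (exp (- (s\<^sup>2 * (norm (0 + (1 / s) *\<^sub>R u))\<^sup>2 / 2))))"
    using s by (intro integral_lborel_affine) auto
  also have "(\<lambda>u. plane_wave (0 + (1 / s) *\<^sub>R u) (y - x) * of_real (exp (- (s\<^sup>2 * (norm (0 + (1 / s) *\<^sub>R u))\<^sup>2 / 2)))) =
      (\<lambda>u. plane_wave u ((y - x) /\<^sub>R s) * of_real (exp (- (norm u)\<^sup>2 / 2)))"
  proof
    fix u :: 'a
    have "s\<^sup>2 * (norm (0 + (1 / s) *\<^sub>R u))\<^sup>2 = (norm u)\<^sup>2"
      using s by (simp add: power_divide)
    moreover have "(0 + (1 / s) *\<^sub>R u) \<bullet> (y - x) = u \<bullet> ((y - x) /\<^sub>R s)"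
      by (simp add: inverse_eq_divide)
    ultimately show "plane_wave (0 + (1 / s) *\<^sub>R u) (y - x) *
        of_real (exp (- (s\<^sup>2 * (norm (0 + (1 / s) *\<^sub>R u))\<^sup>2 / 2))) =
      plane_wave u ((y - x) /\<^sub>R s) * of_real (exp (- (norm u)\<^sup>2 / 2))"
      unfolding plane_wave_def by (simp only: minus_divide_left)
  qed
  finally show ?thesis
    unfolding gauss_fourier(2) by (simp add: power_divide)
qed

text \<open>The test functions \<open>gauss_wave s y\<close> have Fourier transforms that concentrate at \<open>y\<close>
  as \<open>s \<rightarrow> 0\<close>, while they themselves tend boundedly to \<open>plane_wave _ y\<close>.\<close>

lemma fourier_inversion:
  fixes V :: "'a::euclidean_space \<Rightarrow> real"
  assumes V: "continuous_on UNIV V" "bounded (range V)"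
    and \<mu>: "is_fourier_measure (distribution_of V) \<mu>"
  shows "of_real ((2 * pi) ^ DIM('a) * V y) = cm_integral \<mu> (\<lambda>\<omega>. plane_wave \<omega> y)"
proof -
  obtain m u where mu: "\<mu> = (m, u)" by (cases \<mu>)
  have bm: "bounded_complex_measure \<mu>" using \<mu> by (simp add: is_fourier_measure_def)
  then interpret finite_measure m by (simp add: mu bounded_complex_measure_def)
  have sm [measurable_cong]: "sets m = sets borel" and [measurable]: "u \<in> borel_measurable borel"
    and u: "\<And>\<omega>. cmod (u \<omega>) = 1"
    using bm by (auto simp: mu bounded_complex_measure_def)
  obtain K where K: "\<And>x. \<bar>V x\<bar> \<le> K" using V(2) by (auto simp: bounded_iff)
  have Vm [measurable]: "V \<in> borel_measurable borel" by (rule borel_measurable_continuous_onI[OF V(1)])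
  define s where "s n = 1 / real (Suc n)" for n
  have s0: "0 < s n" for n by (simp add: s_def)
  have s: "s \<longlonglongrightarrow> 0" unfolding s_def[abs_def] by (rule LIMSEQ_Suc[OF lim_1_over_n])
  define g where "g x = complex_of_real (exp (- (norm x)\<^sup>2 / 2))" for x :: 'a
  have gi: "integrable lborel g" using gauss_fourier(1)[of 0] by (simp add: g_def[abs_def] plane_wave_def)
  have gint: "integral\<^sup>L lborel g = of_real (sqrt (2 * pi) ^ DIM('a))"
    using gauss_fourier(2)[of 0] by (simp add: g_def[abs_def] plane_wave_def)
  have [measurable]: "g \<in> borel_measurable borel" unfolding g_def by measurable
  \<comment> \<open>Substituting y + s x for x cancels the factor s^(-d) in the height of the
    transform, and V is sampled ever closer to y.\<close>
  have L: "distribution_of V (fourier (gauss_wave (s n) y)) =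
      of_real (sqrt (2 * pi) ^ DIM('a)) * (LBINT x. of_real (V (y + s n *\<^sub>R x)) * g x)" for n
  proof -
    have "distribution_of V (fourier (gauss_wave (s n) y)) =
        (LBINT x. of_real ((sqrt (2 * pi) / s n) ^ DIM('a)) * (of_real (V x) * g ((y - x) /\<^sub>R s n)))"
      by (simp add: distribution_of_def fourier_gauss_wave[OF s0] g_def ac_simps)
    also have "\<dots> = of_real ((sqrt (2 * pi) / s n) ^ DIM('a)) * (LBINT x. of_real (V x) * g ((y - x) /\<^sub>R s n))"
      by simp
    also have "(LBINT x. of_real (V x) * g ((y - x) /\<^sub>R s n)) =
        of_real (s n ^ DIM('a)) * (LBINT x. of_real (V (y + s n *\<^sub>R x)) * g ((y - (y + s n *\<^sub>R x)) /\<^sub>R s n))"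
      by (rule integral_lborel_affine[OF _ s0]) measurable
    also have "(\<lambda>x. of_real (V (y + s n *\<^sub>R x)) * g ((y - (y + s n *\<^sub>R x)) /\<^sub>R s n)) = (\<lambda>x. of_real (V (y + s n *\<^sub>R x)) * g x)"
      using s0[of n] by (auto simp: g_def)
    finally show ?thesis using s0[of n] by (simp add: power_divide)
  qed
  have "(\<lambda>n. LBINT x. of_real (V (y + s n *\<^sub>R x)) * g x) \<longlonglongrightarrow> (LBINT x. of_real (V y) * g x)"
  proof (rule integral_dominated_convergence)
    show "integrable lborel (\<lambda>x. K * cmod (g x))" using gi by auto
    show "AE x in lborel. (\<lambda>n. of_real (V (y + s n *\<^sub>R x)) * g x) \<longlonglongrightarrow> of_real (V y) * g x"
    proof (rule AE_I2)
      fix x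
      have "(\<lambda>n. y + s n *\<^sub>R x) \<longlonglongrightarrow> y + 0 *\<^sub>R x" by (intro tendsto_intros s)
      then have "(\<lambda>n. V (y + s n *\<^sub>R x)) \<longlonglongrightarrow> V y"
        using continuous_on_tendsto_compose[OF V(1), of _ y] by simp
      then show "(\<lambda>n. of_real (V (y + s n *\<^sub>R x)) * g x) \<longlonglongrightarrow> of_real (V y) * g x"
        by (intro tendsto_intros)
    qed
    show "AE x in lborel. norm (of_real (V (y + s n *\<^sub>R x)) * g x) \<le> K * cmod (g x)" for n
      using K by (intro AE_I2) (auto simp: norm_mult intro: mult_right_mono)
  qed measurable
  then have "(\<lambda>n. distribution_of V (fourier (gauss_wave (s n) y))) \<longlonglongrightarrow>
      of_real (sqrt (2 * pi) ^ DIM('a)) * (of_real (V y) * of_real (sqrt (2 * pi) ^ DIM('a)))"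
    unfolding L by (intro tendsto_mult_left) (simp add: gint)
  \<comment> \<open>The constant (2 pi)^d arises as sqrt(2 pi)^d twice: from the height of the
    transform and from the mass of g.\<close>
  moreover have "of_real (sqrt (2 * pi) ^ DIM('a)) * (of_real (V y) * of_real (sqrt (2 * pi) ^ DIM('a))) =
      of_real ((2 * pi) ^ DIM('a) * V y)"
  proof -
    have "sqrt (2 * pi) ^ DIM('a) * sqrt (2 * pi) ^ DIM('a) = (sqrt (2 * pi) * sqrt (2 * pi)) ^ DIM('a)"
      by (rule power_mult_distrib[symmetric])
    also have "sqrt (2 * pi) * sqrt (2 * pi) = 2 * pi" by (rule real_sqrt_mult_self[THEN trans]) simp
    finally have "sqrt (2 * pi) ^ DIM('a) * (V y * sqrt (2 * pi) ^ DIM('a)) = (2 * pi) ^ DIM('a) * V y"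
      by (simp only: mult.left_commute[of _ "V y"] mult.commute[of _ "V y"])
    then show ?thesis by (simp only: of_real_mult[symmetric])
  qed
  moreover have "(\<lambda>n. distribution_of V (fourier (gauss_wave (s n) y))) \<longlonglongrightarrow> cm_integral \<mu> (\<lambda>\<omega>. plane_wave \<omega> y)"
  proof -
    have "distribution_of V (fourier (gauss_wave (s n) y)) = (\<integral>\<omega>. gauss_wave (s n) y \<omega> * u \<omega> \<partial>m)" for n
      using \<mu> gauss_wave_schwartz[OF s0, of n y] by (simp add: is_fourier_measure_def cm_integral_def mu)
    moreover have "(\<lambda>n. \<integral>\<omega>. gauss_wave (s n) y \<omega> * u \<omega> \<partial>m) \<longlonglongrightarrow> (\<integral>\<omega>. plane_wave \<omega> y * u \<omega> \<partial>m)"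
    proof (rule integral_dominated_convergence)
      show "integrable m (\<lambda>_. 1 :: real)" by simp
      show "AE \<omega> in m. (\<lambda>n. gauss_wave (s n) y \<omega> * u \<omega>) \<longlonglongrightarrow> plane_wave \<omega> y * u \<omega>"
      proof (rule AE_I2)
        fix \<omega>
        have "(\<lambda>n. gauss_wave (s n) y \<omega> * u \<omega>) \<longlonglongrightarrow>
            plane_wave \<omega> y * of_real (exp (- (0\<^sup>2 * (norm \<omega>)\<^sup>2 / 2))) * u \<omega>"
          unfolding gauss_wave_def by (intro tendsto_intros s) auto
        then show "(\<lambda>n. gauss_wave (s n) y \<omega> * u \<omega>) \<longlonglongrightarrow> plane_wave \<omega> y * u \<omega>" by simp
      qed
      show "AE \<omega> in m. norm (gauss_wave (s n) y \<omega> * u \<omega>) \<le> 1" for n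
        by (intro AE_I2) (simp add: gauss_wave_def norm_mult u)
    qed measurable
    ultimately show ?thesis by (simp add: cm_integral_def mu)
  qed
  ultimately show ?thesis using LIMSEQ_unique by metis
qed

section \<open>Factorized superoperators\<close>

text \<open>Fixes one rank-one series of R, so that A \<mapsto> trace (R A) is an absolutely
  convergent series for every bounded A.\<close>

locale rank_one_density =
  fixes R :: "'a::euclidean_space L2 op" and f :: "nat \<Rightarrow> 'a L2"
  assumes dens: "density_op R" and sf: "summable (\<lambda>n. (norm (f n))\<^sup>2)"
    and series: "\<And>v. (\<lambda>n. cinner (f n) v *\<^sub>C f n) sums R v"
    and trace: "\<And>A. op_trace (R o\<^sub>C A) = (\<Sum>n. cinner (f n) (cblinfun_apply A (f n)))"
begin

abbreviation "tr A \<equiv> op_trace (R o\<^sub>C A)"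

lemma term_bound:
  assumes "norm (B (f n)) \<le> K * norm (f n)"
  shows "cmod (cinner (f n) (B (f n))) \<le> K * (norm (f n))\<^sup>2"
proof -
  have "cmod (cinner (f n) (B (f n))) \<le> norm (f n) * (K * norm (f n))"
    by (rule order_trans[OF cinner_Cauchy_Schwarz]) (intro mult_left_mono assms norm_ge_zero)
  then show ?thesis by (simp add: power2_eq_square ac_simps)
qed

lemma term_summable:
  assumes "\<And>v. norm (B v) \<le> K * norm v"
  shows "summable (\<lambda>n. cmod (cinner (f n) (B (f n))))"
  by (rule summable_comparison_test'[OF summable_mult[OF sf, of K]]) (simp add: term_bound assms)

definition S :: real where "S = (\<Sum>n. (norm (f n))\<^sup>2)"

lemma S_nonneg: "0 \<le> S"
  unfolding S_def by (rule suminf_nonneg[OF sf]) simp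

lemma trace_sums: "(\<lambda>n. cinner (f n) (cblinfun_apply A (f n))) sums tr A"
  unfolding trace by (rule summable_sums, rule summable_norm_cancel, rule term_summable) (rule norm_cblinfun)

lemma trace_bound:
  assumes "\<And>v. norm (cblinfun_apply A v) \<le> K * norm v"
  shows "cmod (tr A) \<le> S * K"
proof -
  have "cmod (tr A) \<le> (\<Sum>n. cmod (cinner (f n) (A (f n))))"
    unfolding trace by (rule summable_norm[OF term_summable[OF assms]])
  also have "\<dots> \<le> (\<Sum>n. K * (norm (f n))\<^sup>2)"
    by (rule suminf_le[OF term_bound term_summable summable_mult[OF sf]]) (rule assms)+
  also have "\<dots> = S * K" unfolding S_def by (simp add: suminf_mult[OF sf])
  finally show ?thesis .
qed

lemma trace_add: "tr (A + B) = tr A + tr B"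
  by (rule sums_unique2[OF trace_sums])
    (use sums_add[OF trace_sums[of A] trace_sums[of B]] in \<open>simp add: cblinfun_rep cinner_add_right\<close>)

lemma trace_scaleC: "tr (c *\<^sub>C A) = c * tr A"
  by (rule sums_unique2[OF trace_sums])
    (use sums_mult[OF trace_sums[of A], of c] in \<open>simp add: cblinfun_rep cinner_scaleC_right\<close>)

lemma trace_diff: "tr (A - B) = tr A - tr B"
  by (rule sums_unique2[OF trace_sums])
    (use sums_diff[OF trace_sums[of A] trace_sums[of B]] in \<open>simp add: cblinfun_rep cinner_diff_right\<close>)

text \<open>Strong continuity of B gives continuity of each term, and the uniform bound K dominates
  the series as Tannery's theorem requires.\<close>

lemma trace_continuous:
  assumes B: "\<And>v. continuous_on UNIV (\<lambda>\<omega> :: 'b::metric_space. cblinfun_apply (B \<omega>) v)"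
    and K: "\<And>\<omega> v. norm (cblinfun_apply (B \<omega>) v) \<le> K * norm v"
  shows "continuous_on UNIV (\<lambda>\<omega>. tr (B \<omega>))"
  unfolding trace
proof (intro continuous_at_imp_continuous_on ballI)
  fix w :: 'b
  show "isCont (\<lambda>\<omega>. \<Sum>n. cinner (f n) (B \<omega> (f n))) w"
  \<comment> \<open>Tannery's theorem needs a nontrivial filter; at an isolated point continuity is
    automatic.\<close>
  proof (cases "at w = bot")
    case True
    then show ?thesis by (simp add: isCont_def)
  next
    case False
    show ?thesis
      unfolding isCont_def
    proof (rule tannerys_theorem[THEN conjunct2, THEN conjunct2])
      fix n
      have "((\<lambda>\<omega>. B \<omega> (f n)) \<longlongrightarrow> B w (f n)) (at w)"
        using B[of "f n"] by (simp add: continuous_on_def)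
      then show "((\<lambda>\<omega>. cinner (f n) (B \<omega> (f n))) \<longlongrightarrow> cinner (f n) (B w (f n))) (at w)"
        by (rule bounded_linear.tendsto[OF bounded_linear_cinner_right])
    next
      show "\<forall>\<^sub>F (n, \<omega>) in sequentially \<times>\<^sub>F at w. norm (cinner (f n) (B \<omega> (f n))) \<le> K * (norm (f n))\<^sup>2"
        by (rule always_eventually) (auto intro!: term_bound K)
      show "summable (\<lambda>n. K * (norm (f n))\<^sup>2)" by (rule summable_mult[OF sf])
    qed (rule False)
  qed
qed

end

lemma density_op_rank_one_density:
  assumes "density_op R"
  obtains f where "rank_one_density R f"
proof -
  obtain f where "summable (\<lambda>n. (norm (f n))\<^sup>2)" "\<And>v. (\<lambda>n. cinner (f n) v *\<^sub>C f n) sums R v"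
    "\<And>A. op_trace (R o\<^sub>C A) = (\<Sum>n. cinner (f n) (A (f n)))"
    by (rule density_op_rank_one_series[OF assms]) blast
  then have "rank_one_density R f" using assms by unfold_locales
  then show thesis by (rule that)
qed

lemma norm_comp_apply: "norm (cblinfun_apply (A o\<^sub>C B) v) \<le> norm A * norm B * norm v"
  unfolding cblinfun_rep
  using order_trans[OF norm_cblinfun mult_left_mono[OF norm_cblinfun norm_ge_zero]] by (simp add: mult.assoc)

lemma E_op_comp_left: "norm (cblinfun_apply (E_op \<omega> o\<^sub>C A) v) \<le> norm A * norm v"
  by (simp add: cblinfun_rep norm_cblinfun)

lemma E_op_comp_right: "norm (cblinfun_apply (A o\<^sub>C E_op \<omega>) v) \<le> norm A * norm v"
  using norm_cblinfun[of A "E_op \<omega> v"] by (simp add: cblinfun_rep)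

definition trace_superop ::
    "'a::euclidean_space L2 op \<Rightarrow> 'a L2 op \<Rightarrow> ('a ^ 'n::finite) L2 op" where
  "trace_superop R A = op_trace (R o\<^sub>C A) *\<^sub>C id_op"

context rank_one_density
begin

lemma trace_continuous_left:
  "continuous_on UNIV (\<lambda>\<omega>. tr (E_op \<omega> o\<^sub>C A))"
  by (rule trace_continuous[OF _ E_op_comp_left]) (simp add: cblinfun_rep E_op_continuous)

lemma trace_continuous_right:
  "continuous_on UNIV (\<lambda>\<omega>. tr (A o\<^sub>C E_op \<omega>))"
  by (rule trace_continuous[OF _ E_op_comp_right])
    (simp add: cblinfun_rep bounded_linear.continuous_on[OF cblinfun_linear E_op_continuous])

lemma trace_continuous_E: "continuous_on UNIV (\<lambda>\<omega>. tr (E_op \<omega>))"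
  by (rule trace_continuous[where K = 1]) (simp_all add: E_op_continuous)

lemma continuous_uminus: "continuous_on UNIV h \<Longrightarrow> continuous_on UNIV (\<lambda>\<omega>::'a. h (- \<omega>) :: complex)"
  by (rule continuous_on_compose2[of UNIV h UNIV uminus]) (auto intro: continuous_intros)

text \<open>The inner map g covers the three superoperators that enter
  \<open>interaction_defined\<close>: B itself, B composed with A on the right, and on the
  left.\<close>

lemma trace_superop_clinear:
  fixes g :: "'a L2 op \<Rightarrow> 'a L2 op"
  assumes add: "\<And>B C. g (B + C) = g B + g C" and scale: "\<And>c B. g (c *\<^sub>C B) = c *\<^sub>C g B"
    and K: "\<And>B v. norm (cblinfun_apply (g B) v) \<le> norm B * K * norm v"
  shows "bounded_clinear (\<lambda>B. trace_superop R (g B) :: ('a ^ 'n::finite) L2 op)"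
  unfolding bounded_clinear_def
proof
  let ?h = "\<lambda>B. trace_superop R (g B) :: ('a ^ 'n) L2 op"
  have sc: "?h (c *\<^sub>C B) = c *\<^sub>C ?h B" for c B
    by (simp add: trace_superop_def scale trace_scaleC scaleC_scaleC)
  then show "\<forall>c B. ?h (c *\<^sub>C B) = c *\<^sub>C ?h B" by blast
  show "bounded_linear ?h"
  proof (rule bounded_linear_intro[where K = "S * K * norm (id_op :: ('a ^ 'n) L2 op)"])
    show "?h (B + C) = ?h B + ?h C" for B C
      by (simp add: trace_superop_def add trace_add scaleC_add_left)
    show "?h (r *\<^sub>R B) = r *\<^sub>R ?h B" for r B
      using sc[of "of_real r" B] by (simp add: scaleC_of_real)
    show "norm (?h B) \<le> norm B * (S * K * norm (id_op :: ('a ^ 'n) L2 op))" for B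
      using mult_right_mono[OF trace_bound[OF K[of B]], of "norm (id_op :: ('a ^ 'n) L2 op)"]
      by (simp add: trace_superop_def norm_scaleC ac_simps)
  qed
qed

lemma trace_superop_sym: "(trace_superop R :: _ \<Rightarrow> ('a ^ 'n::finite) L2 op) \<in> sym_superops"
proof -
  have "bounded_clinear (trace_superop R :: _ \<Rightarrow> ('a ^ 'n) L2 op)"
    by (rule trace_superop_clinear[where g = "\<lambda>B. B" and K = 1]) (simp_all add: norm_cblinfun)
  then show ?thesis
    unfolding sym_superops_def by (auto simp: trace_superop_def scaleC_id_in_sym_ops)
qed

lemma trace_superop_product:
  "op_trace (trace_superop R A o\<^sub>C trace_superop R B o\<^sub>C F) =
    tr A * tr B * op_trace F"
proof -
  have "trace_superop R A o\<^sub>C trace_superop R B o\<^sub>C F = (tr A * tr B) *\<^sub>C F"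
    by (rule cblinfun_eqI) (simp add: trace_superop_def cblinfun_rep scaleC_scaleC)
  then show ?thesis by (simp add: op_trace_scaleC)
qed

text \<open>By \<open>trace_superop_product\<close> the traces in \<open>EN\<close> split into two
  scalar traces against R and \<open>op_trace F\<close>, so strong continuity of \<open>E_op\<close>
  suffices.\<close>

lemma trace_superop_interaction_defined:
  "interaction_defined (trace_superop R :: _ \<Rightarrow> ('a ^ 'n::finite) L2 op) (trace_superop R)"
  unfolding interaction_defined_def
proof (intro allI conjI)
  fix A :: "'a L2 op"
  have 1: "bounded_clinear (trace_superop R :: _ \<Rightarrow> ('a ^ 'n) L2 op)"
    using trace_superop_sym by (auto simp: sym_superops_def)
  have 2: "bounded_clinear (\<lambda>B. trace_superop R (B o\<^sub>C A) :: ('a ^ 'n) L2 op)"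
  proof (rule trace_superop_clinear[where K = "norm A"])
    show "norm (cblinfun_apply (B o\<^sub>C A) v) \<le> norm B * norm A * norm v" for B v by (rule norm_comp_apply)
  qed (auto intro!: cblinfun_eqI simp: cblinfun_rep)
  have 3: "bounded_clinear (\<lambda>B. trace_superop R (A o\<^sub>C B) :: ('a ^ 'n) L2 op)"
  proof (rule trace_superop_clinear[where K = "norm A"])
    show "norm (cblinfun_apply (A o\<^sub>C B) v) \<le> norm B * norm A * norm v" for B v
      using norm_comp_apply[of A B v] by (simp add: mult.commute[of "norm A"])
  qed (auto intro!: cblinfun_eqI simp: cblinfun_rep cblinfun_add cblinfun_scaleC)
  show "(trace_superop R, \<lambda>B. trace_superop R (B o\<^sub>C A) :: ('a ^ 'n) L2 op) \<in> EN"
    unfolding EN_def adj_E_op using 1 2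
    by (auto simp: trace_superop_product intro!: continuous_intros trace_continuous_left continuous_uminus[OF trace_continuous_E])
  show "(\<lambda>B. trace_superop R (A o\<^sub>C B) :: ('a ^ 'n) L2 op, trace_superop R) \<in> EN"
    unfolding EN_def adj_E_op using 1 3
    by (auto simp: trace_superop_product intro!: continuous_intros trace_continuous_E continuous_uminus[OF trace_continuous_right])
qed

text \<open>Multiples of the identity commute, so the trace with the adjoint plane wave factors out
  of both products and a single scalar integral remains.\<close>

lemma interaction_trace_superop:
  "interaction D (trace_superop R) (trace_superop R) A =
    (of_real (1 / (2 * pi) ^ DIM('a)) * cm_integral (fourier_measure D)
      (\<lambda>\<omega>. tr (E_op (- \<omega>)) * (tr (E_op \<omega> o\<^sub>C A) - tr (A o\<^sub>C E_op \<omega>))))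
    *\<^sub>C (id_op :: ('a ^ 'n::finite) L2 op)"
proof -
  have "trace_superop R (E_op (- \<omega>)) o\<^sub>C trace_superop R (E_op \<omega> o\<^sub>C A) -
      trace_superop R (A o\<^sub>C E_op \<omega>) o\<^sub>C trace_superop R (E_op (- \<omega>)) =
      (tr (E_op (- \<omega>)) * (tr (E_op \<omega> o\<^sub>C A) - tr (A o\<^sub>C E_op \<omega>)))
        *\<^sub>C (id_op :: ('a ^ 'n) L2 op)" for \<omega>
    by (rule cblinfun_eqI)
      (simp add: trace_superop_def cblinfun_rep scaleC_scaleC scaleC_diff_left right_diff_distrib mult.commute)
  then show ?thesis
    unfolding interaction_def adj_E_op by (simp add: ultraweak_integral_id scaleC_scaleC)
qed

text \<open>The explicit kernel \<open>ker\<close> shows that \<open>SOME\<close> picks a genuine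
  kernel; the picked one shares its diagonal almost everywhere and hence its integrals.\<close>

lemma kernel_diagonal:
  "integrable lborel (\<lambda>z. integral_kernel R z z)"
  "(LBINT z. plane_wave \<omega> z * integral_kernel R z z) = tr (E_op \<omega>)"
  "(\<lambda>z. integral_kernel R z z) \<in> borel_measurable borel"
proof -
  obtain g where "L2_series f g" using L2_series_exists[OF sf] by blast
  then interpret L2_series f g .
  have k: "is_integral_kernel R ker" by (rule ker_is_integral_kernel[OF series])
  then have k': "is_integral_kernel R (integral_kernel R)"
    unfolding integral_kernel_def by (rule someI[where P = "is_integral_kernel R"])
  have "integrable lborel (\<lambda>z. integral_kernel R z (z + 0))"
    using k' unfolding is_integral_kernel_def by blast
  then show "integrable lborel (\<lambda>z. integral_kernel R z z)" by simp
  have "(\<lambda>(x, y). integral_kernel R x y) \<in> borel_measurable borel"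
    using k' unfolding is_integral_kernel_def by blast
  then show m [measurable]: "(\<lambda>z. integral_kernel R z z) \<in> borel_measurable borel"
    by (rule kernel_measurable[where f = "\<lambda>x. x"]) measurable
  have mk [measurable]: "(\<lambda>z. ker z z) \<in> borel_measurable borel"
    by (rule kernel_measurable[OF ker_measurable, where f = "\<lambda>x. x"]) measurable
  have "(LBINT z. plane_wave \<omega> z * integral_kernel R z z) = (LBINT z. plane_wave \<omega> z * ker z z)"
    using integral_kernel_diagonal_unique[OF k' k] by (intro integral_cong_AE) auto
  also have "\<dots> = tr (E_op \<omega>)"
    using sums_unique2[OF ker_diagonal_integral[of "plane_wave \<omega>" 1] trace_sums[of "E_op \<omega>", unfolded E_op_eq]]
    by (simp add: E_op_eq)
  finally show "(LBINT z. plane_wave \<omega> z * integral_kernel R z z) = tr (E_op \<omega>)" .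
qed

end

section \<open>The mean-field potential as a Fourier integral\<close>

text \<open>The measure m with phase u is the polar form of the Fourier transform of V; only its
  inversion formula enters from here on.\<close>

locale hartree_potential = rank_one_density R f + finite_measure m
  for R :: "'a::euclidean_space L2 op" and f :: "nat \<Rightarrow> 'a L2" and m :: "'a measure" +
  fixes V :: "'a \<Rightarrow> real" and u :: "'a \<Rightarrow> complex"
  assumes V: "continuous_on UNIV V"
    and sets_m [measurable_cong]: "sets m = sets borel"
    and u_meas [measurable]: "u \<in> borel_measurable borel"
    and u: "\<And>\<omega>. cmod (u \<omega>) = 1"
    and inversion: "\<And>x. of_real ((2 * pi) ^ DIM('a) * V x) = (\<integral>\<omega>. plane_wave \<omega> x * u \<omega> \<partial>m)"
begin

text \<open>\<open>\<rho>\<close> is the particle density and \<open>w\<close> the multiplier of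
  V_R, the convolution of V with \<open>\<rho>\<close>. As in the convolution theorem, its Fourier
  measure has the weight \<open>a\<close> with respect to m: the phase u times the transform trace
  (R E_{-\<omega>}) of the density. The constant \<open>c\<close> is that of Fourier
  inversion.\<close>

definition "\<rho> z = integral_kernel R z z"
definition "w x = (LBINT z. of_real (V (x - z)) * \<rho> z)"
definition "a \<omega> = tr (E_op (- \<omega>)) * u \<omega>"
definition "c = of_real (1 / (2 * pi) ^ DIM('a))"

lemma rho_measurable [measurable]: "\<rho> \<in> borel_measurable borel"
  using kernel_diagonal(3) by (simp add: \<rho>_def[abs_def])

lemma a_measurable [measurable]: "a \<in> borel_measurable borel"
proof -
  have [measurable]: "(\<lambda>\<omega>. tr (E_op (- \<omega>))) \<in> borel_measurable borel"
    by (rule borel_measurable_continuous_onI[OF continuous_uminus[OF trace_continuous_E]])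
  show ?thesis unfolding a_def[abs_def] by measurable
qed

lemma norm_a: "cmod (a \<omega>) \<le> S"
  using trace_bound[of "E_op (- \<omega>)" 1] by (simp add: a_def norm_mult u)

interpretation lm: pair_sigma_finite lborel m
  by (intro pair_sigma_finite.intro sigma_finite_lborel sigma_finite_measure_axioms)

text \<open>Integrable h, bounded b on a finite measure and unimodular p make the integrand
  integrable on the product. It serves twice: to expand V_R and to expand its matrix
  elements.\<close>

lemma Fubini_plane_wave:
  assumes h: "integrable lborel h" and [measurable]: "b \<in> borel_measurable borel"
    and b: "\<And>\<omega>. cmod (b \<omega>) \<le> K" and [measurable]: "p \<in> borel_measurable (lborel \<Otimes>\<^sub>M m)"
    and p: "\<And>x. cmod (p x) = 1"
  shows "(\<integral>x. h x * (\<integral>\<omega>. p (x, \<omega>) * b \<omega> \<partial>m) \<partial>lborel) = (\<integral>\<omega>. b \<omega> * (LBINT x. h x * p (x, \<omega>)) \<partial>m)"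
proof -
  have [measurable]: "h \<in> borel_measurable borel" using h by auto
  have "integrable (lborel \<Otimes>\<^sub>M m) (\<lambda>(x, \<omega>). h x * (p (x, \<omega>) * b \<omega>))"
  proof (rule lm.Fubini_integrable)
    have bi: "integrable m (\<lambda>\<omega>. norm (h x * (p (x, \<omega>) * b \<omega>)))" for x
      by (rule integrable_const_bound[where B = "cmod (h x) * K"])
        (auto simp: norm_mult p intro!: mult_left_mono b)
    then show "AE x in lborel. integrable m (\<lambda>\<omega>. case (x, \<omega>) of (x, \<omega>) \<Rightarrow> h x * (p (x, \<omega>) * b \<omega>))"
      by (intro AE_I2) (simp add: integrable_norm_iff)
    have "(\<lambda>x. \<integral>\<omega>. norm (h x * (p (x, \<omega>) * b \<omega>)) \<partial>m) = (\<lambda>x. cmod (h x) * (\<integral>\<omega>. cmod (b \<omega>) \<partial>m))"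
      by (simp add: norm_mult p)
    then show "integrable lborel (\<lambda>x. \<integral>\<omega>. norm (case (x, \<omega>) of (x, \<omega>) \<Rightarrow> h x * (p (x, \<omega>) * b \<omega>)) \<partial>m)"
      using h by simp
  qed measurable
  from lm.Fubini_integral[OF this]
  have "(\<integral>x. \<integral>\<omega>. h x * (p (x, \<omega>) * b \<omega>) \<partial>m \<partial>lborel) = (\<integral>\<omega>. (LBINT x. h x * (p (x, \<omega>) * b \<omega>)) \<partial>m)" by simp
  moreover have "(LBINT x. h x * (p (x, \<omega>) * b \<omega>)) = b \<omega> * (LBINT x. h x * p (x, \<omega>))" for \<omega>
  proof -
    have "(LBINT x. h x * (p (x, \<omega>) * b \<omega>)) = (LBINT x. b \<omega> * (h x * p (x, \<omega>)))"
      by (simp add: ac_simps)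
    then show ?thesis by (simp only: Bochner_Integration.integral_mult_right_zero)
  qed
  ultimately show ?thesis by simp
qed

text \<open>After inserting the inversion formula for V and exchanging integrals, the wave at x - z
  splits into factors in x and z, and the z-integral is a trace by
  \<open>kernel_diagonal\<close>.\<close>

lemma w_eq: "w x = c * (\<integral>\<omega>. plane_wave \<omega> x * a \<omega> \<partial>m)"
proof -
  have V': "of_real (V y) = c * (\<integral>\<omega>. plane_wave \<omega> y * u \<omega> \<partial>m)" for y
    unfolding inversion[symmetric] c_def by simp
  have "w x = (\<integral>z. c * (\<rho> z * (\<integral>\<omega>. plane_wave \<omega> (x - z) * u \<omega> \<partial>m)) \<partial>lborel)"
    unfolding w_def V' by (simp add: ac_simps)
  also have "\<dots> = c * (\<integral>z. \<rho> z * (\<integral>\<omega>. plane_wave \<omega> (x - z) * u \<omega> \<partial>m) \<partial>lborel)"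
    by (rule Bochner_Integration.integral_mult_right_zero)
  also have "(\<integral>z. \<rho> z * (\<integral>\<omega>. plane_wave \<omega> (x - z) * u \<omega> \<partial>m) \<partial>lborel) =
      (\<integral>\<omega>. u \<omega> * (LBINT z. \<rho> z * plane_wave \<omega> (x - z)) \<partial>m)"
    using Fubini_plane_wave[of \<rho> u 1 "\<lambda>(z, \<omega>). plane_wave \<omega> (x - z)"] kernel_diagonal(1)
    by (simp add: \<rho>_def[abs_def] u split_beta')
  also have "(\<lambda>\<omega>. u \<omega> * (LBINT z. \<rho> z * plane_wave \<omega> (x - z))) = (\<lambda>\<omega>. plane_wave \<omega> x * a \<omega>)"
  proof
    fix \<omega>
    have "(LBINT z. \<rho> z * plane_wave \<omega> (x - z)) = (LBINT z. plane_wave \<omega> x * (plane_wave (- \<omega>) z * integral_kernel R z z))"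
      by (simp add: \<rho>_def plane_wave_diff ac_simps)
    also have "\<dots> = plane_wave \<omega> x * tr (E_op (- \<omega>))"
      unfolding kernel_diagonal(2)[symmetric] by (rule Bochner_Integration.integral_mult_right_zero)
    finally show "u \<omega> * (LBINT z. \<rho> z * plane_wave \<omega> (x - z)) = plane_wave \<omega> x * a \<omega>"
      by (simp add: a_def ac_simps)
  qed
  finally show ?thesis .
qed

lemma w_measurable [measurable]: "w \<in> borel_measurable borel"
proof -
  have "(\<lambda>x. \<integral>\<omega>. plane_wave \<omega> x * a \<omega> \<partial>m) \<in> borel_measurable borel"
    by (rule borel_measurable_lebesgue_integral) measurable
  then show ?thesis unfolding w_eq[abs_def] by measurable
qed

text \<open>Read off from the Fourier representation; with it \<open>mult_op_rep\<close> applies to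
  w, so \<open>mult_op w\<close> really multiplies by w.\<close>

lemma norm_w: "cmod (w x) \<le> cmod c * (S * measure m (space m))"
proof -
  have b: "norm (plane_wave \<omega> x * a \<omega>) \<le> S" for \<omega> by (simp add: norm_mult norm_a)
  have "integrable m (\<lambda>\<omega>. plane_wave \<omega> x * a \<omega>)"
    by (rule integrable_const_bound[OF AE_I2[OF b]]) measurable
  then have "(\<integral>\<omega>. norm (plane_wave \<omega> x * a \<omega>) \<partial>m) \<le> (\<integral>\<omega>. S \<partial>m)"
    by (intro integral_mono integrable_norm b integrable_const)
  then have "cmod (\<integral>\<omega>. plane_wave \<omega> x * a \<omega> \<partial>m) \<le> (\<integral>\<omega>. S \<partial>m)"
    by (rule order_trans[OF integral_norm_bound])
  then show ?thesis unfolding w_eq norm_mult by (intro mult_left_mono) (auto simp: mult.commute)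
qed

lemma mean_field_eq: "mean_field V R = mult_op w"
  by (simp add: mean_field_def w_def[abs_def] \<rho>_def)

lemma cinner_mean_field: "cinner \<psi> (mult_op w \<phi>) = c * (\<integral>\<omega>. a \<omega> * cinner \<psi> (E_op \<omega> \<phi>) \<partial>m)"
proof -
  let ?h = "\<lambda>x. cnj (rep_L2 \<psi> x) * rep_L2 \<phi> x"
  have hi: "integrable lborel ?h" by (intro square_integrable_prod square_integrable_rep)
  have "cinner \<psi> (mult_op w \<phi>) = (LBINT x. cnj (rep_L2 \<psi> x) * (w x * rep_L2 \<phi> x))"
    by (rule cinner_mult_op[OF w_measurable norm_w])
  also have "\<dots> = (\<integral>x. c * (?h x * (\<integral>\<omega>. plane_wave \<omega> x * a \<omega> \<partial>m)) \<partial>lborel)"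
    unfolding w_eq by (simp add: ac_simps)
  also have "\<dots> = c * (\<integral>x. ?h x * (\<integral>\<omega>. plane_wave \<omega> x * a \<omega> \<partial>m) \<partial>lborel)"
    by (rule Bochner_Integration.integral_mult_right_zero)
  also have "(\<integral>x. ?h x * (\<integral>\<omega>. plane_wave \<omega> x * a \<omega> \<partial>m) \<partial>lborel) = (\<integral>\<omega>. a \<omega> * (LBINT x. ?h x * plane_wave \<omega> x) \<partial>m)"
    using Fubini_plane_wave[OF hi a_measurable norm_a, of "\<lambda>(x, \<omega>). plane_wave \<omega> x"] by (simp add: split_beta')
  also have "(\<lambda>\<omega>. a \<omega> * (LBINT x. ?h x * plane_wave \<omega> x)) = (\<lambda>\<omega>. a \<omega> * cinner \<psi> (E_op \<omega> \<phi>))"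
    by (simp add: cinner_E_op ac_simps)
  finally show ?thesis .
qed

text \<open>The factors P and Q let one formula serve both products in the commutator. The sum over
  n and the integral over \<omega> are exchanged under the bound S * norm P * norm Q * (norm (f
  n))^2, summable in n and constant on a finite measure.\<close>

lemma trace_mean_field:
  "tr (P o\<^sub>C mult_op w o\<^sub>C Q) = c * (\<integral>\<omega>. a \<omega> * tr (P o\<^sub>C E_op \<omega> o\<^sub>C Q) \<partial>m)"
proof -
  let ?b = "\<lambda>n \<omega>. cinner (f n) (P (E_op \<omega> (Q (f n))))"
  have bc: "continuous_on UNIV (?b n)" for n
    by (intro bounded_linear.continuous_on[OF bounded_linear_cinner_right]
        bounded_linear.continuous_on[OF cblinfun_linear] E_op_continuous)
  have [measurable]: "?b n \<in> borel_measurable borel" for n by (rule borel_measurable_continuous_onI[OF bc])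
  have nB: "norm (P (E_op \<omega> (Q v))) \<le> norm P * norm Q * norm v" for \<omega> v
  proof -
    have "norm (P (E_op \<omega> (Q v))) \<le> norm P * norm (E_op \<omega> (Q v))" by (rule norm_cblinfun)
    also have "\<dots> \<le> norm P * (norm Q * norm v)" by (simp add: mult_left_mono norm_cblinfun)
    finally show ?thesis by (simp add: mult.assoc)
  qed
  have nb: "cmod (?b n \<omega>) \<le> norm P * norm Q * (norm (f n))\<^sup>2" for n \<omega>
    by (rule term_bound[where B = "\<lambda>v. P (E_op \<omega> (Q v))", OF nB])
  have nab: "norm (a \<omega> * ?b n \<omega>) \<le> S * (norm P * norm Q * (norm (f n))\<^sup>2)" for n \<omega>
    unfolding norm_mult by (intro mult_mono norm_a nb S_nonneg) simp
  have i: "integrable m (\<lambda>\<omega>. a \<omega> * ?b n \<omega>)" for n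
    by (rule integrable_const_bound[OF AE_I2[OF nab]]) measurable
  have t: "cinner (f n) ((P o\<^sub>C mult_op w o\<^sub>C Q) (f n)) = c * (\<integral>\<omega>. a \<omega> * ?b n \<omega> \<partial>m)" for n
  proof -
    \<comment> \<open>Moving \<open>P\<close> to the left-hand side of the inner product makes the weak formula applicable.\<close>
    obtain z where z: "\<And>x. cinner z x = cinner (f n) (P x)" using adjoint_vector_exists[of "f n" P] by blast
    have "cinner (f n) ((P o\<^sub>C mult_op w o\<^sub>C Q) (f n)) = cinner z (mult_op w (Q (f n)))"
      by (simp add: z cblinfun_rep)
    also have "\<dots> = c * (\<integral>\<omega>. a \<omega> * cinner z (E_op \<omega> (Q (f n))) \<partial>m)" by (rule cinner_mean_field)
    finally show ?thesis by (simp only: z)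
  qed
  have su: "summable (\<lambda>n. norm (a \<omega> * ?b n \<omega>))" for \<omega>
    by (rule summable_comparison_test'[OF summable_mult[OF summable_mult[OF sf]]]) (use nab in simp)
  have si: "summable (\<lambda>n. \<integral>\<omega>. norm (a \<omega> * ?b n \<omega>) \<partial>m)"
  proof (rule summable_comparison_test'[OF summable_mult[OF summable_mult[OF sf]]])
    fix n
    have "(\<integral>\<omega>. norm (a \<omega> * ?b n \<omega>) \<partial>m) \<le> (\<integral>\<omega>. S * (norm P * norm Q * (norm (f n))\<^sup>2) \<partial>m)"
      by (intro integral_mono integrable_norm i nab integrable_const)
    then show "norm (\<integral>\<omega>. norm (a \<omega> * ?b n \<omega>) \<partial>m) \<le> (measure m (space m) * S) * ((norm P * norm Q) * (norm (f n))\<^sup>2)"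
      by (simp add: integral_nonneg_AE ac_simps)
  qed
  have "(\<lambda>n. \<integral>\<omega>. a \<omega> * ?b n \<omega> \<partial>m) sums (\<integral>\<omega>. (\<Sum>n. a \<omega> * ?b n \<omega>) \<partial>m)"
    by (rule sums_integral[OF i AE_I2[OF su] si])
  moreover have "(\<Sum>n. a \<omega> * ?b n \<omega>) = a \<omega> * tr (P o\<^sub>C E_op \<omega> o\<^sub>C Q)" for \<omega>
    using sums_unique[OF sums_mult[OF trace_sums[of "P o\<^sub>C E_op \<omega> o\<^sub>C Q"], of "a \<omega>"]] by (simp add: cblinfun_rep)
  ultimately have "(\<lambda>n. c * (\<integral>\<omega>. a \<omega> * ?b n \<omega> \<partial>m)) sums (c * (\<integral>\<omega>. a \<omega> * tr (P o\<^sub>C E_op \<omega> o\<^sub>C Q) \<partial>m))"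
    by (intro sums_mult) simp
  then show ?thesis
    using trace_sums[of "P o\<^sub>C mult_op w o\<^sub>C Q"] sums_unique2 unfolding t by blast
qed

lemma interaction_mean_field:
  assumes "fourier_measure D = (m, u)"
  shows "interaction D (trace_superop R) (trace_superop R) A =
    tr (mean_field V R o\<^sub>C A - A o\<^sub>C mean_field V R) *\<^sub>C (id_op :: ('a ^ 'n::finite) L2 op)"
proof -
  have l: "tr (mult_op w o\<^sub>C A) = c * (\<integral>\<omega>. a \<omega> * tr (E_op \<omega> o\<^sub>C A) \<partial>m)"
  proof -
    have "id_op o\<^sub>C B o\<^sub>C A = B o\<^sub>C A" for B by (rule cblinfun_eqI) (simp add: cblinfun_rep)
    then show ?thesis using trace_mean_field[of id_op A] by simp
  qed
  have r: "tr (A o\<^sub>C mult_op w) = c * (\<integral>\<omega>. a \<omega> * tr (A o\<^sub>C E_op \<omega>) \<partial>m)"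
  proof -
    have "A o\<^sub>C B o\<^sub>C id_op = A o\<^sub>C B" for B by (rule cblinfun_eqI) (simp add: cblinfun_rep)
    then show ?thesis using trace_mean_field[of A id_op] by simp
  qed
  \<comment> \<open>Integrability of the two halves is what permits splitting the integral of their
    difference.\<close>
  have int: "integrable m (\<lambda>\<omega>. a \<omega> * tr (B \<omega>))"
    if "continuous_on UNIV (\<lambda>\<omega>. tr (B \<omega>))" "\<And>\<omega> v. norm (cblinfun_apply (B \<omega>) v) \<le> norm A * norm v" for B
  proof (rule integrable_const_bound[OF AE_I2])
    show "norm (a \<omega> * tr (B \<omega>)) \<le> S * (S * norm A)" for \<omega>
      unfolding norm_mult by (intro mult_mono norm_a trace_bound that(2) S_nonneg) simp
    have [measurable]: "(\<lambda>\<omega>. tr (B \<omega>)) \<in> borel_measurable borel"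
      by (rule borel_measurable_continuous_onI[OF that(1)])
    show "(\<lambda>\<omega>. a \<omega> * tr (B \<omega>)) \<in> borel_measurable m" by measurable
  qed
  have "cm_integral (m, u) (\<lambda>\<omega>. tr (E_op (- \<omega>)) *
      (tr (E_op \<omega> o\<^sub>C A) - tr (A o\<^sub>C E_op \<omega>))) =
    (\<integral>\<omega>. a \<omega> * tr (E_op \<omega> o\<^sub>C A) - a \<omega> * tr (A o\<^sub>C E_op \<omega>) \<partial>m)"
    by (simp add: cm_integral_def a_def algebra_simps)
  also have "\<dots> = (\<integral>\<omega>. a \<omega> * tr (E_op \<omega> o\<^sub>C A) \<partial>m) - (\<integral>\<omega>. a \<omega> * tr (A o\<^sub>C E_op \<omega>) \<partial>m)"
    by (intro Bochner_Integration.integral_diff int trace_continuous_left trace_continuous_right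
        E_op_comp_left E_op_comp_right)
  finally show ?thesis
    unfolding interaction_trace_superop assms mean_field_eq trace_diff l r
    by (simp only: c_def right_diff_distrib)
qed

end

section \<open>Comparison of the two equations\<close>

text \<open>W is defined everywhere, so adding it keeps the domain of D; membership of A, K in the
  graph becomes the same condition on D with the bounded operator [W, A] subtracted from K.\<close>

lemma commutator_uadd:
  "(A, K) \<in> commutator (uadd D W) \<longleftrightarrow> (A, K - (W o\<^sub>C A - A o\<^sub>C W)) \<in> commutator D"
proof -
  have "(A \<psi>, K \<psi> + A (\<eta> + W \<psi>)) \<in> uadd D W \<longleftrightarrow> (A \<psi>, (K - (W o\<^sub>C A - A o\<^sub>C W)) \<psi> + A \<eta>) \<in> D" for \<psi> \<eta>
  proof -
    have "(A \<psi>, K \<psi> + A (\<eta> + W \<psi>)) \<in> uadd D W \<longleftrightarrow> (A \<psi>, K \<psi> + A (\<eta> + W \<psi>) - W (A \<psi>)) \<in> D"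
      unfolding uadd_def by (auto simp: algebra_simps) (metis add_diff_cancel_right' diff_add_cancel)
    also have "K \<psi> + A (\<eta> + W \<psi>) - W (A \<psi>) = (K - (W o\<^sub>C A - A o\<^sub>C W)) \<psi> + A \<eta>"
      by (simp add: cblinfun_rep cblinfun_add algebra_simps)
    finally show ?thesis .
  qed
  moreover have "(\<forall>(\<psi>, \<eta>)\<in>uadd D W. P \<psi> \<eta>) \<longleftrightarrow> (\<forall>(\<psi>, \<eta>)\<in>D. P \<psi> (\<eta> + W \<psi>))" for P
    unfolding uadd_def by auto
  ultimately show ?thesis unfolding commutator_def by simp
qed

text \<open>In one direction c \<mapsto> c I is bounded linear; in the other the scalar is recovered
  by the bounded functional T \<mapsto> cinner x (T x) with a unit vector x.\<close>

lemma has_vector_derivative_scaleC_id: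
  "((\<lambda>s. g s *\<^sub>C (id_op :: 'a::euclidean_space L2 op)) has_vector_derivative v *\<^sub>C id_op) F \<longleftrightarrow>
    (g has_vector_derivative v) F"
proof
  assume "(g has_vector_derivative v) F"
  then show "((\<lambda>s. g s *\<^sub>C (id_op :: 'a L2 op)) has_vector_derivative v *\<^sub>C id_op) F"
    by (rule bounded_linear.has_vector_derivative[OF bounded_linear_scaleC_left])
next
  assume h: "((\<lambda>s. g s *\<^sub>C (id_op :: 'a L2 op)) has_vector_derivative v *\<^sub>C id_op) F"
  obtain x :: "'a L2" where x: "norm x = 1" using unit_vector_L2_exists by blast
  have "bounded_linear (\<lambda>T :: 'a L2 op. T x)"
    by (rule bounded_linear_intro[where K = "norm x"])
      (simp_all add: cblinfun_rep scaleR_cblinfun.rep_eq norm_cblinfun)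
  then have "bounded_linear (\<lambda>T :: 'a L2 op. cinner x (T x))"
    by (rule bounded_linear_compose[OF bounded_linear_cinner_right])
  from bounded_linear.has_vector_derivative[OF this h]
  show "(g has_vector_derivative v) F"
    by (simp add: cblinfun_rep cinner_scaleC_right cinner_self x)
qed

theorem theorem3p7:
  fixes hbar :: real and V :: "real ^ 'd \<Rightarrow> real"
    and R :: "real \<Rightarrow> (real ^ 'd) L2 op"
    and RR :: "real \<Rightarrow> (real ^ 'd) L2 op \<Rightarrow> ((real ^ 'd) ^ 'n) L2 op"
  assumes "hbar > 0" and "CARD('n) \<ge> 2"
    and "continuous_on UNIV V" and "bounded (range V)" and "\<And>x. V (- x) = V x"
    and "\<exists>\<mu>. is_fourier_measure (distribution_of V) \<mu>"
    and "\<And>t. density_op (R t)"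
    and "\<And>t A. RR t A = op_trace (R t o\<^sub>C A) *\<^sub>C id_op"
  shows "(\<forall>t. RR t \<in> sym_superops \<and> interaction_defined (RR t) (RR t)) \<and>
    (evolution_solution hbar V RR \<longleftrightarrow> hartree_solution hbar V R)"
proof -
  have RR: "RR t = trace_superop (R t)" for t
    using assms(8) by (intro ext) (simp add: trace_superop_def)
  let ?\<mu> = "fourier_measure (distribution_of V)"
  obtain m u where mu: "?\<mu> = (m, u)" by (cases ?\<mu>)
  \<comment> \<open>Inversion holds for every Fourier measure of V, hence for the one chosen by
    \<open>SOME\<close>.\<close>
  have F: "is_fourier_measure (distribution_of V) ?\<mu>"
    unfolding fourier_measure_def using assms(6) by (rule someI_ex)
  then have bm: "bounded_complex_measure (m, u)" by (simp add: is_fourier_measure_def mu)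
  \<comment> \<open>These side conditions are conjuncts of \<open>evolution_solution\<close>; once
    they hold, only the derivative conditions have to be compared.\<close>
  have def: "\<forall>t. RR t \<in> sym_superops \<and> interaction_defined (RR t) (RR t)"
  proof
    fix t
    obtain f where "rank_one_density (R t) f" using density_op_rank_one_density[OF assms(7)] by blast
    then interpret rank_one_density "R t" f .
    show "RR t \<in> sym_superops \<and> interaction_defined (RR t) (RR t)"
      unfolding RR by (intro conjI trace_superop_sym trace_superop_interaction_defined)
  qed
  let ?W = "\<lambda>t. mean_field V (R t)"
  let ?C = "\<lambda>t A. ?W t o\<^sub>C A - A o\<^sub>C ?W t"
  have inter: "interaction (distribution_of V) (RR t) (RR t) A = op_trace (R t o\<^sub>C ?C t A) *\<^sub>C id_op"
    and diff: "op_trace (R t o\<^sub>C (K - L)) = op_trace (R t o\<^sub>C K) - op_trace (R t o\<^sub>C L)" for t A K L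
  proof -
    \<comment> \<open>The rank-one series depends on t, so the locales are entered separately at
      each time.\<close>
    obtain f where d: "rank_one_density (R t) f" using density_op_rank_one_density[OF assms(7)] by blast
    have "hartree_potential (R t) f m V u"
    proof (intro hartree_potential.intro d hartree_potential_axioms.intro)
      show "of_real ((2 * pi) ^ DIM(real ^ 'd) * V x) = (\<integral>\<omega>. plane_wave \<omega> x * u \<omega> \<partial>m)" for x
        using fourier_inversion[OF assms(3,4) F, of x] by (simp add: mu cm_integral_def)
    qed (use bm assms(3) in \<open>auto simp: bounded_complex_measure_def\<close>)
    then interpret hartree_potential "R t" f m V u .
    show "interaction (distribution_of V) (RR t) (RR t) A = op_trace (R t o\<^sub>C ?C t A) *\<^sub>C id_op"
      unfolding RR by (rule interaction_mean_field[OF mu])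
    show "op_trace (R t o\<^sub>C (K - L)) = op_trace (R t o\<^sub>C K) - op_trace (R t o\<^sub>C L)" by (rule trace_diff)
  qed
  define P where "P t A L \<longleftrightarrow> ((\<lambda>s. \<i> * of_real hbar * op_trace (R s o\<^sub>C A))
      has_vector_derivative - op_trace (R t o\<^sub>C L)) (at t)" for t and A L :: "(real ^ 'd) L2 op"
  have step: "((\<lambda>s. (\<i> * of_real hbar) *\<^sub>C RR s A) has_vector_derivative
      (- RR t K - interaction (distribution_of V) (RR t) (RR t) A)) (at t) \<longleftrightarrow> P t A (K + ?C t A)" for t A K
  proof -
    \<comment> \<open>The signs combine: -trace (R K) - trace (R [V_R, A]) is the Hartree right-hand
      side for the commutator K + [V_R, A].\<close>
    have "- RR t K - interaction (distribution_of V) (RR t) (RR t) A = (- op_trace (R t o\<^sub>C (K + ?C t A))) *\<^sub>C id_op"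
      using diff[of t "K + ?C t A" "?C t A"]
      by (simp add: inter assms(8) scaleC_minus_left scaleC_diff_left)
    moreover have "(\<i> * of_real hbar) *\<^sub>C RR s A = (\<i> * of_real hbar * op_trace (R s o\<^sub>C A)) *\<^sub>C id_op" for s
      by (simp add: assms(8) scaleC_scaleC)
    ultimately show ?thesis by (simp only: has_vector_derivative_scaleC_id P_def)
  qed
  have "evolution_solution hbar V RR \<longleftrightarrow>
      (\<forall>t A K. A \<in> Domain (commutator laplacian) \<longrightarrow> (A, K) \<in> commutator (kinetic hbar) \<longrightarrow> P t A (K + ?C t A))"
    unfolding evolution_solution_def ad_star_def step[symmetric] using def by blast
  \<comment> \<open>K runs over all bounded operators, so it may be replaced by K - [V_R, A]; the
    premise then says that K is the commutator with the full Hartree Hamiltonian.\<close>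
  also have "\<dots> \<longleftrightarrow> (\<forall>t A K. A \<in> Domain (commutator laplacian) \<longrightarrow> (A, K - ?C t A) \<in> commutator (kinetic hbar) \<longrightarrow> P t A K)"
    by (metis add_diff_cancel_right' diff_add_cancel)
  also have "\<dots> \<longleftrightarrow> hartree_solution hbar V R"
    unfolding hartree_solution_def commutator_uadd P_def ..
  finally show ?thesis using def by blast
qed

end
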